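(* Let $\ell\ge 2$. The derivations $\varphi_1,\dots,\varphi_\ell$ together with the Euler derivation $\theta_E := z\frac{\partial}{\partial z}+\sum_{i=1}^{\ell}x_i\frac{\partial}{\partial x_i}$ form a basis of the $S$-module $D(\mathbf{c}\mathcal{S}(D_\ell))$, where $\mathbf{c}\mathcal{S}(D_\ell)$ is the cone over the Shi arrangement of type $D_\ell$.
   Context: Setting: $V=\mathbb{R}^{\ell+1}$ with coordinates $x_1,\dots,x_\ell,z$, and $S=\mathbb{R}[x_1,\dots,x_\ell,z]$. $\mathrm{Der}_S$ is the $S$-module of $\mathbb{R}$-linear derivations $\theta:S\to S$. For a central hyperplane arrangement $\mathcal{A}$ in $V$ (a finite set of hyperplanes $H=\ker\alpha_H$ through the origin, $\alpha_H\in V^*$), $D(\mathcal{A})=\{\theta\in\mathrm{Der}_S \mid \theta(\alpha_H)\in\alpha_H S \text{ for all } H\in\mathcal{A}\}$. The cone $\mathbf{c}\mathcal{S}(D_\ell)$ over the Shi arrangement of type $D_\ell$ is the central arrangement in $V$ consisting of the hyperplane $z=0$ and the hyperplanes $x_s+\epsilon x_t=0$ and $x_s+\epsilon x_t-z=0$ for $1\le s<t\le\ell$, $\epsilon\in\{-1,1\}$. For integers $p\ge -1$, $q\ge 0$, $B_{p,q}(x)$ denotes the unique rational function in $x$ satisfying $B_{p,q}(x+1)-B_{p,q}(x)=\frac{(x+1)^p-(-x)^p}{(x+1)-(-x)}(x+1)^q(-x)^q$ and $B_{p,q}(-x)=-B_{p,q}(x)$ (it is a polynomial unless $(p,q)=(-1,0)$,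 and $B_{-1,0}(x)=-1/x$). Put $\overline{B}_{p,q}(x,z):=z^{p+2q}B_{p,q}(x/z)$. For a finite set $I=\{y_1,\dots,y_m\}$ of variables, $\sigma_n^I:=\sigma_n(y_1,\dots,y_m)$ and $\tau_{2n}^I:=\sigma_n(y_1^2,\dots,y_m^2)$, where $\sigma_n$ is the elementary symmetric function of degree $n$. For given $j$ put $J=\{x_1,\dots,x_{j-1}\}$, $J_1=\{x_j,x_{j+1}\}$, $J_2=\{x_{j+2},\dots,x_\ell\}$ (for $j=\ell$ only $J$ is used). For disjoint subsets $K_1,K_2$ of $J$ put $\prod K_p=\prod_{x_i\in K_p}x_i$ ($p=1,2$; empty product $=1$) and $k_0=|J\setminus(K_1\cup K_2)|$. For $0\le n_1\le|J_1|$, $0\le n_2\le|J_2|$ put $k=(|J_1|-n_1)+2(|J_2|-n_2)-1$. Then, for $1\le j\le\ell-1$, $$\varphi_j=(x_j-x_{j+1}-z)\sum_{i=1}^{\ell}\ \sum_{\substack{K_1\cup K_2\subseteq J \\ K_1\cap K_2=\emptyset}}\Big(\prod K_1\Big)\Big(\prod K_2\Big)^2(-z)^{|K_1|}\sum_{\substack{0\le n_1\le|J_1| \\ 0\le n_2\le|J_2|}}(-1)^{n_1+n_2}\sigma_{n_1}^{J_1}\tau_{2n_2}^{J_2}\,\overline{B}_{k,k_0}(x_i,z)\frac{\partial}{\partial x_i},$$ and $$\varphi_\ell=\sum_{i=1}^{\ell}\ \sum_{\substack{K_1\cup K_2\subseteq J \\ K_1\cap K_2=\emptyset}}\Big(\prod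 K_1\Big)\Big(\prod K_2\Big)^2(-z)^{|K_1|}(-x_\ell)\,\overline{B}_{-1,k_0}(x_i,z)\frac{\partial}{\partial x_i}\qquad(J=\{x_1,\dots,x_{\ell-1}\}).$$ The sums run over all ordered pairs $(K_1,K_2)$ of disjoint subsets of $J$. In particular $\varphi_j(z)=0$ for all $j$. *)

theory Defs
  imports "HOL-Library.FuncSet" "HOL-Library.Poly_Mapping"
    "HOL-Computational_Algebra.Computational_Algebra" "HOL-Computational_Algebra.Field_as_Ring"
begin

section \<open>The polynomial ring\<close>

text \<open>Multivariate polynomials are finitely supported functions from exponent vectors to
  coefficients. Variable \<open>0\<close> is \<open>z\<close> and variable \<open>i\<close>, for \<open>1 \<le> i \<le> l\<close>, is \<open>x\<^sub>i\<close>.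
  The ambient type has infinitely many variables; \<open>S = \<real>[x\<^sub>1, \<dots>, x\<^sub>l, z]\<close> is the
  subring \<open>poly_ring l\<close>.\<close>

type_synonym mpoly = "(nat \<Rightarrow>\<^sub>0 nat) \<Rightarrow>\<^sub>0 real"

definition Const :: "real \<Rightarrow> mpoly" where
  "Const c = Poly_Mapping.single 0 c"

definition Var :: "nat \<Rightarrow> mpoly" where
  "Var i = Poly_Mapping.single (Poly_Mapping.single i 1) 1"

definition poly_ring :: "nat \<Rightarrow> mpoly set" where
  "poly_ring l = {f. \<forall>m\<in>Poly_Mapping.keys f. Poly_Mapping.keys m \<subseteq> {0..l}}"

definition partial :: "nat \<Rightarrow> mpoly \<Rightarrow> mpoly" where
  "partial i f = (\<Sum>m\<in>Poly_Mapping.keys f.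
     Poly_Mapping.single (m - Poly_Mapping.single i 1)
       (of_nat (Poly_Mapping.lookup m i) * Poly_Mapping.lookup f m))"


section \<open>Derivations and arrangements\<close>

text \<open>Derivations are extensional functions on \<open>S\<close> (value \<open>undefined\<close> outside \<open>S\<close>), so
  that equality of functions is equality on \<open>S\<close>.\<close>

definition Der :: "nat \<Rightarrow> (mpoly \<Rightarrow> mpoly) set" where
  "Der l = {\<theta> \<in> poly_ring l \<rightarrow>\<^sub>E poly_ring l.
     (\<forall>f\<in>poly_ring l. \<forall>g\<in>poly_ring l. \<theta> (f + g) = \<theta> f + \<theta> g) \<and>
     (\<forall>c. \<forall>f\<in>poly_ring l. \<theta> (Const c * f) = Const c * \<theta> f) \<and>
     (\<forall>f\<in>poly_ring l. \<forall>g\<in>poly_ring l. \<theta> (f * g) = \<theta> f * g + f * \<theta> g)}"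

text \<open>A point of \<open>V = \<real>\<^bsup>l+1\<^esup>\<close> has coordinate \<open>0\<close> for \<open>z\<close> and coordinates
  \<open>1, \<dots>, l\<close> for the \<open>x\<^sub>i\<close>.\<close>

definition pt_space :: "nat \<Rightarrow> (nat \<Rightarrow> real) set" where
  "pt_space l = {0..l} \<rightarrow>\<^sub>E UNIV"

definition hyperplane :: "nat \<Rightarrow> (nat \<Rightarrow> real) \<Rightarrow> (nat \<Rightarrow> real) set" where
  "hyperplane l a = {v \<in> pt_space l. (\<Sum>i\<in>{0..l}. a i * v i) = 0}"

definition linear_form :: "nat \<Rightarrow> (nat \<Rightarrow> real) \<Rightarrow> mpoly" where
  "linear_form l a = (\<Sum>i\<in>{0..l}. Const (a i) * Var i)"

text \<open>The defining form of a hyperplane is unique only up to a nonzero scalar, which does not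
  affect the divisibility condition; the condition is imposed on all of them.\<close>

definition log_derivations :: "nat \<Rightarrow> (nat \<Rightarrow> real) set set \<Rightarrow> (mpoly \<Rightarrow> mpoly) set" where
  "log_derivations l A = {\<theta> \<in> Der l.
     \<forall>a. (\<exists>i\<in>{0..l}. a i \<noteq> 0) \<and> hyperplane l a \<in> A \<longrightarrow>
       (\<exists>g\<in>poly_ring l. \<theta> (linear_form l a) = linear_form l a * g)}"

definition cone_shi_D :: "nat \<Rightarrow> (nat \<Rightarrow> real) set set" where
  "cone_shi_D l =
     {{v \<in> pt_space l. v 0 = 0}} \<union>
     {{v \<in> pt_space l. v s + \<epsilon> * v t = 0} | s t \<epsilon>. 1 \<le> s \<and> s < t \<and> t \<le> l \<and> \<epsilon> \<in> {-1, 1}} \<union>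
     {{v \<in> pt_space l. v s + \<epsilon> * v t - v 0 = 0} | s t \<epsilon>. 1 \<le> s \<and> s < t \<and> t \<le> l \<and> \<epsilon> \<in> {-1, 1}}"

definition lin_comb ::
  "nat \<Rightarrow> 'i set \<Rightarrow> ('i \<Rightarrow> mpoly) \<Rightarrow> ('i \<Rightarrow> mpoly \<Rightarrow> mpoly) \<Rightarrow> mpoly \<Rightarrow> mpoly" where
  "lin_comb l I c b = (\<lambda>f\<in>poly_ring l. \<Sum>i\<in>I. c i * b i f)"

definition is_basis ::
  "nat \<Rightarrow> (mpoly \<Rightarrow> mpoly) set \<Rightarrow> 'i set \<Rightarrow> ('i \<Rightarrow> mpoly \<Rightarrow> mpoly) \<Rightarrow> bool" where
  "is_basis l M I b \<longleftrightarrow> finite I \<and> b ` I \<subseteq> M \<and>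
     (\<forall>\<theta>\<in>M. \<exists>c\<in>I \<rightarrow> poly_ring l. \<theta> = lin_comb l I c b) \<and>
     (\<forall>c\<in>I \<rightarrow> poly_ring l. lin_comb l I c b = (\<lambda>f\<in>poly_ring l. 0) \<longrightarrow> (\<forall>i\<in>I. c i = 0))"


section \<open>The rational functions \<open>B\<^bsub>p,q\<^esub>\<close>\<close>

text \<open>\<open>rat_eval h r y\<close> substitutes \<open>y\<close> into the univariate rational function \<open>r\<close> (written
  in lowest terms), where \<open>h\<close> embeds the real coefficients into the target field.\<close>

definition rat_eval :: "(real \<Rightarrow> 'a::field) \<Rightarrow> real poly fract \<Rightarrow> 'a \<Rightarrow> 'a" where
  "rat_eval h r y =
     (case quot_of_fract r of (n, d) \<Rightarrow> poly (map_poly h n) y / poly (map_poly h d) y)"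

text \<open>For \<open>p \<ge> -1\<close> exactly one rational function satisfies the difference equation and is odd.
  Here \<open>ev y\<close> is \<open>b\<close> evaluated at \<open>y\<close>, so \<open>ev (x + 1)\<close> is \<open>B\<^bsub>p,q\<^esub>(x + 1)\<close>.\<close>

definition B_fract :: "int \<Rightarrow> nat \<Rightarrow> real poly fract" where
  "B_fract p q = (THE b.
     let x = to_fract [:0, 1:]; ev = rat_eval (\<lambda>c. to_fract [:c:]) b in
       ev (x + 1) - b = ((x + 1) powi p - (- x) powi p) / ((x + 1) - (- x)) * (x + 1) ^ q * (- x) ^ q
       \<and> ev (- x) = - b)"

definition Bbar :: "int \<Rightarrow> nat \<Rightarrow> mpoly fract \<Rightarrow> mpoly fract \<Rightarrow> mpoly fract" where
  "Bbar p q x z = z powi (p + 2 * int q) * rat_eval (\<lambda>c. to_fract (Const c)) (B_fract p q) (x / z)"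


section \<open>The derivations\<close>

definition elem_sym :: "nat \<Rightarrow> 'i set \<Rightarrow> ('i \<Rightarrow> 'a::comm_ring_1) \<Rightarrow> 'a" where
  "elem_sym n I y = (\<Sum>T | T \<subseteq> I \<and> card T = n. \<Prod>i\<in>T. y i)"

abbreviation xvar :: "nat \<Rightarrow> mpoly fract" where
  "xvar i \<equiv> to_fract (Var i)"

abbreviation zvar :: "mpoly fract" where
  "zvar \<equiv> to_fract (Var 0)"

text \<open>\<open>phi_coeff l j i\<close> is the coefficient of \<open>\<partial>/\<partial>x\<^sub>i\<close> in \<open>\<phi>\<^sub>j\<close>. Since \<open>B\<^bsub>-1,0\<^esub>\<close> is not a
  polynomial, it is computed in the fraction field. Sets of variables are represented by their
  sets of indices; the second branch is \<open>\<phi>\<^sub>l\<close>.\<close>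

definition phi_coeff :: "nat \<Rightarrow> nat \<Rightarrow> nat \<Rightarrow> mpoly fract" where
  "phi_coeff l j i =
    (let J = {1..<j}; J1 = {j, j + 1}; J2 = {j + 2..l};
         KK = {(K1, K2). K1 \<subseteq> J \<and> K2 \<subseteq> J \<and> K1 \<inter> K2 = {}};
         k0 = (\<lambda>K1 K2. card (J - (K1 \<union> K2)));
         w = (\<lambda>K1 K2. (\<Prod>r\<in>K1. xvar r) * (\<Prod>r\<in>K2. xvar r) ^ 2 * (- zvar) ^ card K1)
     in if j < l then
          (xvar j - xvar (j + 1) - zvar) *
          (\<Sum>(K1, K2)\<in>KK. w K1 K2 *
            (\<Sum>n1\<in>{0..card J1}. \<Sum>n2\<in>{0..card J2}.
              (- 1) ^ (n1 + n2) * elem_sym n1 J1 xvar * elem_sym n2 J2 (\<lambda>r. xvar r ^ 2) *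
              Bbar ((int (card J1) - int n1) + 2 * (int (card J2) - int n2) - 1)
                (k0 K1 K2) (xvar i) zvar))
        else
          (\<Sum>(K1, K2)\<in>KK. w K1 K2 * (- xvar l) * Bbar (- 1) (k0 K1 K2) (xvar i) zvar))"

text \<open>\<open>inv to_fract\<close> reads an element of the fraction field as a polynomial. It is meaningful
  because all \<open>phi_coeff l j i\<close> are polynomials.\<close>

definition phi :: "nat \<Rightarrow> nat \<Rightarrow> mpoly \<Rightarrow> mpoly" where
  "phi l j = (\<lambda>f\<in>poly_ring l. \<Sum>i\<in>{1..l}. inv to_fract (phi_coeff l j i) * partial i f)"

definition euler :: "nat \<Rightarrow> mpoly \<Rightarrow> mpoly" where
  "euler l = (\<lambda>f\<in>poly_ring l. Var 0 * partial 0 f + (\<Sum>i\<in>{1..l}. Var i * partial i f))"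

end

theory Submission
  imports Defs "Jordan_Normal_Form.Char_Poly" "Jordan_Normal_Form.Column_Operations"
begin

text \<open>
  The proof is Saito's criterion: derivations that are logarithmic for the arrangement and whose
  coefficient determinant is a nonzero constant times the product of the defining forms are a
  basis. Subtracting a multiple of the Euler derivation from a logarithmic derivation makes it
  kill \<open>z\<close>, so only the \<open>l \<times> l\<close> matrix of the coefficients of \<open>\<phi>\<^sub>1, \<dots>, \<phi>\<^sub>l\<close> and the forms
  \<open>x\<^sub>s + \<epsilon> x\<^sub>t - \<delta> z\<close> with \<open>\<epsilon> = \<plusminus>1\<close> and \<open>\<delta> \<in> {0, 1}\<close> matter.

  Everything about the \<open>\<phi>\<^sub>j\<close> follows from a generating function. The sums over \<open>K\<^sub>1, K\<^sub>2\<close> expand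
  the product \<open>W(A) = \<Prod>\<^bsub>r < j\<^esub> (x\<^sub>r\<^sup>2 - z x\<^sub>r + A)\<close>, the sums over \<open>n\<^sub>1, n\<^sub>2\<close> expand
  \<open>G(y) = (y - x\<^sub>j) (y - x\<^bsub>j+1\<^esub>) \<Prod>\<^bsub>r > j+1\<^esub> (y\<^sup>2 - x\<^sub>r\<^sup>2)\<close>, with \<open>G = - x\<^sub>l\<close> for \<open>j = l\<close>
  (\<open>Wpoly_expand\<close>, \<open>sum_coeff_Gpoly\<close>). Hence the coefficient of \<open>\<partial>/\<partial>x\<^sub>i\<close> in \<open>\<phi>\<^sub>j\<close> is, up to
  the prefactor, \<open>F(x\<^sub>i)\<close> for an odd \<open>F\<close> with
  \<open>F(x + z) - F(x) = z W(-x (x + z)) (G(x + z) / (x + z) - G(-x) / (-x)) / (2 x + z)\<close>, and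
  \<open>W(-x (x + z)) = \<Prod>\<^bsub>r < j\<^esub> (x\<^sub>r + x) (x\<^sub>r - x - z)\<close>. The pole of \<open>B\<^bsub>-1,0\<^esub>\<close> disappears in the
  even polynomial \<open>x F(x)\<close>; its product with the prefactor is \<open>phi_num\<close>, and
  \<open>phi_num_difference\<close> is the equation for that.

  Oddness gives divisibility by \<open>x\<^sub>s \<plusminus> x\<^sub>t\<close>. On \<open>x\<^sub>s = z \<mp> x\<^sub>t\<close> the difference equation applies
  with \<open>x = \<mp> x\<^sub>t\<close>: its right-hand side vanishes through the factor \<open>r = s\<close> of \<open>W\<close> if \<open>s < j\<close>, and
  through the roots of \<open>G\<close> otherwise, except for the single form \<open>x\<^sub>j - x\<^bsub>j+1\<^esub> - z\<close>, which is the
  prefactor (\<open>form_dvd_phi_poly\<close>).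

  All coefficients are homogeneous of degree \<open>2 l - 2\<close>, so the determinant has degree
  \<open>l (2 l - 2)\<close>, which is the number of forms; being divisible by each of these pairwise
  non-associated primes, it is a constant multiple of their product (\<open>det_coeff_mat\<close>). The
  constant is nonzero because the matrix is nonsingular at the point \<open>z = 0\<close>, \<open>x\<^sub>i = i\<close>. There a
  linear relation between the columns yields an even polynomial of degree at most \<open>2 l - 2\<close> that
  vanishes at \<open>\<plusminus>1, \<dots>, \<plusminus>l\<close>, hence is zero; applying \<open>x d/dx - 1\<close>, the limit of the difference
  equation, turns the relation into one between \<open>W\<^sub>j(-x\<^sup>2) (G\<^sub>j(x) + G\<^sub>j(-x))\<close>, and these functions
  form a triangular matrix at \<open>x = 1, \<dots>, l\<close> (\<open>level0_independent\<close>).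
\<close>

(* Vector indexing and coefficients of formal power series share an infix. *)
no_notation fps_nth (infixl \<open>$\<close> 75)

section \<open>Polynomials, evaluation and partial derivatives\<close>

lemma mpoly_induct [case_names zero add_single]:
  fixes f :: mpoly
  assumes "P 0" and "\<And>m c f. P f \<Longrightarrow> P (f + Poly_Mapping.single m c)"
  shows "P f"
proof (induction f rule: update_induct)
  case const
  show ?case by (rule assms(1))
next
  case (update f a b)
  have "Poly_Mapping.update a b f = f + Poly_Mapping.single a b"
    using update(1) by (intro poly_mapping_eqI)
      (auto simp: lookup_update lookup_add lookup_single when_def in_keys_iff)
  with assms(2)[OF update(3)] show ?case by simp
qed

definition mon_eval :: "(nat \<Rightarrow> 'a::comm_ring_1) \<Rightarrow> (nat \<Rightarrow>\<^sub>0 nat) \<Rightarrow> 'a" where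
  "mon_eval v m = (\<Prod>i\<in>Poly_Mapping.keys m. v i ^ Poly_Mapping.lookup m i)"

definition mp_eval :: "(real \<Rightarrow> 'a::comm_ring_1) \<Rightarrow> (nat \<Rightarrow> 'a) \<Rightarrow> mpoly \<Rightarrow> 'a" where
  "mp_eval h v f = (\<Sum>m\<in>Poly_Mapping.keys f. h (Poly_Mapping.lookup f m) * mon_eval v m)"

lemma mon_eval_superset:
  assumes "finite A" "Poly_Mapping.keys m \<subseteq> A"
  shows "mon_eval v m = (\<Prod>i\<in>A. v i ^ Poly_Mapping.lookup m i)"
  unfolding mon_eval_def using assms
  by (intro prod.mono_neutral_left) (auto simp: in_keys_iff)

lemma mon_eval_add: "mon_eval v (m + m') = mon_eval v m * mon_eval v m'"
proof -
  let ?A = "Poly_Mapping.keys m \<union> Poly_Mapping.keys m'"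
  have "mon_eval v (m + m') = (\<Prod>i\<in>?A. v i ^ Poly_Mapping.lookup (m + m') i)"
    by (intro mon_eval_superset) (use keys_add[of m m'] in auto)
  also have "\<dots> = (\<Prod>i\<in>?A. v i ^ Poly_Mapping.lookup m i) * (\<Prod>i\<in>?A. v i ^ Poly_Mapping.lookup m' i)"
    by (simp add: lookup_add power_add prod.distrib)
  also have "\<dots> = mon_eval v m * mon_eval v m'"
    by (subst (1 2) mon_eval_superset[of ?A]) auto
  finally show ?thesis .
qed

lemma mp_eval_single [simp]: "h 0 = 0 \<Longrightarrow> mp_eval h v (Poly_Mapping.single m c) = h c * mon_eval v m"
  by (cases "c = 0") (auto simp: mp_eval_def)

context
  fixes h :: "real \<Rightarrow> 'a::comm_ring_1"
  assumes h: "comm_ring_hom h"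
begin

interpretation h: comm_ring_hom h by (rule h)

lemma mp_eval_add: "mp_eval h v (f + g) = mp_eval h v f + mp_eval h v g"
  unfolding mp_eval_def
  by (rule setsum_keys_plus_distrib) (auto simp: h.hom_add algebra_simps)

lemma mp_eval_mult: "mp_eval h v (f * g) = mp_eval h v f * mp_eval h v g"
proof (induction f rule: mpoly_induct)
  case zero
  then show ?case by (simp add: mp_eval_def)
next
  case (add_single m c f)
  have "mp_eval h v (Poly_Mapping.single m c * g) = h c * mon_eval v m * mp_eval h v g"
  proof (induction g rule: mpoly_induct)
    case zero
    then show ?case by (simp add: mp_eval_def)
  next
    case (add_single m' c' g)
    then show ?case
      by (simp add: distrib_left mp_eval_add mult_single h.hom_mult mon_eval_add)
  qed
  with add_single show ?case by (simp add: distrib_right mp_eval_add)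
qed

text \<open>Polynomials over the reals are the free commutative algebra on the variables: every choice
  of images of the variables extends to a ring homomorphism. Substitutions, evaluation at points
  and gradings are all instances.\<close>

lemma mp_eval_hom: "comm_ring_hom (mp_eval h v)"
proof
  show "mp_eval h v 1 = 1"
    by (simp add: mp_eval_def mon_eval_def flip: single_one)
qed (simp_all add: mp_eval_add mp_eval_mult, simp add: mp_eval_def)

lemma mp_eval_Const [simp]: "mp_eval h v (Const c) = h c"
  by (simp add: Const_def mon_eval_def)

lemma mp_eval_Var [simp]: "mp_eval h v (Var i) = v i"
  by (simp add: Var_def mon_eval_def)

end

lemma Const_hom: "comm_ring_hom Const"
  by standard (simp_all add: Const_def single_add mult_single flip: single_one)

interpretation Const: comm_ring_hom Const by (rule Const_hom)

lemma mon_eval_Var: "mon_eval Var m = Poly_Mapping.single m 1"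
proof -
  have pow: "Var i ^ n = Poly_Mapping.single (Poly_Mapping.single i n) 1" for i n
    by (induction n) (simp_all add: Var_def mult_single flip: single_add)
  have "(\<Prod>i\<in>A. Poly_Mapping.single (Poly_Mapping.single i (g i)) (1::real)) =
      Poly_Mapping.single (\<Sum>i\<in>A. Poly_Mapping.single i (g i)) 1" if "finite A" for A and g :: "nat \<Rightarrow> nat"
    using that by (induction A) (simp_all add: mult_single)
  moreover have "(\<Sum>i\<in>Poly_Mapping.keys m. Poly_Mapping.single i (Poly_Mapping.lookup m i)) = m"
    by (intro poly_mapping_eqI) (auto simp: lookup_sum lookup_single when_def in_keys_iff sum.delta)
  ultimately show ?thesis
    by (simp add: mon_eval_def pow)
qed

lemma mp_eval_Const_Var [simp]: "mp_eval Const Var f = f"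
proof (induction f rule: mpoly_induct)
  case zero
  then show ?case by (simp add: mp_eval_def)
next
  case (add_single m c f)
  then show ?case
    by (simp add: mp_eval_add[OF Const_hom] mon_eval_Var) (simp add: Const_def mult_single)
qed

lemma Const_in_poly_ring [simp]: "Const c \<in> poly_ring l"
  by (auto simp: poly_ring_def Const_def)

lemma Var_in_poly_ring [simp]: "Var i \<in> poly_ring l \<longleftrightarrow> i \<le> l"
  by (auto simp: poly_ring_def Var_def)

lemma poly_ring_add: "f \<in> poly_ring l \<Longrightarrow> g \<in> poly_ring l \<Longrightarrow> f + g \<in> poly_ring l"
  using keys_add[of f g] by (auto simp: poly_ring_def)

lemma poly_ring_mult: "f \<in> poly_ring l \<Longrightarrow> g \<in> poly_ring l \<Longrightarrow> f * g \<in> poly_ring l"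
proof -
  assume *: "f \<in> poly_ring l" "g \<in> poly_ring l"
  show ?thesis
    unfolding poly_ring_def
  proof safe
    fix m i assume m: "m \<in> Poly_Mapping.keys (f * g)" and i: "i \<in> Poly_Mapping.keys m"
    obtain a b where ab: "m = a + b" "a \<in> Poly_Mapping.keys f" "b \<in> Poly_Mapping.keys g"
      using subsetD[OF keys_mult m] by auto
    then have "i \<in> Poly_Mapping.keys a \<or> i \<in> Poly_Mapping.keys b"
      using i keys_add[of a b] by auto
    with * ab show "i \<in> {0..l}" unfolding poly_ring_def by fastforce
  qed
qed

lemma poly_ring_0 [simp]: "0 \<in> poly_ring l" and poly_ring_1 [simp]: "1 \<in> poly_ring l"
  using Const_in_poly_ring[of 0 l] Const_in_poly_ring[of 1 l] by simp_all

lemma poly_ring_uminus: "f \<in> poly_ring l \<Longrightarrow> - f \<in> poly_ring l"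
  by (auto simp: poly_ring_def)

lemma poly_ring_diff: "f \<in> poly_ring l \<Longrightarrow> g \<in> poly_ring l \<Longrightarrow> f - g \<in> poly_ring l"
  using poly_ring_add[of f l "- g"] poly_ring_uminus[of g l] by simp

lemma poly_ring_sum: "(\<And>i. i \<in> A \<Longrightarrow> f i \<in> poly_ring l) \<Longrightarrow> sum f A \<in> poly_ring l"
  by (induction A rule: infinite_finite_induct) (auto intro: poly_ring_add)

lemma poly_ring_prod: "(\<And>i. i \<in> A \<Longrightarrow> f i \<in> poly_ring l) \<Longrightarrow> prod f A \<in> poly_ring l"
  by (induction A rule: infinite_finite_induct) (auto intro: poly_ring_mult)

lemma poly_ring_power: "f \<in> poly_ring l \<Longrightarrow> f ^ n \<in> poly_ring l"
  by (induction n) (auto intro: poly_ring_mult)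

text \<open>Evaluation at the variables themselves is the identity, which writes \<open>f\<close> as a sum of products
  of constants and variables.\<close>

lemma poly_ring_induct [consumes 1, case_names Const Var add mult]:
  assumes f: "f \<in> poly_ring l"
    and Const: "\<And>c. P (Const c)" and Var: "\<And>i. i \<le> l \<Longrightarrow> P (Var i)"
    and add: "\<And>f g. f \<in> poly_ring l \<Longrightarrow> g \<in> poly_ring l \<Longrightarrow> P f \<Longrightarrow> P g \<Longrightarrow> P (f + g)"
    and mult: "\<And>f g. f \<in> poly_ring l \<Longrightarrow> g \<in> poly_ring l \<Longrightarrow> P f \<Longrightarrow> P g \<Longrightarrow> P (f * g)"
  shows "P f"
proof -
  define Q where "Q f \<longleftrightarrow> f \<in> poly_ring l \<and> P f" for f
  have Q0: "Q 0" and Q1: "Q 1" using Const[of 0] Const[of 1] by (simp_all add: Q_def)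
  have Qadd: "Q (f + g)" and Qmult: "Q (f * g)" if "Q f" "Q g" for f g
    using that add mult by (auto simp: Q_def poly_ring_add poly_ring_mult)
  have sum: "Q (\<Sum>m\<in>A. g m)" if "finite A" "\<And>m. m \<in> A \<Longrightarrow> Q (g m)" for A :: "(nat \<Rightarrow>\<^sub>0 nat) set" and g
    using that by (induction A) (auto intro: Q0 Qadd)
  have prod: "Q (\<Prod>m\<in>A. g m)" if "finite A" "\<And>m. m \<in> A \<Longrightarrow> Q (g m)" for A :: "nat set" and g
    using that by (induction A) (auto intro: Q1 Qmult)
  have pow: "Q (g ^ n)" if "Q g" for g n
    using that by (induction n) (auto intro: Q1 Qmult)
  have "Q (\<Sum>m\<in>Poly_Mapping.keys f. Const (Poly_Mapping.lookup f m) *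
      (\<Prod>i\<in>Poly_Mapping.keys m. Var i ^ Poly_Mapping.lookup m i))"
  proof (rule sum)
    fix m assume m: "m \<in> Poly_Mapping.keys f"
    show "Q (Const (Poly_Mapping.lookup f m) *
      (\<Prod>i\<in>Poly_Mapping.keys m. Var i ^ Poly_Mapping.lookup m i))"
    proof (rule Qmult)
      show "Q (\<Prod>i\<in>Poly_Mapping.keys m. Var i ^ Poly_Mapping.lookup m i)"
      proof (intro prod pow)
        fix i assume "i \<in> Poly_Mapping.keys m"
        with f m have "i \<le> l" unfolding poly_ring_def by fastforce
        then show "Q (Var i)" by (simp add: Q_def Var)
      qed simp
    qed (simp add: Q_def Const)
  qed simp
  then have "Q (mp_eval Const Var f)"
    by (simp only: mp_eval_def mon_eval_def)
  then show ?thesis by (simp add: Q_def)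
qed

text \<open>Setting the variables beyond \<open>l\<close> to zero is a retraction of the ambient ring onto
  \<open>poly_ring l\<close>. As a ring homomorphism it transports equations, which shows that quotients and
  determinants of elements of \<open>poly_ring l\<close> stay in \<open>poly_ring l\<close>.\<close>

definition retr :: "nat \<Rightarrow> mpoly \<Rightarrow> mpoly" where
  "retr l = mp_eval Const (\<lambda>i. if i \<le> l then Var i else 0)"

lemma retr_hom: "comm_ring_hom (retr l)"
  unfolding retr_def by (rule mp_eval_hom[OF Const_hom])

interpretation retr: comm_ring_hom "retr l" for l by (rule retr_hom)

lemma retr_in_poly_ring: "retr l f \<in> poly_ring l"
proof (induction f rule: mpoly_induct)
  case (add_single m c f)
  have "mon_eval (\<lambda>i. if i \<le> l then Var i else 0) m \<in> poly_ring l"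
    unfolding mon_eval_def by (intro poly_ring_prod poly_ring_power) simp
  moreover have "retr l (Poly_Mapping.single m c) = Const c * mon_eval (\<lambda>i. if i \<le> l then Var i else 0) m"
    unfolding retr_def by (rule mp_eval_single) simp
  ultimately have "retr l (Poly_Mapping.single m c) \<in> poly_ring l"
    by (simp only: poly_ring_mult Const_in_poly_ring)
  with add_single show ?case by (simp only: retr.hom_add poly_ring_add)
qed simp

lemma retr_id: "f \<in> poly_ring l \<Longrightarrow> retr l f = f"
  by (induction f rule: poly_ring_induct)
    (auto simp: retr.hom_add retr.hom_mult,
     auto simp: retr_def mp_eval_Const[OF Const_hom] mp_eval_Var[OF Const_hom])

lemma poly_ring_iff_retr: "f \<in> poly_ring l \<longleftrightarrow> retr l f = f"
  using retr_id retr_in_poly_ring by metis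

lemma poly_ring_cancel:
  assumes "f * g \<in> poly_ring l" "f \<in> poly_ring l" "f \<noteq> 0"
  shows "g \<in> poly_ring l"
proof -
  have "f * retr l g = f * g"
    using assms by (simp add: poly_ring_iff_retr retr.hom_mult)
  with assms(3) show ?thesis by (simp add: poly_ring_iff_retr)
qed

lemma partial_single:
  "partial i (Poly_Mapping.single m c) =
     Poly_Mapping.single (m - Poly_Mapping.single i 1) (of_nat (Poly_Mapping.lookup m i) * c)"
  by (cases "c = 0") (auto simp: partial_def)

lemma partial_0 [simp]: "partial i 0 = 0"
  by (simp add: partial_def)

lemma partial_add: "partial i (f + g) = partial i f + partial i g"
  unfolding partial_def
  by (rule setsum_keys_plus_distrib) (auto simp: single_add algebra_simps)

lemma partial_mult: "partial i (f * g) = partial i f * g + f * partial i g"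
proof (induction f rule: mpoly_induct)
  case zero
  then show ?case by simp
next
  case (add_single m c f)
  have "partial i (Poly_Mapping.single m c * g) =
      partial i (Poly_Mapping.single m c) * g + Poly_Mapping.single m c * partial i g"
  proof (induction g rule: mpoly_induct)
    case zero
    then show ?case by simp
  next
    case (add_single m' c' g)
    have dec: "(a + b) - Poly_Mapping.single i 1 = (a - Poly_Mapping.single i 1) + b"
      if "Poly_Mapping.lookup a i > 0" for a b :: "nat \<Rightarrow>\<^sub>0 nat"
      using that by (intro poly_mapping_eqI)
        (auto simp: lookup_add lookup_minus lookup_single when_def)
    have dec': "(a + b) - Poly_Mapping.single i 1 = a + (b - Poly_Mapping.single i 1)"
      if "Poly_Mapping.lookup b i > 0" for a b :: "nat \<Rightarrow>\<^sub>0 nat"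
      using dec[OF that, of a] by (simp add: add.commute)
    have "partial i (Poly_Mapping.single m c * Poly_Mapping.single m' c') =
        partial i (Poly_Mapping.single m c) * Poly_Mapping.single m' c' +
        Poly_Mapping.single m c * partial i (Poly_Mapping.single m' c')"
    proof -
      let ?e = "Poly_Mapping.single i (1::nat)"
      let ?a = "Poly_Mapping.lookup m i" and ?b = "Poly_Mapping.lookup m' i"
      have "Poly_Mapping.single ((m - ?e) + m') (of_nat ?a * c * c') =
          Poly_Mapping.single (m + m' - ?e) (of_nat ?a * c * c')"
        by (cases "?a = 0") (simp, simp only: dec neq0_conv)
      moreover have "Poly_Mapping.single (m + (m' - ?e)) (c * (of_nat ?b * c')) =
          Poly_Mapping.single (m + m' - ?e) (c * (of_nat ?b * c'))"
        by (cases "?b = 0") (simp, simp only: dec' neq0_conv)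
      moreover have "(of_nat (?a + ?b) * (c * c')) = of_nat ?a * c * c' + c * (of_nat ?b * c')"
        by (simp add: algebra_simps)
      ultimately show ?thesis
        by (simp only: partial_single mult_single lookup_add single_add)
    qed
    with add_single show ?case by (simp only: distrib_left partial_add add_ac)
  qed
  with add_single show ?case by (simp only: distrib_right partial_add add_ac)
qed

lemma partial_Const [simp]: "partial i (Const c) = 0"
  by (simp add: Const_def partial_single)

lemma partial_Var: "partial i (Var j) = (if i = j then 1 else 0)"
  by (auto simp: Var_def partial_single lookup_single when_def simp flip: single_one)

lemma partial_in_poly_ring: "f \<in> poly_ring l \<Longrightarrow> partial i f \<in> poly_ring l"
  by (induction f rule: poly_ring_induct)
    (auto simp: partial_add partial_mult partial_Var intro: poly_ring_add poly_ring_mult)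

section \<open>The difference equation\<close>

text \<open>The difference of \<open>x\<^bsup>n+1\<^esup> / (n + 1)\<close> has leading term \<open>x\<^sup>n\<close>, so leading terms can be removed
  one by one.\<close>

lemma forward_difference_surj:
  fixes R :: "real poly"
  assumes "R = 0 \<or> degree R < n"
  shows "\<exists>P. degree P \<le> n \<and> P \<circ>\<^sub>p [:1, 1:] - P = R"
  using assms
proof (induction n arbitrary: R)
  case 0
  then show ?case by (intro exI[of _ 0]) auto
next
  case (Suc n)
  define P0 where "P0 = monom (coeff R n / real (Suc n)) (Suc n)"
  define D0 where "D0 = P0 \<circ>\<^sub>p [:1, 1:] - P0"
  have D0: "D0 = Polynomial.smult (coeff R n / real (Suc n)) ([:1, 1:] ^ Suc n) - P0"
    by (simp only: D0_def P0_def pcompose_smult monom_altdef pcompose_hom.hom_power) (simp add: pcompose_pCons)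
  have top: "coeff D0 (Suc n) = 0"
    unfolding D0 by (simp add: P0_def coeff_linear_poly_power del: power_Suc)
  have "coeff D0 n = coeff R n"
    unfolding D0 by (simp add: P0_def coeff_linear_poly_power del: power_Suc)
  have degp: "degree ([:1, 1::real:] ^ Suc n) \<le> Suc n"
    using degree_power_le[of "[:1, 1::real:]" "Suc n"] by simp
  have "degree D0 \<le> Suc n"
    unfolding D0 P0_def by (intro degree_diff_le order.trans[OF degree_smult_le degp] degree_monom_le)
  have small: "coeff (R - D0) i = 0" if i: "i \<ge> n" for i
  proof -
    consider "i = n" | "i = Suc n" | "i > Suc n" using i by linarith
    then show ?thesis
    proof cases
      case 2
      with Suc.prems have "coeff R i = 0" by (auto intro: coeff_eq_0)
      with 2 top show ?thesis by simp
    next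
      case 3
      with Suc.prems have "coeff R i = 0" by (auto intro: coeff_eq_0)
      with 3 \<open>degree D0 \<le> Suc n\<close> show ?thesis by (simp add: coeff_eq_0)
    qed (use \<open>coeff D0 n = coeff R n\<close> in simp)
  qed
  have "R - D0 = 0 \<or> degree (R - D0) < n"
    using small by (metis leading_coeff_0_iff not_le)
  from Suc.IH[OF this] obtain P where P: "degree P \<le> n" "P \<circ>\<^sub>p [:1, 1:] - P = R - D0"
    by blast
  show ?case
  proof (intro exI conjI)
    show "degree (P + P0) \<le> Suc n"
      using P(1) by (intro degree_add_le) (auto simp: P0_def intro: order.trans[OF degree_monom_le])
    show "(P + P0) \<circ>\<^sub>p [:1, 1:] - (P + P0) = R"
      using P(2) by (simp add: D0_def pcompose_add algebra_simps)
  qed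
qed

text \<open>If \<open>P(x + 1) - P(x) = R(x)\<close> and \<open>R\<close> is symmetric under \<open>x \<mapsto> -1 - x\<close>, then
  \<open>-P(-x)\<close> solves the same equation, so the odd part of \<open>P\<close> does.\<close>

lemma odd_forward_difference_surj:
  fixes R :: "real poly"
  assumes deg: "R = 0 \<or> degree R < n" and sym: "R \<circ>\<^sub>p [:-1, -1:] = R"
  shows "\<exists>B. degree B \<le> n \<and> B \<circ>\<^sub>p [:0, -1:] = - B \<and> B \<circ>\<^sub>p [:1, 1:] - B = R"
proof -
  obtain P where P: "degree P \<le> n" "P \<circ>\<^sub>p [:1, 1:] - P = R"
    using forward_difference_surj[OF deg] by blast
  define P' where "P' = P \<circ>\<^sub>p [:0, -1:]"
  have "P' \<circ>\<^sub>p [:1, 1:] = P \<circ>\<^sub>p [:-1, -1:]"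
    by (simp add: P'_def pcompose_assoc[symmetric] pcompose_pCons)
  moreover have "R \<circ>\<^sub>p [:-1, -1:] = P' - P \<circ>\<^sub>p [:-1, -1:]"
    by (simp add: P(2)[symmetric] pcompose_diff P'_def pcompose_assoc[symmetric] pcompose_pCons)
  ultimately have P'eq: "P' \<circ>\<^sub>p [:1, 1:] - P' = - R" using sym by simp
  define B where "B = Polynomial.smult (1/2) (P - P')"
  show ?thesis
  proof (intro exI conjI)
    have "degree P' \<le> n" using P(1) by (simp add: P'_def degree_pcompose)
    then show "degree B \<le> n"
      unfolding B_def using P(1) by (intro order.trans[OF degree_smult_le] degree_diff_le)
    have "P' \<circ>\<^sub>p [:0, -1:] = P"
      by (simp add: P'_def pcompose_assoc[symmetric] pcompose_pCons) 
    then show "B \<circ>\<^sub>p [:0, -1:] = - B"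
      unfolding B_def pcompose_smult pcompose_diff P'_def[symmetric] by (simp flip: smult_minus_right)
    have "B \<circ>\<^sub>p [:1, 1:] - B = Polynomial.smult (1/2) ((P \<circ>\<^sub>p [:1, 1:] - P) - (P' \<circ>\<^sub>p [:1, 1:] - P'))"
      unfolding B_def pcompose_smult pcompose_diff by (simp add: smult_diff_right)
    also have "\<dots> = R"
      unfolding P(2) P'eq by (rule poly_eqI) (simp only: coeff_smult coeff_diff coeff_minus, simp)
    finally show "B \<circ>\<^sub>p [:1, 1:] - B = R" .
  qed
qed

text \<open>\<open>c\<close> stands for \<open>x B\<^bsub>m-1,q\<^esub>(x)\<close>, and the last conjunct is the difference equation of
  \<open>B\<^bsub>m-1,q\<^esub>\<close> multiplied by \<open>x (x + 1) (2 x + 1)\<close>. The factor \<open>x\<close> removes the pole of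
  \<open>B\<^bsub>-1,0\<^esub>\<close>, and the shift of \<open>p\<close> to \<open>m = p + 1\<close> makes all exponents natural numbers.\<close>

definition is_cpoly :: "nat \<Rightarrow> nat \<Rightarrow> real poly \<Rightarrow> bool" where
  "is_cpoly m q c \<longleftrightarrow> degree c \<le> m + 2 * q \<and> c \<circ>\<^sub>p [:0, -1:] = c \<and>
     [:1, 2:] * ([:0, 1:] * (c \<circ>\<^sub>p [:1, 1:]) - [:1, 1:] * c) =
     ([:1, 1:] * [:0, -1:]) ^ q * ([:0, 1:] * [:1, 1:] ^ m + [:1, 1:] * [:0, -1:] ^ m)"

lemma is_cpolyI:
  assumes "degree B < m + 2 * q \<or> (B = 0)" "B \<circ>\<^sub>p [:0, -1:] = - B"
    and "[:1, 2:] * (B \<circ>\<^sub>p [:1, 1:] - B) * ([:0, 1:] * [:1, 1:]) =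
      ([:1, 1:] * [:0, -1:]) ^ q * ([:0, 1:] * [:1, 1:] ^ m + [:1, 1:] * [:0, -1:] ^ m)"
  shows "is_cpoly m q ([:0, 1:] * B)"
  unfolding is_cpoly_def
proof (intro conjI)
  show "degree ([:0, 1:] * B) \<le> m + 2 * q"
    using assms(1) degree_mult_le[of "[:0, 1:]" B] by auto
  have "([:0, 1:] * B) \<circ>\<^sub>p [:0, -1:] = ([:0, 1:] \<circ>\<^sub>p [:0, -1:]) * (B \<circ>\<^sub>p [:0, -1:])"
    by (rule pcompose_mult)
  also have "[:0, 1:] \<circ>\<^sub>p [:0, -1:] = - [:0, 1::real:]"
    by (simp add: pcompose_pCons)
  finally show "([:0, 1:] * B) \<circ>\<^sub>p [:0, -1:] = [:0, 1:] * B"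
    unfolding assms(2) by simp
  have "([:0, 1:] * B) \<circ>\<^sub>p [:1, 1:] = [:1, 1:] * (B \<circ>\<^sub>p [:1, 1:])"
    unfolding pcompose_mult by (simp add: pcompose_pCons)
  then have "[:1, 2:] * ([:0, 1:] * (([:0, 1:] * B) \<circ>\<^sub>p [:1, 1:]) - [:1, 1:] * ([:0, 1:] * B)) =
      [:1, 2:] * (B \<circ>\<^sub>p [:1, 1:] - B) * ([:0, 1:] * [:1, 1:])"
    by (simp only:) (simp only: algebra_simps)
  then show "[:1, 2:] * ([:0, 1:] * (([:0, 1:] * B) \<circ>\<^sub>p [:1, 1:]) - [:1, 1:] * ([:0, 1:] * B)) =
    ([:1, 1:] * [:0, -1:]) ^ q * ([:0, 1:] * [:1, 1:] ^ m + [:1, 1:] * [:0, -1:] ^ m)"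
    using assms(3) by (simp only:)
qed

text \<open>With \<open>A = x + 1\<close> and \<open>D = -x\<close> the right-hand side of the difference equation is
  \<open>(A\<^sup>p - D\<^sup>p) / (A - D) (A D)\<^sup>q\<close>. It is symmetric in \<open>A\<close> and \<open>D\<close>, which \<open>x \<mapsto> -1 - x\<close> swaps, and a
  polynomial unless \<open>(p, q) = (-1, 0)\<close>; for \<open>p = -1\<close> it is \<open>-(A D)\<^bsup>q-1\<^esup>\<close>. In the exceptional case
  \<open>x B\<^bsub>-1,0\<^esub>(x) = -1\<close>.\<close>

lemma ex_is_cpoly: "\<exists>c. is_cpoly m q c"
proof -
  let ?A = "[:1, 1::real:]" and ?D = "[:0, -1::real:]"
  have AD: "?A - ?D = [:1, 2:]" and X: "[:0, 1::real:] = - ?D" by simp_all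
  have swapA: "?A \<circ>\<^sub>p [:-1, -1:] = ?D" and swapD: "?D \<circ>\<^sub>p [:-1, -1:] = ?A"
    by (simp_all add: pcompose_pCons)
  have swapAD: "(?A * ?D) \<circ>\<^sub>p [:-1, -1:] = ?A * ?D"
    unfolding pcompose_mult swapA swapD by (rule mult.commute)
  have degAD: "degree ((?A * ?D) ^ r) \<le> 2 * r" for r
    using degree_power_le[of "?A * ?D" r] by (simp add: degree_mult_eq mult.commute)
  consider "m = 0" "q = 0" | r where "m = 0" "q = Suc r" | p where "m = Suc p"
    by (metis not0_implies_Suc)
  then show ?thesis
  proof cases
    case 1
    have "is_cpoly 0 0 [:-1:]"
      by (simp add: is_cpoly_def pcompose_pCons)
    with 1 show ?thesis by blast
  next
    case 2
    define R where "R = - ((?A * ?D) ^ r)"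
    have "degree R < 2 * r + 1" using degAD[of r] by (simp add: R_def)
    moreover have "R \<circ>\<^sub>p [:-1, -1:] = R"
      by (simp only: R_def pcompose_uminus pcompose_hom.hom_power swapAD)
    ultimately obtain B where B: "degree B \<le> 2 * r + 1" "B \<circ>\<^sub>p [:0, -1:] = - B" "B \<circ>\<^sub>p [:1, 1:] - B = R"
      using odd_forward_difference_surj by blast
    have "is_cpoly m q ([:0, 1:] * B)"
    proof (rule is_cpolyI)
      show "degree B < m + 2 * q \<or> B = 0" using B(1) 2 by simp
      have "(?A - ?D) * (- ((?A * ?D) ^ r)) * ((- ?D) * ?A) = (?A * ?D) ^ Suc r * ((- ?D) * ?A ^ 0 + ?A * ?D ^ 0)"
        by (simp only: power_Suc power_0 mult_1_right) (simp only: algebra_simps)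
      then show "[:1, 2:] * (B \<circ>\<^sub>p [:1, 1:] - B) * ([:0, 1:] * ?A) =
          (?A * ?D) ^ q * ([:0, 1:] * ?A ^ m + ?A * ?D ^ m)"
        unfolding B(3) 2 R_def X AD .
    qed (rule B(2))
    then show ?thesis by blast
  next
    case 3
    define T where "T = (\<Sum>i<p. ?D ^ (p - Suc i) * ?A ^ i)"
    have T: "(?A - ?D) * T = ?A ^ p - ?D ^ p"
      unfolding T_def by (rule power_diff_sumr2[symmetric])
    define R where "R = T * (?A * ?D) ^ q"
    have "degree T \<le> p - 1"
      unfolding T_def
    proof (rule degree_sum_le)
      fix i assume "i \<in> {..<p}"
      have "degree (?D ^ (p - Suc i) * ?A ^ i) \<le> (p - Suc i) + i"
        using degree_mult_le[of "?D ^ (p - Suc i)" "?A ^ i"]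
          degree_power_le[of ?D "p - Suc i"] degree_power_le[of ?A i] by simp
      with \<open>i \<in> {..<p}\<close> show "degree (?D ^ (p - Suc i) * ?A ^ i) \<le> p - 1" by simp
    qed simp
    moreover have "degree R \<le> degree T + degree ((?A * ?D) ^ q)"
      unfolding R_def by (rule degree_mult_le)
    moreover have "R = 0" if "p = 0" using that by (simp add: R_def T_def)
    ultimately have "R = 0 \<or> degree R < p + 2 * q"
      using degAD[of q] by (cases "p = 0") auto
    moreover have "R \<circ>\<^sub>p [:-1, -1:] = R"
    proof -
      have "(?D - ?A) * (T \<circ>\<^sub>p [:-1, -1:]) = ((?A - ?D) * T) \<circ>\<^sub>p [:-1, -1:]"
        by (simp only: pcompose_mult pcompose_diff swapA swapD)
      also have "\<dots> = ?D ^ p - ?A ^ p"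
        unfolding T by (simp only: pcompose_diff pcompose_hom.hom_power swapA swapD)
      also have "\<dots> = (?D - ?A) * T"
        using T by (simp only: algebra_simps minus_diff_eq)
      finally have "T \<circ>\<^sub>p [:-1, -1:] = T"
        by (rule mult_left_cancel[THEN iffD1, rotated]) simp
      then show ?thesis
        by (simp only: R_def pcompose_mult pcompose_hom.hom_power swapA swapD) (simp only: mult_ac)
    qed
    ultimately obtain B where B: "degree B \<le> p + 2 * q" "B \<circ>\<^sub>p [:0, -1:] = - B" "B \<circ>\<^sub>p [:1, 1:] - B = R"
      using odd_forward_difference_surj by blast
    have "is_cpoly m q ([:0, 1:] * B)"
    proof (rule is_cpolyI)
      show "degree B < m + 2 * q \<or> B = 0" using B(1) 3 by simp
      have "(?A - ?D) * (T * (?A * ?D) ^ q) * ((- ?D) * ?A) = (?A * ?D) ^ q * ((?A ^ p - ?D ^ p) * ((- ?D) * ?A))"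
        unfolding T[symmetric] by (simp only: mult_ac)
      also have "(?A ^ p - ?D ^ p) * ((- ?D) * ?A) = (- ?D) * ?A ^ Suc p + ?A * ?D ^ Suc p"
        unfolding power_Suc by (simp only: algebra_simps)
      finally show "[:1, 2:] * (B \<circ>\<^sub>p [:1, 1:] - B) * ([:0, 1:] * ?A) =
          (?A * ?D) ^ q * ([:0, 1:] * ?A ^ m + ?A * ?D ^ m)"
        unfolding B(3) 3 R_def X AD .
    qed (rule B(2))
    then show ?thesis by blast
  qed
qed

definition cpoly :: "nat \<Rightarrow> nat \<Rightarrow> real poly" where
  "cpoly m q = (SOME c. is_cpoly m q c)"

lemma is_cpoly_cpoly: "is_cpoly m q (cpoly m q)"
  unfolding cpoly_def using ex_is_cpoly by (rule someI_ex)

lemmas degree_cpoly = is_cpoly_cpoly[unfolded is_cpoly_def, THEN conjunct1]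
  and even_cpoly = is_cpoly_cpoly[unfolded is_cpoly_def, THEN conjunct2, THEN conjunct1]
  and difference_cpoly = is_cpoly_cpoly[unfolded is_cpoly_def, THEN conjunct2, THEN conjunct2]

section \<open>Identification of the rational functions\<close>

lemma to_fract_ring_hom: "comm_ring_hom (to_fract :: 'a::idom \<Rightarrow> 'a fract)"
  by standard simp_all

interpretation tf: comm_ring_hom "to_fract :: 'a::idom \<Rightarrow> 'a fract"
  by (rule to_fract_ring_hom)

lemma poly_map_poly_const_fract:
  "poly (map_poly (\<lambda>c::real. to_fract [:c:]) P) (to_fract Q) = to_fract (P \<circ>\<^sub>p Q)"
  by (induction P) (auto simp: map_poly_pCons pcompose_pCons)

text \<open>Evaluation is defined through the reduced fraction, but any fraction whose denominator does
  not vanish at the point gives the same value, since the reduced denominator divides every other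
  one.\<close>

lemma rat_eval_quotient:
  fixes h :: "real \<Rightarrow> 'a::field"
  assumes h: "comm_ring_hom h" and nz: "poly (map_poly h d) y \<noteq> 0"
  shows "rat_eval h (to_fract n / to_fract d) y = poly (map_poly h n) y / poly (map_poly h d) y"
proof -
  interpret h: comm_ring_hom h by (rule h)
  interpret mh: map_poly_comm_ring_hom h ..
  \<comment> \<open>the reduced numerator and denominator\<close>
  obtain n' d' where q: "quot_of_fract (to_fract n / to_fract d) = (n', d')" by fastforce
  from nz have d: "d \<noteq> 0" by auto
  have d': "d' \<noteq> 0" using snd_quot_of_fract_nonzero[of "to_fract n / to_fract d"] q by simp
  have "Fract n' d' = to_fract n / to_fract d"
    using Fract_quot_of_fract[of "to_fract n / to_fract d"] q by simp
  also have "\<dots> = Fract n d" using d by (simp add: to_fract_def)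
  finally have eq: "n' * d = n * d'" using d d' by (simp add: eq_fract)
  have "coprime n' d'" using coprime_quot_of_fract[of "to_fract n / to_fract d"] q by simp
  moreover have "d' dvd n' * d" unfolding eq by simp
  ultimately have "d' dvd d" using coprime_commute coprime_dvd_mult_right_iff by blast
  then obtain e where e: "d = d' * e" by (elim dvdE)
  with eq d' have n: "n = n' * e" by (simp add: mult.left_commute mult.commute)
  have *: "poly (map_poly h (p * r)) y = poly (map_poly h p) y * poly (map_poly h r) y" for p r
    by (simp add: mh.hom_mult)
  have "rat_eval h (to_fract n / to_fract d) y = poly (map_poly h n') y / poly (map_poly h d') y"
    by (simp add: rat_eval_def q)
  also have "\<dots> = poly (map_poly h n) y / poly (map_poly h d) y"
    using nz unfolding n e * by simp
  finally show ?thesis .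
qed

text \<open>A rational function \<open>N / E\<close> with period one takes the same value at infinitely many points,
  so it is constant; an odd constant is zero.\<close>

lemma periodic_odd_rational_zero:
  fixes N E :: "real poly"
  assumes E: "E \<noteq> 0" and per: "(N \<circ>\<^sub>p [:1, 1:]) * E = N * (E \<circ>\<^sub>p [:1, 1:])"
    and odd: "(N \<circ>\<^sub>p [:0, -1:]) * E = - (N * (E \<circ>\<^sub>p [:0, -1:]))"
  shows "N = 0"
proof -
  have fin: "finite {t. poly E t = 0}" by (rule poly_roots_finite[OF E])
  define t0 where "t0 = Max (insert 0 {t. poly E t = 0})"
  have t0: "t \<le> t0" if "poly E t = 0" for t
    unfolding t0_def by (rule Max_ge) (use fin that in simp_all)
  define t where "t k = t0 + 1 + real k" for k
  \<comment> \<open>a progression with step one beyond all zeros of \<open>E\<close>\<close>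
  have nz: "poly E (t k) \<noteq> 0" for k using t0[of "t k"] by (auto simp: t_def)
  define r where "r = poly N (t 0) / poly E (t 0)"
  have shift: "poly (N \<circ>\<^sub>p [:1, 1:]) (t k) = poly N (t (Suc k))"
    "poly (E \<circ>\<^sub>p [:1, 1:]) (t k) = poly E (t (Suc k))" for k
    by (simp_all add: poly_pcompose t_def add_ac)
  have "poly N (t k) = r * poly E (t k)" for k
  proof (induction k)
    case 0
    then show ?case using nz[of 0] by (simp add: r_def)
  next
    case (Suc k)
    have "poly N (t (Suc k)) * poly E (t k) = poly N (t k) * poly E (t (Suc k))"
      using arg_cong[OF per, of "\<lambda>p. poly p (t k)"] by (simp add: shift)
    with Suc nz[of k] show ?case by simp
  qed
  then have "range t \<subseteq> {u. poly (N - Polynomial.smult r E) u = 0}" by auto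
  moreover have "infinite (range t)"
    by (rule range_inj_infinite) (simp add: inj_def t_def)
  ultimately have "infinite {u. poly (N - Polynomial.smult r E) u = 0}"
    using finite_subset by blast
  then have N: "N = Polynomial.smult r E"
    using poly_roots_finite[of "N - Polynomial.smult r E"] by auto
  have "E \<circ>\<^sub>p [:0, -1:] \<noteq> 0" using E by (simp add: pcompose_eq_0_iff)
  moreover have "Polynomial.smult (2 * r) ((E \<circ>\<^sub>p [:0, -1:]) * E) = 0"
  proof -
    have "Polynomial.smult r ((E \<circ>\<^sub>p [:0, -1:]) * E) = - Polynomial.smult r ((E \<circ>\<^sub>p [:0, -1:]) * E)"
      using odd by (simp add: N pcompose_smult mult.commute)
    then show ?thesis by (simp add: eq_neg_iff_add_eq_0 flip: smult_add_left)
  qed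
  ultimately have "r = 0" using E by auto
  with N show ?thesis by simp
qed

text \<open>This is the passage between the difference equation for \<open>x B(x)\<close>, cleared of denominators, and
  the one for \<open>B\<close>, where \<open>a\<close> stands for \<open>x + 1\<close> and \<open>u\<close>, \<open>v\<close> for the values of \<open>x B(x)\<close> at \<open>x + 1\<close> and
  \<open>x\<close>.\<close>

lemma difference_quotient_form:
  fixes x a u v :: "'a::field"
  assumes nz: "x \<noteq> 0" "a \<noteq> 0" "a + x \<noteq> 0"
    and key: "(a + x) * (x * u - a * v) = (a * (- x)) ^ q * (x * a ^ m + a * (- x) ^ m)"
  shows "u / a - v / x = (a ^ m / a - (- x) ^ m / (- x)) / (a - (- x)) * a ^ q * (- x) ^ q"
proof -
  define K where "K = x * a ^ m + a * (- x) ^ m"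
  have "(a + x) * (x * u - a * v) = a ^ q * (- x) ^ q * K"
    using key by (simp only: K_def power_mult_distrib)
  then have *: "x * u - a * v = a ^ q * (- x) ^ q * K / (a + x)"
    using nz(3) by (metis nonzero_mult_div_cancel_left)
  have "u / a - v / x = (x * u - a * v) / (a * x)"
    using nz by (simp add: diff_frac_eq mult.commute)
  also have "\<dots> = (K / (a * x)) / (a + x) * a ^ q * (- x) ^ q"
    unfolding * by (simp only: times_divide_eq_left times_divide_eq_right divide_divide_eq_left mult_ac)
  also have "K / (a * x) = a ^ m / a - (- x) ^ m / (- x)"
    using nz by (simp add: K_def add_divide_distrib)
  finally show ?thesis by simp
qed

text \<open>The quotient satisfies the defining conditions of \<open>B\<^bsub>m-1,q\<^esub>\<close>. The difference of two solutions
  is a periodic odd rational function, hence zero.\<close>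

lemma B_fract_eq: "B_fract (int m - 1) q = to_fract (cpoly m q) / to_fract [:0, 1:]"
proof -
  let ?x = "to_fract [:0, 1::real:]" and ?h = "\<lambda>c::real. to_fract [:c:]"
  define c where "c = cpoly m q"
  have h: "comm_ring_hom ?h"
    by standard (simp_all add: mult.commute flip: to_fract_add to_fract_mult one_pCons)
  have xA: "?x + 1 = to_fract [:1, 1:]" and xD: "- ?x = to_fract [:0, -1:]"
    by (simp_all flip: to_fract_add to_fract_1 to_fract_uminus add: one_pCons)
  have nz: "?x \<noteq> 0" "?x + 1 \<noteq> 0" "?x + 1 + ?x \<noteq> 0"
    unfolding xA by (simp_all flip: to_fract_add)
  have ev: "rat_eval ?h b (to_fract Q) = to_fract (fst (quot_of_fract b) \<circ>\<^sub>p Q) / to_fract (snd (quot_of_fract b) \<circ>\<^sub>p Q)" for b Q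
    by (simp add: rat_eval_def poly_map_poly_const_fract split: prod.split)
  have evc: "rat_eval ?h (to_fract c / ?x) (to_fract Q) = to_fract (c \<circ>\<^sub>p Q) / to_fract Q" if "Q \<noteq> 0" for Q
    using that by (subst rat_eval_quotient[OF h])
      (simp_all add: poly_map_poly_const_fract pcompose_pCons flip: one_pCons)
  define P where "P b \<longleftrightarrow> rat_eval ?h b (?x + 1) - b =
      ((?x + 1) powi (int m - 1) - (- ?x) powi (int m - 1)) / ((?x + 1) - (- ?x)) * (?x + 1) ^ q * (- ?x) ^ q
       \<and> rat_eval ?h b (- ?x) = - b" for b
  have Pc: "P (to_fract c / ?x)"
    unfolding P_def
  proof
    have "(?x + 1 + ?x) * (?x * to_fract (c \<circ>\<^sub>p [:1, 1:]) - (?x + 1) * to_fract c) =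
        ((?x + 1) * (- ?x)) ^ q * (?x * (?x + 1) ^ m + (?x + 1) * (- ?x) ^ m)"
    proof -
      have "?x + 1 + ?x = to_fract [:1, 2:]" unfolding xA by (simp flip: to_fract_add)
      then show ?thesis
        using arg_cong[OF difference_cpoly[of m q], of to_fract, folded c_def]
        unfolding xD xA by (simp only: to_fract_mult to_fract_diff tf.hom_power to_fract_add)
    qed
    note key = difference_quotient_form[OF nz this]
    have pw: "y powi (int m - 1) = y ^ m / y" if "y \<noteq> 0" for y :: "real poly fract"
      using that by (simp add: power_int_diff)
    have "rat_eval ?h (to_fract c / ?x) (?x + 1) - to_fract c / ?x =
        to_fract (c \<circ>\<^sub>p [:1, 1:]) / (?x + 1) - to_fract c / ?x"
      unfolding xA by (subst evc) simp_all
    also note key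
    finally show "rat_eval ?h (to_fract c / ?x) (?x + 1) - to_fract c / ?x =
      ((?x + 1) powi (int m - 1) - (- ?x) powi (int m - 1)) / ((?x + 1) - (- ?x)) * (?x + 1) ^ q * (- ?x) ^ q"
      using nz by (simp add: pw)
    show "rat_eval ?h (to_fract c / ?x) (- ?x) = - (to_fract c / ?x)"
      unfolding xD by (subst evc) (simp_all add: c_def even_cpoly flip: xD)
  qed
  have uniq: "b = to_fract c / ?x" if b: "P b" for b
  proof -
    define n where "n = fst (quot_of_fract b)"
    define d where "d = snd (quot_of_fract b)"
    note evb = ev[of b, folded n_def d_def]
    have d: "d \<noteq> 0" by (simp add: d_def)
    \<comment> \<open>\<open>N / E\<close> is the difference of the two solutions\<close>
    have bq: "b = to_fract n / to_fract d"
      using Fract_quot_of_fract[of b] d by (simp add: n_def d_def to_fract_def)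
    define N where "N = n * [:0, 1:] - c * d"
    define E where "E = d * [:0, 1:]"
    have u: "to_fract (n \<circ>\<^sub>p Q) / to_fract (d \<circ>\<^sub>p Q) - to_fract (c \<circ>\<^sub>p Q) / to_fract Q =
        to_fract (N \<circ>\<^sub>p Q) / to_fract (E \<circ>\<^sub>p Q)" if "d \<circ>\<^sub>p Q \<noteq> 0" "Q \<noteq> 0" for Q
      using that unfolding N_def E_def
      by (simp add: pcompose_diff pcompose_mult pcompose_pCons diff_frac_eq mult.commute)
    have dA: "d \<circ>\<^sub>p [:1, 1:] \<noteq> 0" and dD: "d \<circ>\<^sub>p [:0, -1:] \<noteq> 0" and dX: "d \<circ>\<^sub>p [:0, 1:] \<noteq> 0"
      using d by (simp_all add: pcompose_eq_0_iff)
    have uX: "b - to_fract c / ?x = to_fract N / to_fract E"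
      using u[OF dX] by (simp add: bq pcompose_idR)
    have E: "E \<noteq> 0" using d by (simp add: E_def)
    have EA: "E \<circ>\<^sub>p [:1, 1:] \<noteq> 0" and ED: "E \<circ>\<^sub>p [:0, -1:] \<noteq> 0"
      using E by (simp_all add: pcompose_eq_0_iff)
    have "rat_eval ?h b (?x + 1) - rat_eval ?h (to_fract c / ?x) (?x + 1) = b - to_fract c / ?x"
      using b Pc by (simp add: P_def algebra_simps)
    then have "to_fract (N \<circ>\<^sub>p [:1, 1:]) / to_fract (E \<circ>\<^sub>p [:1, 1:]) = to_fract N / to_fract E"
      unfolding uX xA by (simp add: evb evc flip: u[OF dA])
    then have per: "(N \<circ>\<^sub>p [:1, 1:]) * E = N * (E \<circ>\<^sub>p [:1, 1:])"
      using E EA by (simp add: frac_eq_eq flip: to_fract_mult)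
    have "rat_eval ?h b (- ?x) - rat_eval ?h (to_fract c / ?x) (- ?x) = - (b - to_fract c / ?x)"
      using b Pc by (simp add: P_def algebra_simps)
    then have "to_fract (N \<circ>\<^sub>p [:0, -1:]) / to_fract (E \<circ>\<^sub>p [:0, -1:]) = to_fract (- N) / to_fract E"
      unfolding uX xD by (simp add: evb evc flip: u[OF dD])
    then have odd: "(N \<circ>\<^sub>p [:0, -1:]) * E = - (N * (E \<circ>\<^sub>p [:0, -1:]))"
      using E ED by (simp add: frac_eq_eq flip: to_fract_mult to_fract_uminus)
    have "N = 0" by (rule periodic_odd_rational_zero[OF E per odd])
    with uX show ?thesis by simp
  qed
  have "B_fract (int m - 1) q = (THE b. P b)"
    by (simp add: B_fract_def P_def Let_def)
  also have "\<dots> = to_fract c / ?x"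
    using Pc uniq by (rule the_equality)
  finally show ?thesis by (simp add: c_def)
qed

section \<open>Homogenization\<close>

text \<open>The homogenization \<open>z\<^bsup>m+2q\<^esup> c(x / z)\<close> of \<open>c = cpoly m q\<close>, over an arbitrary commutative ring: it
  will be used over the polynomial ring and its fraction field, over univariate polynomials, and
  over the reals at \<open>z = 0\<close>.\<close>

definition Cform :: "(real \<Rightarrow> 'a::comm_ring_1) \<Rightarrow> nat \<Rightarrow> nat \<Rightarrow> 'a \<Rightarrow> 'a \<Rightarrow> 'a" where
  "Cform h m q x z = (\<Sum>i\<le>m + 2 * q. h (coeff (cpoly m q) i) * x ^ i * z ^ (m + 2 * q - i))"

lemma Cform_hom:
  assumes "comm_ring_hom g"
  shows "g (Cform h m q x z) = Cform (\<lambda>c. g (h c)) m q (g x) (g z)"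
proof -
  interpret g: comm_ring_hom g by (rule assms)
  show ?thesis by (simp add: Cform_def g.hom_sum g.hom_mult g.hom_power)
qed

lemma coeff_cpoly_odd: "odd i \<Longrightarrow> coeff (cpoly m q) i = 0"
  using arg_cong[OF even_cpoly[of m q], of "\<lambda>p. coeff p i"]
  by (simp add: coeff_pcompose_linear)

lemma Cform_uminus:
  assumes "h 0 = 0"
  shows "Cform h m q (- x) z = Cform h m q x z"
  unfolding Cform_def
proof (rule sum.cong[OF refl])
  fix i
  show "h (coeff (cpoly m q) i) * (- x) ^ i * z ^ (m + 2 * q - i) = h (coeff (cpoly m q) i) * x ^ i * z ^ (m + 2 * q - i)"
    by (cases "even i") (simp_all add: coeff_cpoly_odd assms)
qed

lemma Cform_scale: "Cform h m q (c * x) (c * z) = c ^ (m + 2 * q) * Cform h m q x z"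
  unfolding Cform_def sum_distrib_left
proof (rule sum.cong[OF refl])
  fix i assume "i \<in> {..m + 2 * q}"
  then have "c ^ (m + 2 * q) = c ^ i * c ^ (m + 2 * q - i)" by (simp flip: power_add)
  then show "h (coeff (cpoly m q) i) * (c * x) ^ i * (c * z) ^ (m + 2 * q - i) =
      c ^ (m + 2 * q) * (h (coeff (cpoly m q) i) * x ^ i * z ^ (m + 2 * q - i))"
    by (simp only: power_mult_distrib) (simp only: mult_ac)
qed

lemma poly_sum_bound:
  fixes P :: "'a::comm_semiring_1 poly"
  assumes "degree P \<le> n"
  shows "poly P x = (\<Sum>i\<le>n. coeff P i * x ^ i)"
  unfolding poly_altdef
  by (rule sum.mono_neutral_left) (use assms in \<open>auto simp: coeff_eq_0\<close>)

lemma Cform_field: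
  fixes h :: "real \<Rightarrow> 'a::field"
  assumes h: "h 0 = 0" and z: "z \<noteq> 0"
  shows "Cform h m q x z = z ^ (m + 2 * q) * poly (map_poly h (cpoly m q)) (x / z)"
proof -
  have "degree (map_poly h (cpoly m q)) \<le> m + 2 * q"
    using degree_map_poly_le[of h "cpoly m q"] degree_cpoly[of m q] by simp
  then have "poly (map_poly h (cpoly m q)) (x / z) = (\<Sum>i\<le>m + 2 * q. h (coeff (cpoly m q) i) * (x / z) ^ i)"
    by (simp add: poly_sum_bound coeff_map_poly h)
  moreover have "h (coeff (cpoly m q) i) * x ^ i * z ^ (m + 2 * q - i) =
      z ^ (m + 2 * q) * (h (coeff (cpoly m q) i) * (x / z) ^ i)" if "i \<le> m + 2 * q" for i
  proof -
    have "z ^ (m + 2 * q) = z ^ (m + 2 * q - i) * z ^ i" using that by (simp flip: power_add)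
    then show ?thesis using z by (simp add: power_divide)
  qed
  ultimately show ?thesis
    unfolding Cform_def by (simp only: sum_distrib_left) (intro sum.cong refl, simp)
qed

lemma Cform_difference_field:
  fixes h :: "real \<Rightarrow> 'a::field"
  assumes h: "comm_ring_hom h" and z: "z \<noteq> 0"
  shows "(2 * x + z) * (x * Cform h m q (x + z) z - (x + z) * Cform h m q x z) =
    z * ((x + z) * (- x)) ^ q * (x * (x + z) ^ m + (x + z) * (- x) ^ m)"
proof -
  interpret h: comm_ring_hom h by (rule h)
  interpret mh: map_poly_comm_ring_hom h ..
  define u where "u = x / z"
  have x: "x = z * u" and xz: "x + z = z * (1 + u)" and xz2: "2 * x + z = z * (1 + 2 * u)"
    using z by (simp_all add: u_def algebra_simps)
  define c where "c v = poly (map_poly h (cpoly m q)) v" for v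
  have C: "Cform h m q x z = z ^ (m + 2 * q) * c u" "Cform h m q (x + z) z = z ^ (m + 2 * q) * c (1 + u)"
    unfolding c_def using z by (simp_all add: Cform_field u_def add_divide_distrib add.commute)
  define D where "D = (1 + 2 * u) * (u * c (1 + u) - (1 + u) * c u)"
  have "map_poly h [:1, 2:] = [:1, 2:]" "map_poly h [:0, 1:] = [:0, 1:]"
    "map_poly h [:1, 1:] = [:1, 1:]" "map_poly h [:0, -1:] = [:0, -1:]"
    using h.hom_add[of 1 1] by (simp_all add: h.map_poly_pCons_hom h.hom_uminus)
  note lin = this
  have plin: "poly [:1, 2:] u = 1 + 2 * u" "poly [:0, 1:] u = u" "poly [:1, 1:] u = 1 + u" "poly [:0, -1:] u = - u"
    by (simp_all add: mult.commute)
  have "D = ((1 + u) * (- u)) ^ q * (u * (1 + u) ^ m + (1 + u) * (- u) ^ m)"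
    using arg_cong[OF difference_cpoly[of m q], of "\<lambda>p. poly (map_poly h p) u"]
    unfolding mh.hom_mult mh.hom_minus mh.hom_add mh.hom_power h.map_poly_pcompose lin
    by (simp only: poly_pcompose D_def c_def poly_mult poly_diff poly_add poly_power plin)
  moreover have "((x + z) * (- x)) ^ q = z ^ (2 * q) * ((1 + u) * (- u)) ^ q"
  proof -
    have "(x + z) * (- x) = z ^ 2 * ((1 + u) * (- u))"
      unfolding xz unfolding x by (simp add: power2_eq_square mult_ac)
    then show ?thesis by (simp only: power_mult_distrib power_mult)
  qed
  moreover have "x * (x + z) ^ m + (x + z) * (- x) ^ m = z ^ (m + 1) * (u * (1 + u) ^ m + (1 + u) * (- u) ^ m)"
  proof -
    have "- x = z * (- u)" by (simp add: x)
    then have "(- x) ^ m = z ^ m * (- u) ^ m" by (simp only: power_mult_distrib)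
    moreover have "(x + z) ^ m = z ^ m * (1 + u) ^ m" by (simp only: xz power_mult_distrib)
    ultimately have "x * (x + z) ^ m + (x + z) * (- x) ^ m = x * (z ^ m * (1 + u) ^ m) + (x + z) * (z ^ m * (- u) ^ m)"
      by (simp only:)
    also have "\<dots> = z * u * (z ^ m * (1 + u) ^ m) + z * (1 + u) * (z ^ m * (- u) ^ m)"
      unfolding xz unfolding x ..
    also have "\<dots> = z ^ (m + 1) * (u * (1 + u) ^ m + (1 + u) * (- u) ^ m)"
      by (simp only: power_add power_one_right distrib_left distrib_right mult_ac)
    finally show ?thesis .
  qed
  moreover have "z ^ (m + 2 * q + 2) = z * z ^ (2 * q) * z ^ (m + 1)"
    by (simp add: power_add power2_eq_square)
  ultimately have "z ^ (m + 2 * q + 2) * D = z * ((x + z) * (- x)) ^ q * (x * (x + z) ^ m + (x + z) * (- x) ^ m)"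
    by (simp only: mult_ac)
  moreover have "(2 * x + z) * (x * Cform h m q (x + z) z - (x + z) * Cform h m q x z) = z ^ (m + 2 * q + 2) * D"
    unfolding C D_def unfolding xz2 xz unfolding x by (simp add: algebra_simps power2_eq_square)
  ultimately show ?thesis by simp
qed

text \<open>An identity between ring elements may be checked in the fraction field.\<close>

lemma Cform_difference:
  fixes h :: "real \<Rightarrow> 'a::idom"
  assumes h: "comm_ring_hom h" and z: "z \<noteq> 0"
  shows "(2 * x + z) * (x * Cform h m q (x + z) z - (x + z) * Cform h m q x z) =
    z * ((x + z) * (- x)) ^ q * (x * (x + z) ^ m + (x + z) * (- x) ^ m)"
proof -
  interpret h: comm_ring_hom h by (rule h)
  have "comm_ring_hom (\<lambda>c. to_fract (h c))"
    by standard (simp_all add: h.hom_add h.hom_mult)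
  moreover have "to_fract z \<noteq> 0" using z by simp
  ultimately have "(2 * to_fract x + to_fract z) * (to_fract x * to_fract (Cform h m q (x + z) z) - (to_fract x + to_fract z) * to_fract (Cform h m q x z)) =
    to_fract z * ((to_fract x + to_fract z) * (- to_fract x)) ^ q * (to_fract x * (to_fract x + to_fract z) ^ m + (to_fract x + to_fract z) * (- to_fract x) ^ m)"
    unfolding Cform_hom[OF to_fract_ring_hom] tf.hom_add by (rule Cform_difference_field)
  then have "to_fract ((2 * x + z) * (x * Cform h m q (x + z) z - (x + z) * Cform h m q x z)) =
    to_fract (z * ((x + z) * (- x)) ^ q * (x * (x + z) ^ m + (x + z) * (- x) ^ m))"
    by (simp only: tf.hom_mult tf.hom_add tf.hom_minus tf.hom_power tf.hom_uminus tf.hom_numeral)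
  then show ?thesis by (simp only: to_fract_eq_iff)
qed

lemma Bbar_eq:
  assumes "x \<noteq> 0" "z \<noteq> 0"
  shows "Bbar (int m - 1) q x z = Cform (\<lambda>c. to_fract (Const c)) m q x z / x"
proof -
  let ?h = "\<lambda>c. to_fract (Const c)"
  have h: "comm_ring_hom ?h" by standard (simp_all add: Const.hom_add Const.hom_mult)
  interpret h: comm_ring_hom ?h by (rule h)
  have X: "poly (map_poly ?h [:0, 1:]) (x / z) = x / z"
    by (simp add: h.map_poly_pCons_hom)
  have "rat_eval ?h (B_fract (int m - 1) q) (x / z) = poly (map_poly ?h (cpoly m q)) (x / z) / (x / z)"
    unfolding B_fract_eq using assms by (subst rat_eval_quotient[OF h]) (simp_all add: X)
  moreover have "z powi (int m - 1 + 2 * int q) = z ^ (m + 2 * q) / z"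
  proof -
    have "int m - 1 + 2 * int q = int (m + 2 * q) - 1" by simp
    then show ?thesis using assms by (simp only: power_int_diff power_int_of_nat power_int_1_right simp_thms)
  qed
  ultimately show ?thesis
    using assms by (simp add: Bbar_def Cform_field)
qed

text \<open>Replacing \<open>A\<^sup>q y\<^sup>m\<close> by \<open>x B\<^bsub>m-1,q\<^esub>(x)\<close>, homogenized, in the product \<open>W(A) G(y)\<close>. The ranges are
  fixed, rather than given by the degrees of \<open>W\<close> and \<open>G\<close>, so that the expression commutes with ring
  homomorphisms that lower degrees.\<close>

definition Esum :: "(real \<Rightarrow> 'a::comm_ring_1) \<Rightarrow> nat \<Rightarrow> 'a poly \<Rightarrow> 'a poly \<Rightarrow> 'a \<Rightarrow> 'a \<Rightarrow> 'a" where
  "Esum h l W G x z = (\<Sum>q\<le>l. \<Sum>m\<le>2 * l. coeff W q * coeff G m * Cform h m q x z)"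

lemma Esum_hom:
  assumes "comm_ring_hom g"
  shows "g (Esum h l W G x z) = Esum (\<lambda>c. g (h c)) l (map_poly g W) (map_poly g G) (g x) (g z)"
proof -
  interpret g: comm_ring_hom g by (rule assms)
  show ?thesis
    by (simp add: Esum_def g.hom_sum g.hom_mult coeff_map_poly Cform_hom[OF assms])
qed

lemma Esum_uminus: "h 0 = 0 \<Longrightarrow> Esum h l W G (- x) z = Esum h l W G x z"
  by (simp add: Esum_def Cform_uminus)

lemma Esum_scale:
  assumes W: "W' \<circ>\<^sub>p [:0, c ^ 2:] = Polynomial.smult (c ^ a) W"
    and G: "G' \<circ>\<^sub>p [:0, c:] = Polynomial.smult (c ^ b) G"
  shows "Esum h l W' G' (c * x) (c * z) = c ^ (a + b) * Esum h l W G x z"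
  unfolding Esum_def sum_distrib_left
proof (intro sum.cong[OF refl])
  fix q m
  have "c ^ (2 * q) * coeff W' q = c ^ a * coeff W q"
    using arg_cong[OF W, of "\<lambda>p. coeff p q"] by (simp add: coeff_pcompose_linear power_mult)
  moreover have "c ^ m * coeff G' m = c ^ b * coeff G m"
    using arg_cong[OF G, of "\<lambda>p. coeff p m"] by (simp add: coeff_pcompose_linear)
  moreover have "coeff W' q * coeff G' m * Cform h m q (c * x) (c * z) =
      (c ^ (2 * q) * coeff W' q) * (c ^ m * coeff G' m) * Cform h m q x z"
    unfolding Cform_scale power_add by (simp only: mult_ac)
  ultimately show "coeff W' q * coeff G' m * Cform h m q (c * x) (c * z) =
      c ^ (a + b) * (coeff W q * coeff G m * Cform h m q x z)"
    unfolding power_add by (simp only: mult_ac)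
qed

text \<open>The difference equation turns the symbol \<open>A\<^sup>q y\<^sup>m\<close> into actual powers: \<open>A\<close> becomes
  \<open>-x (x + z)\<close>, and \<open>y\<close> becomes \<open>x + z\<close> in one summand and \<open>-x\<close> in the other. Thus the double sum
  factors.\<close>

lemma Esum_difference:
  fixes h :: "real \<Rightarrow> 'a::idom"
  assumes h: "comm_ring_hom h" and z: "z \<noteq> 0" and W: "degree W \<le> l" and G: "degree G \<le> 2 * l"
  shows "(2 * x + z) * (x * Esum h l W G (x + z) z - (x + z) * Esum h l W G x z) =
    z * poly W ((x + z) * (- x)) * (x * poly G (x + z) + (x + z) * poly G (- x))"
proof -
  let ?A = "(x + z) * (- x)"
  have "(2 * x + z) * (x * Esum h l W G (x + z) z - (x + z) * Esum h l W G x z) =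
      (\<Sum>q\<le>l. \<Sum>m\<le>2 * l. coeff W q * coeff G m *
        ((2 * x + z) * (x * Cform h m q (x + z) z - (x + z) * Cform h m q x z)))"
    unfolding Esum_def sum_distrib_left sum_subtractf[symmetric]
    by (intro sum.cong refl) (simp only: algebra_simps)
  also have "\<dots> = (\<Sum>q\<le>l. \<Sum>m\<le>2 * l. z * (coeff W q * ?A ^ q) *
      (x * (coeff G m * (x + z) ^ m) + (x + z) * (coeff G m * (- x) ^ m)))"
    unfolding Cform_difference[OF h z]
    by (intro sum.cong refl) (simp only: distrib_left mult_ac)
  also have "\<dots> = (\<Sum>q\<le>l. z * (coeff W q * ?A ^ q)) *
      (\<Sum>m\<le>2 * l. x * (coeff G m * (x + z) ^ m) + (x + z) * (coeff G m * (- x) ^ m))"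
    by (rule sum_product[symmetric])
  also have "(\<Sum>q\<le>l. z * (coeff W q * ?A ^ q)) = z * poly W ?A"
    by (simp add: poly_sum_bound[OF W] sum_distrib_left)
  also have "(\<Sum>m\<le>2 * l. x * (coeff G m * (x + z) ^ m) + (x + z) * (coeff G m * (- x) ^ m)) =
      x * poly G (x + z) + (x + z) * poly G (- x)"
    by (simp add: poly_sum_bound[OF G] sum.distrib sum_distrib_left)
  finally show ?thesis .
qed

section \<open>Generating functions\<close>

definition Wpoly :: "(nat \<Rightarrow> 'a::comm_ring_1) \<Rightarrow> 'a \<Rightarrow> nat \<Rightarrow> 'a poly" where
  "Wpoly y z j = (\<Prod>r\<in>{1..<j}. [:y r ^ 2 - z * y r, 1:])"

definition Gpoly :: "(nat \<Rightarrow> 'a::comm_ring_1) \<Rightarrow> nat \<Rightarrow> nat \<Rightarrow> 'a poly" where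
  "Gpoly y l j = (if j < l
     then (\<Prod>r\<in>{j, j + 1}. [:- y r, 1:]) * (\<Prod>r\<in>{j + 2..l}. [:- (y r ^ 2), 0, 1:])
     else [:- y l:])"

definition prefactor :: "(nat \<Rightarrow> 'a::comm_ring_1) \<Rightarrow> 'a \<Rightarrow> nat \<Rightarrow> nat \<Rightarrow> 'a" where
  "prefactor y z l j = (if j < l then y j - y (j + 1) - z else 1)"

text \<open>This is \<open>x\<close> times the coefficient function of \<open>\<phi>\<^sub>j\<close>: its value at \<open>x = x\<^sub>i\<close> is \<open>x\<^sub>i\<close> times the
  coefficient of \<open>\<partial>/\<partial>x\<^sub>i\<close>. The variables \<open>y\<close> are kept apart from the argument \<open>x\<close> so that the
  difference equation in \<open>x\<close> can be stated.\<close>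

definition phi_num :: "(real \<Rightarrow> 'a::comm_ring_1) \<Rightarrow> nat \<Rightarrow> nat \<Rightarrow> (nat \<Rightarrow> 'a) \<Rightarrow> 'a \<Rightarrow> 'a \<Rightarrow> 'a" where
  "phi_num h l j y z x = prefactor y z l j * Esum h l (Wpoly y z j) (Gpoly y l j) x z"

lemma degree_Wpoly: "degree (Wpoly y z j) \<le> j - 1"
proof -
  have "degree (Wpoly y z j) \<le> sum (degree \<circ> (\<lambda>r. [:y r ^ 2 - z * y r, 1:])) {1..<j}"
    unfolding Wpoly_def by (rule degree_prod_sum_le) simp
  also have "\<dots> \<le> (\<Sum>r\<in>{1..<j}. 1)" by (rule sum_mono) simp
  finally show ?thesis by simp
qed

lemma degree_Gpoly: "j \<le> l \<Longrightarrow> degree (Gpoly y l j) \<le> 2 * (l - j)"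
proof (cases "j < l")
  case True
  have "degree (\<Prod>r\<in>{j, j + 1}. [:- y r, 1:]) \<le> sum (degree \<circ> (\<lambda>r. [:- y r, 1:])) {j, j + 1}"
    by (rule degree_prod_sum_le) simp
  also have "\<dots> \<le> (\<Sum>r\<in>{j, j + 1}. 1)" by (rule sum_mono) simp
  also have "\<dots> = 2" by simp
  finally have 1: "degree (\<Prod>r\<in>{j, j + 1}. [:- y r, 1:]) \<le> 2" .
  have "degree (\<Prod>r\<in>{j + 2..l}. [:- (y r ^ 2), 0, 1:]) \<le> sum (degree \<circ> (\<lambda>r. [:- (y r ^ 2), 0, 1:])) {j + 2..l}"
    by (rule degree_prod_sum_le) simp
  also have "\<dots> \<le> (\<Sum>r\<in>{j + 2..l}. 2)" by (rule sum_mono) simp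
  also have "\<dots> = 2 * (l - j - 1)" by simp
  finally have 2: "degree (\<Prod>r\<in>{j + 2..l}. [:- (y r ^ 2), 0, 1:]) \<le> 2 * (l - j - 1)" .
  have "degree (Gpoly y l j) \<le> degree (\<Prod>r\<in>{j, j + 1}. [:- y r, 1:]) + degree (\<Prod>r\<in>{j + 2..l}. [:- (y r ^ 2), 0, 1:])"
    using True by (simp only: Gpoly_def if_True degree_mult_le)
  with 1 2 True show ?thesis by linarith
qed (simp add: Gpoly_def)

lemma poly_Wpoly: "poly (Wpoly y z j) A = (\<Prod>r\<in>{1..<j}. y r ^ 2 - z * y r + A)"
  by (simp add: Wpoly_def poly_prod)

lemma poly_Gpoly: "poly (Gpoly y l j) x =
   (if j < l then (x - y j) * (x - y (j + 1)) * (\<Prod>r\<in>{j + 2..l}. x ^ 2 - y r ^ 2) else - y l)"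
  by (simp only: Gpoly_def poly_mult poly_prod if_distrib[of "\<lambda>p. poly p x"]) (simp add: power2_eq_square)

lemma poly_Gpoly_root: "j < l \<Longrightarrow> j \<le> s \<Longrightarrow> s \<le> l \<Longrightarrow> poly (Gpoly y l j) (y s) = 0"
proof (cases "s = j \<or> s = j + 1")
  case False
  assume "j < l" "j \<le> s" "s \<le> l"
  with False have "(\<Prod>r\<in>{j + 2..l}. y s ^ 2 - y r ^ 2) = 0"
    by (intro prod_zero bexI[of _ s]) auto
  then show ?thesis by (simp add: poly_Gpoly \<open>j < l\<close>)
qed (auto simp: poly_Gpoly)

lemma poly_Gpoly_root_uminus: "j < l \<Longrightarrow> j + 2 \<le> s \<Longrightarrow> s \<le> l \<Longrightarrow> poly (Gpoly y l j) (- y s) = 0"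
proof -
  assume "j < l" "j + 2 \<le> s" "s \<le> l"
  then have "(\<Prod>r\<in>{j + 2..l}. (- y s) ^ 2 - y r ^ 2) = 0"
    by (intro prod_zero bexI[of _ s]) auto
  then show ?thesis by (simp only: poly_Gpoly \<open>j < l\<close> if_True mult_zero_right)
qed

lemma phi_num_hom:
  assumes "comm_ring_hom g"
  shows "g (phi_num h l j y z x) = phi_num (\<lambda>c. g (h c)) l j (\<lambda>r. g (y r)) (g z) (g x)"
proof -
  interpret g: comm_ring_hom g by (rule assms)
  interpret mg: map_poly_comm_ring_hom g ..
  have "map_poly g (Wpoly y z j) = Wpoly (\<lambda>r. g (y r)) (g z) j"
    by (simp add: Wpoly_def mg.hom_prod g.map_poly_pCons_hom g.hom_minus g.hom_mult g.hom_power)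
  moreover have "map_poly g (Gpoly y l j) = Gpoly (\<lambda>r. g (y r)) l j"
    unfolding Gpoly_def if_distrib[of "map_poly g"] mg.hom_prod mg.hom_mult g.map_poly_pCons_hom
      g.hom_uminus g.hom_power g.hom_zero g.hom_one map_poly_0 ..
  moreover have "g (prefactor y z l j) = prefactor (\<lambda>r. g (y r)) (g z) l j"
    by (simp add: prefactor_def g.hom_minus)
  ultimately show ?thesis
    by (simp add: phi_num_def g.hom_mult Esum_hom[OF assms])
qed

text \<open>Homogeneity: \<open>A\<close> has weight two and \<open>y\<close> weight one, for which \<open>W\<close> is homogeneous of degree
  \<open>2 (j - 1)\<close>; \<open>G\<close> has degree \<open>2 (l - j)\<close> and the prefactor degree one if \<open>j < l\<close>, while for \<open>j = l\<close>
  the degrees are one and zero.\<close>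

lemma phi_num_scale:
  assumes "1 \<le> j" "j \<le> l"
  shows "phi_num h l j (\<lambda>r. c * y r) (c * z) (c * x) = c ^ (2 * l - 1) * phi_num h l j y z x"
proof -
  have W: "Wpoly (\<lambda>r. c * y r) (c * z) j \<circ>\<^sub>p [:0, c ^ 2:] = Polynomial.smult (c ^ (2 * (j - 1))) (Wpoly y z j)"
  proof -
    have "[:(c * y r) ^ 2 - c * z * (c * y r), 1:] \<circ>\<^sub>p [:0, c ^ 2:] = Polynomial.smult (c ^ 2) [:y r ^ 2 - z * y r, 1:]" for r
      by (simp add: pcompose_pCons power2_eq_square algebra_simps)
    then show ?thesis
      by (simp only: Wpoly_def pcompose_prod prod_smult power_mult prod_constant card_atLeastLessThan)
  qed
  show ?thesis
  proof (cases "j < l")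
    case True
    have 1: "[:- (c * y r), 1:] \<circ>\<^sub>p [:0, c:] = Polynomial.smult c [:- y r, 1:]" for r
      by (simp add: pcompose_pCons)
    have 2: "[:- ((c * y r) ^ 2), 0, 1:] \<circ>\<^sub>p [:0, c:] = Polynomial.smult (c ^ 2) [:- (y r ^ 2), 0, 1:]" for r
      by (simp add: pcompose_pCons power2_eq_square algebra_simps)
    have e: "c ^ 2 * (c ^ 2) ^ (l - j - 1) = c ^ (2 * (l - j))"
    proof -
      have "2 * (l - j) = 2 + 2 * (l - j - 1)" using True by simp
      then show ?thesis by (simp only: power_add power_mult)
    qed
    have "Gpoly (\<lambda>r. c * y r) l j \<circ>\<^sub>p [:0, c:] =
        (\<Prod>r\<in>{j, j + 1}. Polynomial.smult c [:- y r, 1:]) * (\<Prod>r\<in>{j + 2..l}. Polynomial.smult (c ^ 2) [:- (y r ^ 2), 0, 1:])"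
      using True by (simp only: Gpoly_def if_True pcompose_mult pcompose_prod 1 2)
    also have "\<dots> = Polynomial.smult (c ^ 2 * (c ^ 2) ^ (l - j - 1)) (Gpoly y l j)"
    proof -
      have J1: "card {j, j + 1} = 2" and J2: "card {j + 2..l} = l - j - 1" by simp_all
      show ?thesis
        using True by (simp only: prod_smult prod_constant J1 J2 Gpoly_def if_True mult_smult_left mult_smult_right smult_smult mult_ac)
    qed
    finally have G: "Gpoly (\<lambda>r. c * y r) l j \<circ>\<^sub>p [:0, c:] = Polynomial.smult (c ^ (2 * (l - j))) (Gpoly y l j)"
      unfolding e .
    have "prefactor (\<lambda>r. c * y r) (c * z) l j = c * prefactor y z l j"
      using True by (simp add: prefactor_def algebra_simps)
    moreover have "2 * l - 1 = Suc (2 * (j - 1) + 2 * (l - j))" using assms by simp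
    ultimately show ?thesis
      unfolding phi_num_def Esum_scale[OF W G] by (simp only: power_Suc mult_ac)
  next
    case False
    with assms have j: "j = l" by simp
    have G: "Gpoly (\<lambda>r. c * y r) l j \<circ>\<^sub>p [:0, c:] = Polynomial.smult (c ^ 1) (Gpoly y l j)"
      by (simp add: Gpoly_def j)
    have "2 * l - 1 = 2 * (j - 1) + 1" using assms j by simp
    then show ?thesis
      unfolding phi_num_def Esum_scale[OF W G] by (simp add: prefactor_def j)
  qed
qed

section \<open>Comparison with the combinatorial sums\<close>

text \<open>The linear functional \<open>X\<^sup>q \<mapsto> f q\<close> can be evaluated on any expansion of a polynomial into
  monomials. It transfers the expansions of \<open>W\<close> and \<open>G\<close> to sums of functions \<open>B\<^bsub>p,q\<^esub>\<close>.\<close>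

lemma sum_coeff_monom:
  fixes c :: "'s \<Rightarrow> 'a::comm_ring_1"
  assumes "\<And>s. s \<in> S \<Longrightarrow> d s \<le> n"
  shows "(\<Sum>q\<le>n. coeff (\<Sum>s\<in>S. monom (c s) (d s)) q * f q) = (\<Sum>s\<in>S. c s * f (d s))"
proof -
  have "(\<Sum>q\<le>n. coeff (\<Sum>s\<in>S. monom (c s) (d s)) q * f q) = (\<Sum>s\<in>S. \<Sum>q\<le>n. coeff (monom (c s) (d s)) q * f q)"
    unfolding coeff_sum sum_distrib_right by (rule sum.swap)
  also have "\<dots> = (\<Sum>s\<in>S. c s * f (d s))"
  proof (rule sum.cong[OF refl])
    fix s assume "s \<in> S"
    have "(\<Sum>q\<le>n. coeff (monom (c s) (d s)) q * f q) = (\<Sum>q\<le>n. if d s = q then c s * f q else 0)"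
      by (rule sum.cong) (auto simp: coeff_monom)
    also have "\<dots> = c s * f (d s)" using assms[OF \<open>s \<in> S\<close>] by simp
    finally show "(\<Sum>q\<le>n. coeff (monom (c s) (d s)) q * f q) = c s * f (d s)" .
  qed
  finally show ?thesis .
qed

lemma prod_const_poly: "(\<Prod>r\<in>K. [:a r:]) = [:\<Prod>r\<in>K. a r:]" for a :: "_ \<Rightarrow> 'a::comm_ring_1"
  by (induction K rule: infinite_finite_induct) (simp_all add: one_pCons)

text \<open>In \<open>\<Prod> (- z y\<^sub>r + (y\<^sub>r\<^sup>2 + A))\<close> each index chooses one of three summands: those in \<open>K\<^sub>1\<close> choose
  the first, those in \<open>K\<^sub>2\<close> the second, and the remaining ones choose \<open>A\<close>.\<close>

lemma Wpoly_expand: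
  fixes y :: "nat \<Rightarrow> 'a::comm_ring_1" and j :: nat
  defines "KK \<equiv> {(K1, K2). K1 \<subseteq> {1..<j} \<and> K2 \<subseteq> {1..<j} \<and> K1 \<inter> K2 = {}}"
  shows "Wpoly y z j = (\<Sum>s\<in>KK. monom ((\<Prod>r\<in>fst s. y r) * (\<Prod>r\<in>snd s. y r) ^ 2 * (- z) ^ card (fst s))
     (card ({1..<j} - (fst s \<union> snd s))))"
proof -
  let ?J = "{1..<j}"
  have "Wpoly y z j = (\<Prod>r\<in>?J. [:- z * y r:] + ([:y r ^ 2:] + [:0, 1:]))"
    unfolding Wpoly_def by (rule prod.cong) simp_all
  also have "\<dots> = (\<Sum>K1\<in>Pow ?J. (\<Prod>r\<in>K1. [:- z * y r:]) * (\<Prod>r\<in>?J - K1. [:y r ^ 2:] + [:0, 1:]))"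
    by (rule prod_add) simp
  also have "\<dots> = (\<Sum>K1\<in>Pow ?J. \<Sum>K2\<in>Pow (?J - K1).
      (\<Prod>r\<in>K1. [:- z * y r:]) * ((\<Prod>r\<in>K2. [:y r ^ 2:]) * (\<Prod>r\<in>?J - K1 - K2. [:0, 1:])))"
    by (simp only: prod_add finite_Diff finite_atLeastLessThan sum_distrib_left)
  also have "\<dots> = (\<Sum>s\<in>Sigma (Pow ?J) (\<lambda>K1. Pow (?J - K1)).
      (\<Prod>r\<in>fst s. [:- z * y r:]) * ((\<Prod>r\<in>snd s. [:y r ^ 2:]) * (\<Prod>r\<in>?J - fst s - snd s. [:0, 1:])))"
    by (subst sum.Sigma) (auto simp: case_prod_beta)
  also have "Sigma (Pow ?J) (\<lambda>K1. Pow (?J - K1)) = KK"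
    by (auto simp: KK_def)
  also have "(\<Sum>s\<in>KK. (\<Prod>r\<in>fst s. [:- z * y r:]) * ((\<Prod>r\<in>snd s. [:y r ^ 2:]) * (\<Prod>r\<in>?J - fst s - snd s. [:0, 1:]))) =
    (\<Sum>s\<in>KK. monom ((\<Prod>r\<in>fst s. y r) * (\<Prod>r\<in>snd s. y r) ^ 2 * (- z) ^ card (fst s))
     (card (?J - (fst s \<union> snd s))))"
  proof (rule sum.cong[OF refl])
    fix s :: "nat set \<times> nat set"
    have "(\<Prod>r\<in>fst s. [:- z * y r:]) = [:(- z) ^ card (fst s) * (\<Prod>r\<in>fst s. y r):]"
      by (simp only: prod_const_poly prod.distrib prod_constant)
    moreover have "(\<Prod>r\<in>snd s. [:y r ^ 2:]) = [:(\<Prod>r\<in>snd s. y r) ^ 2:]"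
      by (simp only: prod_const_poly prod_power_distrib)
    moreover have "(\<Prod>r\<in>?J - fst s - snd s. [:0, 1::'a:]) = monom 1 (card (?J - (fst s \<union> snd s)))"
    proof -
      have "?J - fst s - snd s = ?J - (fst s \<union> snd s)" by auto
      then show ?thesis by (simp add: monom_altdef)
    qed
    ultimately show "(\<Prod>r\<in>fst s. [:- z * y r:]) * ((\<Prod>r\<in>snd s. [:y r ^ 2:]) * (\<Prod>r\<in>?J - fst s - snd s. [:0, 1:])) =
        monom ((\<Prod>r\<in>fst s. y r) * (\<Prod>r\<in>snd s. y r) ^ 2 * (- z) ^ card (fst s)) (card (?J - (fst s \<union> snd s)))"
      by (simp add: smult_monom mult_ac)
  qed
  finally show ?thesis .
qed

lemma prod_linear_elem_sym:
  fixes y :: "'i \<Rightarrow> 'a::comm_ring_1"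
  assumes "finite I"
  shows "(\<Prod>r\<in>I. [:- y r, 1:]) = (\<Sum>n\<in>{0..card I}. monom ((- 1) ^ n * elem_sym n I y) (card I - n))"
proof -
  have "(\<Prod>r\<in>I. [:- y r, 1:]) = (\<Prod>r\<in>I. [:- y r:] + [:0, 1:])"
    by (rule prod.cong) simp_all
  also have "\<dots> = (\<Sum>T\<in>Pow I. (\<Prod>r\<in>T. [:- y r:]) * (\<Prod>r\<in>I - T. [:0, 1:]))"
    by (rule prod_add[OF assms])
  also have "\<dots> = (\<Sum>T\<in>Pow I. monom ((- 1) ^ card T * (\<Prod>r\<in>T. y r)) (card I - card T))"
  proof (rule sum.cong[OF refl])
    fix T assume T: "T \<in> Pow I"
    then have "finite T" using assms finite_subset by auto
    have "(\<Prod>r\<in>T. [:- y r:]) = [:(- 1) ^ card T * (\<Prod>r\<in>T. y r):]"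
      by (simp only: prod_const_poly prod_uminus)
    moreover have "(\<Prod>r\<in>I - T. [:0, 1::'a:]) = monom 1 (card I - card T)"
      using T \<open>finite T\<close> by (simp add: monom_altdef card_Diff_subset)
    ultimately show "(\<Prod>r\<in>T. [:- y r:]) * (\<Prod>r\<in>I - T. [:0, 1:]) =
        monom ((- 1) ^ card T * (\<Prod>r\<in>T. y r)) (card I - card T)"
      by (simp add: smult_monom)
  qed
  also have "\<dots> = (\<Sum>n\<in>{0..card I}. \<Sum>T\<in>{T \<in> Pow I. card T = n}.
      monom ((- 1) ^ card T * (\<Prod>r\<in>T. y r)) (card I - card T))"
    by (rule sum.group[symmetric]) (use assms in \<open>auto simp: card_mono\<close>)
  also have "\<dots> = (\<Sum>n\<in>{0..card I}. monom ((- 1) ^ n * elem_sym n I y) (card I - n))"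
    by (rule sum.cong) (simp_all add: elem_sym_def sum_distrib_left monom_sum)
  finally show ?thesis .
qed

text \<open>Substitute \<open>X\<^sup>2\<close> for \<open>X\<close> in Vieta's formula.\<close>

lemma prod_quadratic_elem_sym:
  fixes y :: "'i \<Rightarrow> 'a::comm_ring_1"
  assumes "finite I"
  shows "(\<Prod>r\<in>I. [:- y r, 0, 1:]) = (\<Sum>n\<in>{0..card I}. monom ((- 1) ^ n * elem_sym n I y) (2 * (card I - n)))"
proof -
  have X2: "monom a k \<circ>\<^sub>p [:0, 0, 1:] = monom a (2 * k)" for a :: 'a and k
  proof -
    have X: "[:0, 0, 1::'a:] = [:0, 1:] ^ 2" by (simp add: power2_eq_square)
    show ?thesis
      by (simp only: monom_altdef pcompose_smult pcompose_hom.hom_power) (simp add: pcompose_pCons X power_mult)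
  qed
  have "(\<Prod>r\<in>I. [:- y r, 0, 1:]) = (\<Prod>r\<in>I. [:- y r, 1:]) \<circ>\<^sub>p [:0, 0, 1:]"
    by (simp add: pcompose_prod pcompose_pCons)
  also have "\<dots> = (\<Sum>n\<in>{0..card I}. monom ((- 1) ^ n * elem_sym n I y) (card I - n) \<circ>\<^sub>p [:0, 0, 1:])"
    unfolding prod_linear_elem_sym[OF assms] by (rule pcompose_sum)
  finally show ?thesis unfolding X2 .
qed

lemma sum_coeff_Gpoly:
  fixes y :: "nat \<Rightarrow> 'a::comm_ring_1"
  assumes "1 \<le> j" "j < l"
  shows "(\<Sum>m\<le>2 * l. coeff (Gpoly y l j) m * f m) =
    (\<Sum>n1\<in>{0..card {j, j + 1}}. \<Sum>n2\<in>{0..card {j + 2..l}}.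
      (- 1) ^ (n1 + n2) * elem_sym n1 {j, j + 1} y * elem_sym n2 {j + 2..l} (\<lambda>r. y r ^ 2) *
      f ((card {j, j + 1} - n1) + 2 * (card {j + 2..l} - n2)))"
proof -
  let ?S = "{0..card {j, j + 1}} \<times> {0..card {j + 2..l}}"
  have "Gpoly y l j = (\<Sum>n1\<in>{0..card {j, j + 1}}. monom ((- 1) ^ n1 * elem_sym n1 {j, j + 1} y) (card {j, j + 1} - n1)) *
      (\<Sum>n2\<in>{0..card {j + 2..l}}. monom ((- 1) ^ n2 * elem_sym n2 {j + 2..l} (\<lambda>r. y r ^ 2)) (2 * (card {j + 2..l} - n2)))"
    unfolding Gpoly_def using assms
    by (simp only: if_True prod_linear_elem_sym prod_quadratic_elem_sym finite.intros finite_atLeastAtMost)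
  also have "\<dots> = (\<Sum>s\<in>?S. monom ((- 1) ^ (fst s + snd s) * elem_sym (fst s) {j, j + 1} y * elem_sym (snd s) {j + 2..l} (\<lambda>r. y r ^ 2))
      ((card {j, j + 1} - fst s) + 2 * (card {j + 2..l} - snd s)))"
    unfolding sum_product mult_monom sum.cartesian_product
    by (rule sum.cong) (auto simp: power_add mult_ac)
  finally have G: "Gpoly y l j = \<dots>" .
  have "(\<Sum>m\<le>2 * l. coeff (Gpoly y l j) m * f m) =
      (\<Sum>s\<in>?S. ((- 1) ^ (fst s + snd s) * elem_sym (fst s) {j, j + 1} y * elem_sym (snd s) {j + 2..l} (\<lambda>r. y r ^ 2)) *
      f ((card {j, j + 1} - fst s) + 2 * (card {j + 2..l} - snd s)))"
    unfolding G by (rule sum_coeff_monom) (use assms in auto)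
  then show ?thesis
    by (simp only: sum.cartesian_product case_prod_unfold)
qed

lemma Var_neq_0 [simp]: "Var i \<noteq> 0"
  unfolding Var_def by (metis lookup_single_eq lookup_zero zero_neq_one)

text \<open>The multiple sums in \<open>phi_coeff\<close> are those in the expansions of \<open>W\<close> and \<open>G\<close>.\<close>

lemma phi_coeff_eq:
  assumes j: "1 \<le> j" "j \<le> l"
  shows "phi_coeff l j i = to_fract (phi_num Const l j Var (Var 0) (Var i)) / xvar i"
proof -
  let ?h = "\<lambda>c. to_fract (Const c)"
  define KK where "KK = {(K1, K2). K1 \<subseteq> {1..<j} \<and> K2 \<subseteq> {1..<j} \<and> K1 \<inter> K2 = {}}"
  define w where "w s = (\<Prod>r\<in>fst s. xvar r) * (\<Prod>r\<in>snd s. xvar r) ^ 2 * (- zvar) ^ card (fst s)" for s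
  define k0 where "k0 s = card ({1..<j} - (fst s \<union> snd s))" for s :: "nat set \<times> nat set"
  have k0: "k0 s \<le> l" for s
  proof -
    have "k0 s \<le> card {1..<j}" unfolding k0_def by (rule card_mono) auto
    with j show ?thesis by simp
  qed
  have nz: "xvar r \<noteq> 0" for r by simp
  have "to_fract (phi_num Const l j Var (Var 0) (Var i)) = phi_num ?h l j xvar zvar (xvar i)"
    by (rule phi_num_hom[OF to_fract_ring_hom])
  also have "\<dots> = prefactor xvar zvar l j * (\<Sum>q\<le>l. coeff (Wpoly xvar zvar j) q *
      (\<Sum>m\<le>2 * l. coeff (Gpoly xvar l j) m * Cform ?h m q (xvar i) zvar))"
    by (simp add: phi_num_def Esum_def sum_distrib_left mult.assoc)
  also have "Wpoly xvar zvar j = (\<Sum>s\<in>KK. monom (w s) (k0 s))"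
    unfolding Wpoly_expand w_def k0_def KK_def ..
  also have "(\<Sum>q\<le>l. coeff (\<Sum>s\<in>KK. monom (w s) (k0 s)) q *
      (\<Sum>m\<le>2 * l. coeff (Gpoly xvar l j) m * Cform ?h m q (xvar i) zvar)) =
      (\<Sum>s\<in>KK. w s * (\<Sum>m\<le>2 * l. coeff (Gpoly xvar l j) m * Cform ?h m (k0 s) (xvar i) zvar))"
    by (rule sum_coeff_monom) (rule k0)
  finally have num: "to_fract (phi_num Const l j Var (Var 0) (Var i)) / xvar i =
      prefactor xvar zvar l j * (\<Sum>s\<in>KK. w s * (\<Sum>m\<le>2 * l. coeff (Gpoly xvar l j) m * (Cform ?h m (k0 s) (xvar i) zvar / xvar i)))"
    by (simp only: sum_divide_distrib times_divide_eq_right[symmetric])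
  show ?thesis
  proof (cases "j < l")
    case True
    have B: "Bbar ((int (card {j, j + 1}) - int n1) + 2 * (int (card {j + 2..l}) - int n2) - 1) q (xvar i) zvar =
        Cform ?h ((card {j, j + 1} - n1) + 2 * (card {j + 2..l} - n2)) q (xvar i) zvar / xvar i"
      if "n1 \<in> {0..card {j, j + 1}}" "n2 \<in> {0..card {j + 2..l}}" for n1 n2 q
    proof -
      have "(int (card {j, j + 1}) - int n1) + 2 * (int (card {j + 2..l}) - int n2) - 1 =
          int ((card {j, j + 1} - n1) + 2 * (card {j + 2..l} - n2)) - 1"
        using that by (simp add: of_nat_diff)
      then show ?thesis by (simp only: Bbar_eq[OF nz nz])
    qed
    have "phi_coeff l j i = prefactor xvar zvar l j * (\<Sum>s\<in>KK. w s *
        (\<Sum>n1\<in>{0..card {j, j + 1}}. \<Sum>n2\<in>{0..card {j + 2..l}}.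
          (- 1) ^ (n1 + n2) * elem_sym n1 {j, j + 1} xvar * elem_sym n2 {j + 2..l} (\<lambda>r. xvar r ^ 2) *
          Bbar ((int (card {j, j + 1}) - int n1) + 2 * (int (card {j + 2..l}) - int n2) - 1) (k0 s) (xvar i) zvar))"
      unfolding phi_coeff_def Let_def if_P[OF True] KK_def w_def k0_def prefactor_def case_prod_unfold ..
    also have "\<dots> = prefactor xvar zvar l j * (\<Sum>s\<in>KK. w s *
        (\<Sum>m\<le>2 * l. coeff (Gpoly xvar l j) m * (Cform ?h m (k0 s) (xvar i) zvar / xvar i)))"
      unfolding sum_coeff_Gpoly[OF j(1) True]
      by (intro arg_cong2[of _ _ _ _ "(*)"] sum.cong refl B)
    finally show ?thesis unfolding num .
  next
    case False
    with j have jl: "j = l" by simp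
    have G: "(\<Sum>m\<le>2 * l. coeff (Gpoly xvar l j) m * f m) = - xvar l * f 0" for f
    proof -
      have "Gpoly xvar l j = (\<Sum>s\<in>{0::nat}. monom (- xvar l) s)" by (simp add: Gpoly_def jl monom_0)
      then show ?thesis by (simp only:) (subst sum_coeff_monom, simp_all)
    qed
    have B: "Bbar (- 1) q (xvar i) zvar = Cform ?h 0 q (xvar i) zvar / xvar i" for q
      using Bbar_eq[OF nz nz, of 0] by simp
    have "phi_coeff l j i = (\<Sum>s\<in>KK. w s * (- xvar l) * Bbar (- 1) (k0 s) (xvar i) zvar)"
      unfolding phi_coeff_def Let_def if_not_P[OF False] KK_def w_def k0_def case_prod_unfold ..
    then show ?thesis
      unfolding num G B by (simp only: prefactor_def False if_False mult_1_left mult.assoc)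
  qed
qed

section \<open>Divisibility by linear forms\<close>

lemma poly_ring_mono: "f \<in> poly_ring l \<Longrightarrow> l \<le> l' \<Longrightarrow> f \<in> poly_ring l'"
  unfolding poly_ring_def by fastforce

lemma ex_poly_ring: "\<exists>l. f \<in> poly_ring l"
proof (induction f rule: mpoly_induct)
  case zero
  show ?case by (intro exI[of _ 0]) simp
next
  case (add_single m c f)
  then obtain l where l: "f \<in> poly_ring l" by blast
  let ?k = "Max (insert 0 (Poly_Mapping.keys m))"
  have "i \<le> ?k" if "i \<in> Poly_Mapping.keys m" for i
    by (rule Max_ge) (use that in auto)
  then have "Poly_Mapping.single m c \<in> poly_ring ?k"
    by (auto simp: poly_ring_def)
  then have "f + Poly_Mapping.single m c \<in> poly_ring (max l ?k)"
    by (intro poly_ring_add) (auto intro: poly_ring_mono[OF l] poly_ring_mono)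
  then show ?case by blast
qed

definition subst_var :: "nat \<Rightarrow> mpoly \<Rightarrow> mpoly \<Rightarrow> mpoly" where
  "subst_var s g = mp_eval Const (Var(s := g))"

lemma subst_var_hom: "comm_ring_hom (subst_var s g)"
  unfolding subst_var_def by (rule mp_eval_hom[OF Const_hom])

interpretation subst_var: comm_ring_hom "subst_var s g" for s g by (rule subst_var_hom)

lemma subst_var_Const [simp]: "subst_var s g (Const c) = Const c"
  by (simp add: subst_var_def mp_eval_Const[OF Const_hom])

lemma subst_var_Var: "subst_var s g (Var i) = (if i = s then g else Var i)"
  by (simp add: subst_var_def mp_eval_Var[OF Const_hom])

lemma subst_var_cong: "Var s - g dvd f - subst_var s g f"
proof -
  obtain l where "f \<in> poly_ring l" using ex_poly_ring by blast
  then show ?thesis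
  proof (induction f rule: poly_ring_induct)
    case (add f1 f2)
    have "f1 + f2 - subst_var s g (f1 + f2) = (f1 - subst_var s g f1) + (f2 - subst_var s g f2)"
      by (simp add: subst_var.hom_add)
    with add show ?case by (simp only: dvd_add)
  next
    case (mult f1 f2)
    have "f1 * f2 - subst_var s g (f1 * f2) = f1 * (f2 - subst_var s g f2) + (f1 - subst_var s g f1) * subst_var s g f2"
      by (simp add: subst_var.hom_mult algebra_simps)
    with mult show ?case by (simp only: dvd_add dvd_mult dvd_mult2)
  qed (simp_all add: subst_var_Var)
qed

text \<open>Divisibility by \<open>x\<^sub>s - g\<close> means vanishing after the substitution of \<open>g\<close> for \<open>x\<^sub>s\<close>. This replaces
  unique factorization: the substitution maps into an integral domain, so these linear forms are
  prime.\<close>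

lemma dvd_iff_subst_var: "Var s - g dvd f \<longleftrightarrow> subst_var s g f = 0" if "subst_var s g g = g"
proof
  assume "Var s - g dvd f"
  then obtain k where "f = (Var s - g) * k" by (elim dvdE)
  then show "subst_var s g f = 0"
    by (simp add: subst_var.hom_mult subst_var.hom_minus subst_var_Var that)
qed (use subst_var_cong[of s g f] in simp)

section \<open>The coefficients as polynomials\<close>

lemma phi_num_cong:
  assumes "1 \<le> j" "j \<le> l" and y: "\<And>r. 1 \<le> r \<Longrightarrow> r \<le> l \<Longrightarrow> y r = y' r"
  shows "phi_num h l j y z x = phi_num h l j y' z x"
proof -
  have "Wpoly y z j = Wpoly y' z j"
    unfolding Wpoly_def using assms by (intro prod.cong) auto
  moreover have "Gpoly y l j = Gpoly y' l j"
  proof (cases "j < l")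
    case True
    have "(\<Prod>r\<in>{j, j + 1}. [:- y r, 1:]) = (\<Prod>r\<in>{j, j + 1}. [:- y' r, 1:])"
      using assms True by (intro prod.cong) auto
    moreover have "(\<Prod>r\<in>{j + 2..l}. [:- (y r ^ 2), 0, 1:]) = (\<Prod>r\<in>{j + 2..l}. [:- (y' r ^ 2), 0, 1:])"
      using assms by (intro prod.cong) auto
    ultimately show ?thesis using True by (simp only: Gpoly_def if_True)
  qed (use assms in \<open>auto simp: Gpoly_def\<close>)
  moreover have "prefactor y z l j = prefactor y' z l j"
    using assms by (auto simp: prefactor_def)
  ultimately show ?thesis by (simp only: phi_num_def)
qed

lemma phi_num_uminus: "h 0 = 0 \<Longrightarrow> phi_num h l j y z (- x) = phi_num h l j y z x"
  by (simp add: phi_num_def Esum_uminus)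

lemma phi_num_difference:
  fixes h :: "real \<Rightarrow> 'a::idom"
  assumes h: "comm_ring_hom h" and z: "z \<noteq> 0" and j: "1 \<le> j" "j \<le> l"
  shows "(2 * x + z) * (x * phi_num h l j y z (x + z) - (x + z) * phi_num h l j y z x) =
    prefactor y z l j * (z * poly (Wpoly y z j) ((x + z) * (- x)) *
      (x * poly (Gpoly y l j) (x + z) + (x + z) * poly (Gpoly y l j) (- x)))"
proof -
  have "degree (Wpoly y z j) \<le> l" using degree_Wpoly[of y z j] j by linarith
  moreover have "degree (Gpoly y l j) \<le> 2 * l" using degree_Gpoly[OF j(2), of y] by linarith
  ultimately have "(2 * x + z) * (x * Esum h l (Wpoly y z j) (Gpoly y l j) (x + z) z -
      (x + z) * Esum h l (Wpoly y z j) (Gpoly y l j) x z) =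
    z * poly (Wpoly y z j) ((x + z) * (- x)) *
      (x * poly (Gpoly y l j) (x + z) + (x + z) * poly (Gpoly y l j) (- x))"
    by (rule Esum_difference[OF h z])
  moreover have "a * (x * (b * c) - w * (b * u)) = b * (a * (x * c - w * u))" for a b c u w :: 'a
    by (simp add: algebra_simps)
  ultimately show ?thesis
    unfolding phi_num_def by (simp only:)
qed

text \<open>At \<open>x = 0\<close> the difference equation reads \<open>-z\<^sup>2 N(0) = z\<^sup>2 W(0) G(0)\<close> up to the prefactor, and
  \<open>y\<^sub>i = 0\<close> makes a factor of \<open>W(0)\<close> or of \<open>G(0)\<close> vanish. This is why the pole of \<open>B\<^bsub>-1,0\<^esub>(x\<^sub>i)\<close> cancels in
  \<open>\<phi>\<^sub>j\<close>.\<close>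

lemma phi_num_zero:
  fixes h :: "real \<Rightarrow> 'a::idom"
  assumes h: "comm_ring_hom h" and z: "z \<noteq> 0" and j: "1 \<le> j" "j \<le> l"
    and i: "1 \<le> i" "i \<le> l" and yi: "y i = 0"
  shows "phi_num h l j y z 0 = 0"
proof -
  have "poly (Wpoly y z j) 0 = 0 \<or> poly (Gpoly y l j) 0 = 0"
  proof (cases "i < j")
    case True
    then have "poly (Wpoly y z j) 0 = 0"
      unfolding poly_Wpoly using i yi by (intro prod_zero bexI[of _ i]) auto
    then show ?thesis ..
  next
    case False
    have "poly (Gpoly y l j) 0 = 0"
    proof (cases "j < l")
      case True
      then show ?thesis using poly_Gpoly_root[of j l i y] False i yi by simp
    next
      case False
      with \<open>\<not> i < j\<close> i j have "i = l" by simp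
      with False yi show ?thesis by (simp add: poly_Gpoly)
    qed
    then show ?thesis ..
  qed
  then have "z * (z * phi_num h l j y z 0) = 0"
    using phi_num_difference[OF h z j, of 0 y] by auto
  with z show ?thesis by simp
qed

lemma ex_phi_poly:
  assumes j: "1 \<le> j" "j \<le> l" and i: "1 \<le> i" "i \<le> l"
  shows "\<exists>p. p \<in> poly_ring l \<and> Var i * p = phi_num Const l j Var (Var 0) (Var i)"
proof -
  have "subst_var i 0 (phi_num Const l j Var (Var 0) (Var i)) = 0"
    unfolding phi_num_hom[OF subst_var_hom]
    using i by (simp add: subst_var_Var phi_num_zero[OF Const_hom _ j i])
  then have "Var i - 0 dvd phi_num Const l j Var (Var 0) (Var i)"
    by (subst dvd_iff_subst_var) simp_all
  then obtain p where p: "Var i * p = phi_num Const l j Var (Var 0) (Var i)"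
    by (auto elim: dvdE)
  have rC: "retr l (Const c) = Const c" for c by (simp add: retr_id)
  have rV: "retr l (Var r) = Var r" if "r \<le> l" for r using that by (simp add: retr_id)
  have "retr l (Var i * p) = Var i * p"
    unfolding p phi_num_hom[OF retr_hom] rC using i j
    by (simp add: rV) (rule phi_num_cong, simp_all add: rV)
  then have "Var i * p \<in> poly_ring l" by (simp add: poly_ring_iff_retr)
  then have "p \<in> poly_ring l" by (rule poly_ring_cancel) (use i in simp_all)
  with p show ?thesis by blast
qed

definition phi_poly :: "nat \<Rightarrow> nat \<Rightarrow> nat \<Rightarrow> mpoly" where
  "phi_poly l j i = (SOME p. p \<in> poly_ring l \<and> Var i * p = phi_num Const l j Var (Var 0) (Var i))"

context
  fixes l j i :: nat
  assumes j: "1 \<le> j" "j \<le> l" and i: "1 \<le> i" "i \<le> l"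
begin

lemma phi_poly_in_poly_ring: "phi_poly l j i \<in> poly_ring l"
  and Var_mult_phi_poly: "Var i * phi_poly l j i = phi_num Const l j Var (Var 0) (Var i)"
  unfolding phi_poly_def using someI_ex[OF ex_phi_poly[OF j i]] by auto

lemma to_fract_phi_poly: "to_fract (phi_poly l j i) = phi_coeff l j i"
proof -
  have "xvar i * to_fract (phi_poly l j i) = to_fract (phi_num Const l j Var (Var 0) (Var i))"
    using Var_mult_phi_poly by (simp flip: to_fract_mult)
  then show ?thesis
    unfolding phi_coeff_eq[OF j] by (simp add: nonzero_eq_divide_eq mult.commute)
qed

lemma inv_to_fract_phi_coeff: "inv_into UNIV to_fract (phi_coeff l j i) = phi_poly l j i"
  unfolding to_fract_phi_poly[symmetric] by (rule inv_f_f) (simp add: inj_def)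

lemma hom_phi_poly:
  assumes "comm_ring_hom g"
  shows "g (Var i) * g (phi_poly l j i) =
    phi_num (\<lambda>c. g (Const c)) l j (\<lambda>r. g (Var r)) (g (Var 0)) (g (Var i))"
proof -
  interpret g: comm_ring_hom g by (rule assms)
  show ?thesis unfolding phi_num_hom[OF assms, symmetric] Var_mult_phi_poly[symmetric] by (simp add: g.hom_mult)
qed

end

text \<open>The homomorphism \<open>grade\<close> multiplies every variable by a new variable; \<open>f\<close> is homogeneous of
  degree \<open>d\<close> exactly when \<open>grade f\<close> is \<open>f\<close> times the \<open>d\<close>-th power of that variable.\<close>

definition grade :: "mpoly \<Rightarrow> mpoly poly" where
  "grade = mp_eval (\<lambda>c. [:Const c:]) (\<lambda>i. [:0, 1:] * [:Var i:])"

lemma const_poly_hom: "comm_ring_hom (\<lambda>a::'a::comm_ring_1. [:a:])"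
  by standard (simp_all add: one_pCons)

lemma const_poly_Const_hom: "comm_ring_hom (\<lambda>c. [:Const c:])"
  by standard (simp_all add: Const.hom_add Const.hom_mult one_pCons)

lemma grade_hom: "comm_ring_hom grade"
  unfolding grade_def by (rule mp_eval_hom[OF const_poly_Const_hom])

interpretation grade: comm_ring_hom grade by (rule grade_hom)

lemma grade_Const [simp]: "grade (Const c) = [:Const c:]"
  unfolding grade_def by (rule mp_eval_Const[OF const_poly_Const_hom])

lemma grade_Var: "grade (Var i) = [:0, 1:] * [:Var i:]"
  unfolding grade_def by (rule mp_eval_Var[OF const_poly_Const_hom])

text \<open>Scaling all variables by the new one is an instance of \<open>phi_num_scale\<close>.\<close>

lemma grade_phi_poly:
  assumes j: "1 \<le> j" "j \<le> l" and i: "1 \<le> i" "i \<le> l"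
  shows "grade (phi_poly l j i) = [:0, 1:] ^ (2 * l - 2) * [:phi_poly l j i:]"
proof -
  have "([:0, 1:] * [:Var i:]) * grade (phi_poly l j i) =
      phi_num (\<lambda>c. [:Const c:]) l j (\<lambda>r. [:0, 1:] * [:Var r:]) ([:0, 1:] * [:Var 0:]) ([:0, 1:] * [:Var i:])"
    using hom_phi_poly[OF j i grade_hom] by (simp only: grade_Var grade_Const)
  also have "\<dots> = [:0, 1:] ^ (2 * l - 1) * phi_num (\<lambda>c. [:Const c:]) l j (\<lambda>r. [:Var r:]) [:Var 0:] [:Var i:]"
    by (rule phi_num_scale[OF j])
  also have "phi_num (\<lambda>c. [:Const c:]) l j (\<lambda>r. [:Var r:]) [:Var 0:] [:Var i:] = [:Var i:] * [:phi_poly l j i:]"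
    unfolding phi_num_hom[OF const_poly_hom, symmetric] Var_mult_phi_poly[OF j i, symmetric] by simp
  also have "2 * l - 1 = Suc (2 * l - 2)" using j by simp
  finally have "([:0, 1:] * [:Var i:]) * grade (phi_poly l j i) =
      ([:0, 1:] * [:Var i:]) * ([:0, 1:] ^ (2 * l - 2) * [:phi_poly l j i:])"
    by (simp only: power_Suc mult_ac)
  moreover have "[:0, 1:] * [:Var i:] \<noteq> 0" by simp
  ultimately show ?thesis by (rule mult_left_cancel[THEN iffD1, rotated])
qed

section \<open>The derivations are logarithmic\<close>

definition form :: "nat \<Rightarrow> nat \<Rightarrow> real \<Rightarrow> real \<Rightarrow> mpoly" where
  "form s t e d = Var s + Const e * Var t - Const d * Var 0"

text \<open>Restriction to the hyperplane \<open>form s t e d = 0\<close>, by elimination of \<open>x\<^sub>s\<close>.\<close>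

definition form_sub :: "nat \<Rightarrow> nat \<Rightarrow> real \<Rightarrow> real \<Rightarrow> mpoly \<Rightarrow> mpoly" where
  "form_sub s t e d = subst_var s (Const d * Var 0 - Const e * Var t)"

lemma form_sub_hom: "comm_ring_hom (form_sub s t e d)"
  unfolding form_sub_def by (rule subst_var_hom)

interpretation form_sub: comm_ring_hom "form_sub s t e d" for s t e d by (rule form_sub_hom)

lemma form_dvd_iff: "s \<noteq> 0 \<Longrightarrow> s \<noteq> t \<Longrightarrow> form s t e d dvd f \<longleftrightarrow> form_sub s t e d f = 0"
proof -
  assume "s \<noteq> 0" "s \<noteq> t"
  have "form s t e d = Var s - (Const d * Var 0 - Const e * Var t)" by (simp add: form_def)
  then show ?thesis
    unfolding form_sub_def using \<open>s \<noteq> 0\<close> \<open>s \<noteq> t\<close>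
    by (simp only:) (rule dvd_iff_subst_var, simp add: subst_var.hom_minus subst_var.hom_mult subst_var_Var)
qed

definition eval_at :: "(nat \<Rightarrow> real) \<Rightarrow> mpoly \<Rightarrow> real" where
  "eval_at = mp_eval (\<lambda>c. c)"

lemma id_real_hom: "comm_ring_hom (\<lambda>c::real. c)" by standard simp_all

lemma eval_at_hom: "comm_ring_hom (eval_at v)"
  unfolding eval_at_def by (rule mp_eval_hom[OF id_real_hom])

interpretation eval_at: comm_ring_hom "eval_at v" for v by (rule eval_at_hom)

lemma eval_at_Const [simp]: "eval_at v (Const c) = c" and eval_at_Var [simp]: "eval_at v (Var i) = v i"
  by (simp_all add: eval_at_def mp_eval_Const[OF id_real_hom] mp_eval_Var[OF id_real_hom])

text \<open>On the hyperplane, let \<open>X\<^sub>s\<close> and \<open>X\<^sub>t\<close> be the restrictions of \<open>x\<^sub>s\<close> and \<open>x\<^sub>t\<close>. After multiplication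
  by \<open>X\<^sub>s X\<^sub>t\<close> the claim becomes \<open>X\<^sub>t N(X\<^sub>s) + e X\<^sub>s N(X\<^sub>t) = 0\<close> for the even polynomial \<open>N = phi_num\<close>.
  If \<open>d = 0\<close>, then \<open>X\<^sub>s = -e X\<^sub>t\<close> and evenness suffices. If \<open>d = 1\<close>, then \<open>X\<^sub>s = x + z\<close> for
  \<open>x = -e X\<^sub>t\<close>, and the left-hand side is \<open>-e\<close> times \<open>x N(x + z) - (x + z) N(x)\<close>, to which the
  difference equation applies.\<close>

lemma form_dvd_phi_poly:
  assumes j: "1 \<le> j" "j \<le> l" and st: "1 \<le> s" "s < t" "t \<le> l" and e: "e \<in> {-1, 1}" and d: "d \<in> {0, 1}"
  shows "form s t e d dvd phi_poly l j s + Const e * phi_poly l j t"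
proof -
  let ?g = "form_sub s t e d"
  define y where "y r = ?g (Var r)" for r
  let ?z = "Var 0 :: mpoly"
  have ys: "y s = Const d * Var 0 - Const e * Var t" and yt: "y t = Var t" and z: "?g ?z = ?z"
    using st by (simp_all add: y_def form_sub_def subst_var_Var)
  have gC: "?g (Const c) = Const c" for c by (simp add: form_sub_def)
  have yfun: "y = (\<lambda>r. ?g (Var r))" by (simp add: y_def fun_eq_iff)
  define N where "N = phi_num Const l j y ?z"
  have ev: "y i * ?g (phi_poly l j i) = N (y i)" if "1 \<le> i" "i \<le> l" for i
    using hom_phi_poly[OF j that form_sub_hom[of s t e d]] by (simp only: gC z N_def yfun)
  have even: "N (- x) = N x" for x by (simp add: N_def phi_num_uminus)
  have ys0: "y s \<noteq> 0"
  proof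
    assume "y s = 0"
    then have "eval_at (\<lambda>i. if i = t then 1 else 0) (y s) = 0" by simp
    then show False using e st unfolding ys by (auto simp: eval_at.hom_minus eval_at.hom_mult)
  qed
  \<comment> \<open>\<open>y s\<close> and \<open>y t\<close> are \<open>X\<^sub>s\<close> and \<open>X\<^sub>t\<close>\<close>
  have comb: "y t * N (y s) + Const e * y s * N (y t) = 0"
  proof (cases "d = 0")
    case True
    show ?thesis
    proof (cases "e = 1")
      case True
      then have "y s = - y t" using \<open>d = 0\<close> by (simp add: ys yt)
      then show ?thesis using True by (simp add: even)
    next
      case False
      then have "e = -1" using e by simp
      then have "y s = y t" using \<open>d = 0\<close> by (simp add: ys yt Const.hom_uminus)
      then show ?thesis using \<open>e = -1\<close> by (simp add: Const.hom_uminus)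
    qed
  next
    case False
    then have d1: "d = 1" using d by simp
    define x where "x = - (Const e * y t)"
    have xs: "y s = x + ?z" using d1 by (simp add: ys yt x_def)
    have ee: "Const e * Const e = 1" using e by (auto simp: Const.hom_uminus)
    have xt: "y t = - (Const e * x)" using ee by (simp add: x_def flip: mult.assoc)
    have Nt: "N (y t) = N x"
      using e by (auto simp: x_def even Const.hom_uminus)
    have zero: "prefactor y ?z l j * (?z * poly (Wpoly y ?z j) ((x + ?z) * (- x)) *
      (x * poly (Gpoly y l j) (x + ?z) + (x + ?z) * poly (Gpoly y l j) (- x))) = 0"
    proof (cases "s < j")
      case True
      have "y s ^ 2 - ?z * y s + (x + ?z) * (- x) = 0"
        unfolding xs by (simp add: power2_eq_square algebra_simps)
      then have "poly (Wpoly y ?z j) ((x + ?z) * (- x)) = 0"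
        unfolding poly_Wpoly using st True by (intro prod_zero bexI[of _ s]) auto
      then show ?thesis by simp
    next
      case False
      then have jl: "j < l" using st by simp
      have 1: "poly (Gpoly y l j) (x + ?z) = 0"
        using poly_Gpoly_root[OF jl, of s y] False st by (simp add: xs)
      \<comment> \<open>the third case is the form \<open>x\<^sub>j - x\<^bsub>j+1\<^esub> - z\<close>, where \<open>-x\<close> is not a root of \<open>G\<close>\<close>
      consider "e = 1" | "e = -1" "t \<ge> j + 2" | "e = -1" "t = j + 1" "s = j"
        using e st False by force
      then show ?thesis
      proof cases
        case 1
        then have "- x = y t" by (simp add: x_def)
        then have "poly (Gpoly y l j) (- x) = 0"
          using poly_Gpoly_root[OF jl, of t y] False st by simp
        with \<open>poly (Gpoly y l j) (x + ?z) = 0\<close> show ?thesis by simp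
      next
        case 2
        then have "- x = - y t" by (simp add: x_def Const.hom_uminus)
        then have "poly (Gpoly y l j) (- x) = 0"
          using poly_Gpoly_root_uminus[OF jl, of t y] 2 st by simp
        with \<open>poly (Gpoly y l j) (x + ?z) = 0\<close> show ?thesis by simp
      next
        case 3
        then have "prefactor y ?z l j = 0"
          using jl xs by (simp add: prefactor_def x_def Const.hom_uminus)
        then show ?thesis by simp
      qed
    qed
    have "2 * x + ?z \<noteq> 0"
    proof
      assume "2 * x + ?z = 0"
      then have "eval_at (\<lambda>i. if i = t then 1 else 0) (2 * x + ?z) = 0" by simp
      then show False using e st
        by (auto simp: x_def yt eval_at.hom_add eval_at.hom_minus eval_at.hom_uminus eval_at.hom_mult eval_at.hom_numeral)
    qed
    moreover have "(2 * x + ?z) * (x * N (x + ?z) - (x + ?z) * N x) = 0"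
      unfolding N_def using phi_num_difference[OF Const_hom Var_neq_0 j, of x 0 y] zero by simp
    ultimately have "x * N (x + ?z) - (x + ?z) * N x = 0" by simp
    then have "- Const e * (x * N (x + ?z) - (x + ?z) * N x) = 0" by simp
    then show ?thesis unfolding xs[symmetric] Nt unfolding xt by (simp add: algebra_simps)
  qed
  have "y s * y t * (?g (phi_poly l j s) + Const e * ?g (phi_poly l j t)) =
      y t * (y s * ?g (phi_poly l j s)) + Const e * y s * (y t * ?g (phi_poly l j t))"
    by (simp only: algebra_simps)
  also have "\<dots> = 0" using comb st by (simp add: ev)
  finally have "?g (phi_poly l j s) + Const e * ?g (phi_poly l j t) = 0"
    using ys0 by (simp add: yt)
  then show ?thesis
    using st by (subst form_dvd_iff) (simp_all add: form_sub.hom_add form_sub.hom_mult gC)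
qed

section \<open>Independence\<close>

lemma coeff_mult_top:
  fixes p q :: "'a::comm_ring_1 poly"
  assumes "degree p \<le> a" "degree q \<le> b"
  shows "coeff (p * q) (a + b) = coeff p a * coeff q b"
proof -
  have "coeff p i * coeff q (a + b - i) = (if i = a then coeff p a * coeff q b else 0)" if "i \<le> a + b" for i
    using assms that by (cases i a rule: linorder_cases) (auto simp: coeff_eq_0)
  then show ?thesis unfolding coeff_mult by (simp add: sum.delta)
qed

text \<open>Compare the coefficients of \<open>x\<^bsup>m+2q+1\<^esup>\<close> in the difference equation: the leading coefficient of
  \<open>cpoly m q\<close> is all that remains of it at \<open>z = 0\<close>.\<close>

lemma lead_coeff_cpoly:
  "coeff (cpoly m q) (m + 2 * q) * (real (m + 2 * q) - 1) = (if even m then (- 1) ^ q else 0)"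
proof -
  define k where "k = m + 2 * q"
  define c where "c = cpoly m q"
  have c0: "coeff c i = 0" if "i > k" for i
    using degree_cpoly[of m q] that by (intro coeff_eq_0) (simp add: c_def k_def)
  have shift: "coeff (c \<circ>\<^sub>p [:1, 1:]) i = (\<Sum>r\<le>k. coeff c r * coeff ([:1, 1:] ^ r) i)" for i
  proof -
    have "c = (\<Sum>r\<le>k. monom (coeff c r) r)"
      by (rule poly_as_sum_of_monoms'[symmetric]) (use degree_cpoly[of m q] in \<open>simp add: c_def k_def\<close>)
    then have "c \<circ>\<^sub>p [:1, 1:] = (\<Sum>r\<le>k. monom (coeff c r) r \<circ>\<^sub>p [:1, 1:])"
      by (metis pcompose_sum)
    moreover have "monom a r \<circ>\<^sub>p [:1, 1:] = Polynomial.smult a ([:1, 1:] ^ r)" for a :: real and r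
      by (simp only: monom_altdef pcompose_smult pcompose_hom.hom_power) (simp add: pcompose_pCons)
    ultimately show ?thesis by (simp add: coeff_sum)
  qed
  have hi: "coeff ([:1, 1::real:] ^ r) i = 0" if "r < i" for r i
    using degree_power_le[of "[:1, 1::real:]" r] that by (intro coeff_eq_0) simp
  have top: "coeff (c \<circ>\<^sub>p [:1, 1:]) k = coeff c k"
  proof -
    have "(\<Sum>r\<le>k. coeff c r * coeff ([:1, 1::real:] ^ r) k) = (\<Sum>r\<in>{k}. coeff c r * coeff ([:1, 1:] ^ r) k)"
      by (rule sum.mono_neutral_right) (auto simp: hi)
    then show ?thesis by (simp add: shift coeff_linear_power)
  qed
  have subtop: "coeff (c \<circ>\<^sub>p [:1, 1:]) (k - 1) = real k * coeff c k + coeff c (k - 1)" if "k > 0"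
  proof -
    have "(\<Sum>r\<le>k. coeff c r * coeff ([:1, 1::real:] ^ r) (k - 1)) = (\<Sum>r\<in>{k - 1, k}. coeff c r * coeff ([:1, 1:] ^ r) (k - 1))"
      by (rule sum.mono_neutral_right) (auto simp: hi)
    also have "\<dots> = coeff c (k - 1) + coeff c k * real k"
      using that binomial_symmetric[of 1 k] by (simp add: coeff_linear_power coeff_linear_poly_power)
    finally show ?thesis by (simp add: shift mult.commute)
  qed
  define T where "T = [:0, 1:] * (c \<circ>\<^sub>p [:1, 1:]) - [:1, 1:] * c"
  have "coeff T (Suc k) = 0" using top c0[of "Suc k"] by (simp add: T_def)
  moreover have "coeff T k = (real k - 1) * coeff c k"
    using subtop by (cases k) (simp_all add: T_def algebra_simps)
  ultimately have e1: "coeff ([:1, 2:] * T) (Suc k) = 2 * ((real k - 1) * coeff c k)"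
    by simp
  have e2: "[:1, 2:] * T = ([:1, 1:] * [:0, -1:]) ^ q * ([:0, 1:] * [:1, 1:] ^ m + [:1, 1:] * [:0, -1:] ^ m)"
    unfolding T_def c_def by (rule difference_cpoly)
  have e3: "coeff (([:1, 1:] * [:0, -1:]) ^ q * ([:0, 1:] * [:1, 1:] ^ m + [:1, 1:] * [:0, -1:] ^ m)) (Suc k) =
      (-1) ^ q * (1 + (-1 :: real) ^ m)"
  proof -
    have pw: "degree ([:a, b:] ^ i) \<le> i" for a b :: real and i
      using degree_power_le[of "[:a, b:]" i] by (rule order.trans) simp
    have lin: "degree [:a, b:] \<le> 1" for a b :: real by simp
    have "degree (([:1, 1:] * [:0, -1::real:]) ^ q) \<le> q + q"
      unfolding power_mult_distrib by (rule order.trans[OF degree_mult_le add_mono[OF pw pw]])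
    moreover have "degree ([:0, 1:] * [:1, 1:] ^ m + [:1, 1:] * [:0, -1::real:] ^ m) \<le> 1 + m"
      by (rule degree_add_le; rule order.trans[OF degree_mult_le add_mono[OF lin pw]])
    ultimately have "coeff (([:1, 1:] * [:0, -1:]) ^ q * ([:0, 1:] * [:1, 1:] ^ m + [:1, 1:] * [:0, -1:] ^ m)) (q + q + (1 + m)) =
        coeff (([:1, 1:] * [:0, -1::real:]) ^ q) (q + q) * coeff ([:0, 1:] * [:1, 1:] ^ m + [:1, 1:] * [:0, -1::real:] ^ m) (1 + m)"
      by (rule coeff_mult_top)
    moreover have "coeff (([:1, 1:] * [:0, -1::real:]) ^ q) (q + q) = (-1) ^ q"
      unfolding power_mult_distrib coeff_mult_top[OF pw pw] by (simp add: coeff_linear_power)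
    moreover have "coeff ([:0, 1:] * [:1, 1:] ^ m + [:1, 1:] * [:0, -1::real:] ^ m) (1 + m) = 1 + (-1) ^ m"
      unfolding coeff_add coeff_mult_top[OF lin pw] by (simp add: coeff_linear_power)
    moreover have "Suc k = q + q + (1 + m)" by (simp add: k_def)
    ultimately show ?thesis by simp
  qed
  have "2 * ((real k - 1) * coeff c k) = (-1) ^ q * (1 + (-1) ^ m)"
    using e1 unfolding e2 e3 by (rule sym)
  then show ?thesis
    unfolding k_def[symmetric] c_def[symmetric] by (auto simp: mult.commute)
qed

text \<open>The polynomial \<open>phi_num\<close> in \<open>x\<close> at the point \<open>z = 0\<close>, \<open>x\<^sub>i = i\<close>.\<close>

definition level0 :: "nat \<Rightarrow> nat \<Rightarrow> real poly" where
  "level0 l j = Polynomial.smult (prefactor real 0 l j) (\<Sum>q\<le>l. \<Sum>m\<le>2 * l.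
     monom (coeff (Wpoly real 0 j) q * coeff (Gpoly real l j) m * coeff (cpoly m q) (m + 2 * q)) (m + 2 * q))"

lemma poly_level0: "poly (level0 l j) u = phi_num (\<lambda>c. c) l j real 0 u"
proof -
  have "Cform (\<lambda>c. c) m q u 0 = coeff (cpoly m q) (m + 2 * q) * u ^ (m + 2 * q)" for m q
  proof -
    have "Cform (\<lambda>c. c) m q u 0 = (\<Sum>i\<in>{m + 2 * q}. coeff (cpoly m q) i * u ^ i * 0 ^ (m + 2 * q - i))"
      unfolding Cform_def by (rule sum.mono_neutral_right) auto
    then show ?thesis by simp
  qed
  then show ?thesis
    by (simp add: level0_def phi_num_def Esum_def poly_sum poly_monom mult.assoc)
qed

lemma degree_level0:
  assumes "1 \<le> j" "j \<le> l"
  shows "degree (level0 l j) \<le> 2 * l - 2"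
  unfolding level0_def
proof (intro order.trans[OF degree_smult_le] degree_sum_le finite_atMost)
  fix q m
  let ?c = "coeff (Wpoly real 0 j) q * coeff (Gpoly real l j) m * coeff (cpoly m q) (m + 2 * q)"
  show "degree (monom ?c (m + 2 * q)) \<le> 2 * l - 2"
  proof (cases "?c = 0")
    case False
    then have "q \<le> degree (Wpoly real 0 j)" "m \<le> degree (Gpoly real l j)"
      by (auto intro: le_degree)
    with degree_Wpoly[of real 0 j] degree_Gpoly[OF assms(2), of real]
    have "m + 2 * q \<le> 2 * l - 2" using assms by linarith
    then show ?thesis by (rule order.trans[OF degree_monom_le])
  next
    case True
    show ?thesis unfolding True by simp
  qed
qed

text \<open>On \<open>N(x) = x F(x)\<close> this is \<open>x\<^sup>2 F'(x)\<close>, and \<open>F'\<close> is the limit of \<open>(F(x + z) - F(x)) / z\<close> as \<open>z\<close>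
  tends to zero. The next lemma is thus the difference equation at \<open>z = 0\<close>.\<close>

definition euler_minus_id :: "real poly \<Rightarrow> real poly" where
  "euler_minus_id P = [:0, 1:] * pderiv P - P"

lemma poly_euler_minus_id_level0:
  assumes "1 \<le> j" "j \<le> l"
  shows "2 * poly (euler_minus_id (level0 l j)) u =
    prefactor real 0 l j * (poly (Wpoly real 0 j) (- (u ^ 2)) * (poly (Gpoly real l j) u + poly (Gpoly real l j) (- u)))"
proof -
  let ?W = "Wpoly real 0 j" and ?G = "Gpoly real l j"
  have W: "degree ?W \<le> l" using degree_Wpoly[of real 0 j] assms by linarith
  have G: "degree ?G \<le> 2 * l" using degree_Gpoly[OF assms(2), of real] by linarith
  have add: "euler_minus_id (\<Sum>i\<in>A. P i) = (\<Sum>i\<in>A. euler_minus_id (P i))" for A and P :: "nat \<Rightarrow> real poly"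
    by (simp add: euler_minus_id_def pderiv_sum sum_distrib_left sum_subtractf)
  have smult: "euler_minus_id (Polynomial.smult a P) = Polynomial.smult a (euler_minus_id P)" for a P
    by (simp add: euler_minus_id_def pderiv_smult smult_diff_right)
  have mon: "poly (euler_minus_id (monom a k)) u = (real k - 1) * a * u ^ k" for a k
    by (cases k) (simp_all add: euler_minus_id_def pderiv_monom poly_monom algebra_simps)
  have summand: "2 * ((real (m + 2 * q) - 1) * (coeff ?W q * coeff ?G m * coeff (cpoly m q) (m + 2 * q)) * u ^ (m + 2 * q)) =
      (coeff ?W q * (- (u ^ 2)) ^ q) * (coeff ?G m * u ^ m + coeff ?G m * (- u) ^ m)" for m q
  proof -
    have "2 * ((real (m + 2 * q) - 1) * (coeff ?W q * coeff ?G m * coeff (cpoly m q) (m + 2 * q)) * u ^ (m + 2 * q)) =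
        2 * (coeff (cpoly m q) (m + 2 * q) * (real (m + 2 * q) - 1)) * (coeff ?W q * coeff ?G m * u ^ (m + 2 * q))"
      by (simp only: mult_ac)
    also have "\<dots> = 2 * (if even m then (- 1) ^ q else 0) * (coeff ?W q * coeff ?G m * u ^ (m + 2 * q))"
      unfolding lead_coeff_cpoly ..
    also have "\<dots> = (coeff ?W q * (- (u ^ 2)) ^ q) * (coeff ?G m * u ^ m + coeff ?G m * (- u) ^ m)"
      by (cases "even m"; cases "even q") (simp_all add: power_add power_mult)
    finally show ?thesis .
  qed
  have "2 * poly (euler_minus_id (level0 l j)) u = prefactor real 0 l j * (\<Sum>q\<le>l. \<Sum>m\<le>2 * l.
      2 * ((real (m + 2 * q) - 1) * (coeff ?W q * coeff ?G m * coeff (cpoly m q) (m + 2 * q)) * u ^ (m + 2 * q)))"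
    unfolding level0_def smult add poly_smult poly_sum mon
    by (simp only: sum_distrib_left mult.left_commute)
  also have "\<dots> = prefactor real 0 l j * (\<Sum>q\<le>l. \<Sum>m\<le>2 * l.
      (coeff ?W q * (- (u ^ 2)) ^ q) * (coeff ?G m * u ^ m + coeff ?G m * (- u) ^ m))"
    by (simp only: summand)
  also have "\<dots> = prefactor real 0 l j * (poly ?W (- (u ^ 2)) * (poly ?G u + poly ?G (- u)))"
    unfolding sum_product[symmetric] poly_sum_bound[OF W] poly_sum_bound[OF G] sum.distrib ..
  finally show ?thesis .
qed

text \<open>A relation between the values at \<open>1, \<dots>, l\<close> is a relation between the polynomials, because
  these are even and have degree less than \<open>2 l\<close>. After \<open>x d/dx - 1\<close> the \<open>j\<close>-th polynomial vanishes
  at \<open>1, \<dots>, j - 1\<close> but not at \<open>j\<close>, so the coefficients vanish one after the other.\<close>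

lemma level0_independent:
  assumes zero: "\<And>i. 1 \<le> i \<Longrightarrow> i \<le> l \<Longrightarrow> (\<Sum>j\<in>{1..l}. a j * poly (level0 l j) (real i)) = 0"
    and k: "1 \<le> k" "k \<le> l"
  shows "a k = 0"
proof -
  define H where "H = (\<Sum>j\<in>{1..l}. Polynomial.smult (a j) (level0 l j))"
  have pH: "poly H u = (\<Sum>j\<in>{1..l}. a j * poly (level0 l j) u)" for u
    by (simp add: H_def poly_sum)
  have "H = 0"
  proof (rule ccontr)
    assume "H \<noteq> 0"
    have evenH: "poly H (- u) = poly H u" for u
      by (simp add: pH poly_level0 phi_num_uminus)
    let ?R = "real ` {1..l} \<union> (\<lambda>i. - real i) ` {1..l}"
    have "?R \<subseteq> {u. poly H u = 0}"
      using zero by (auto simp: evenH) (auto simp: pH)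
    then have "card ?R \<le> card {u. poly H u = 0}"
      using poly_roots_finite[OF \<open>H \<noteq> 0\<close>] by (rule card_mono[rotated])
    also have "\<dots> \<le> degree H" by (rule card_poly_roots_bound[OF \<open>H \<noteq> 0\<close>])
    also have "degree H \<le> 2 * l - 2"
      unfolding H_def by (intro degree_sum_le) (auto intro!: order.trans[OF degree_smult_le] degree_level0)
    finally have "card ?R \<le> 2 * l - 2" .
    moreover have "card ?R = l + l"
    proof -
      have "real ` {1..l} \<inter> (\<lambda>i. - real i) ` {1..l} = {}" by auto
      then have "card ?R = card (real ` {1..l}) + card ((\<lambda>i. - real i) ` {1..l})"
        by (intro card_Un_disjoint) auto
      also have "card (real ` {1..l}) = l" by (subst card_image) (auto simp: inj_on_def)
      also have "card ((\<lambda>i. - real i) ` {1..l}) = l" by (subst card_image) (auto simp: inj_on_def)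
      finally show ?thesis .
    qed
    ultimately show False using k by simp
  qed
  define F where "F j u = prefactor real 0 l j * (poly (Wpoly real 0 j) (- (u ^ 2)) *
    (poly (Gpoly real l j) u + poly (Gpoly real l j) (- u)))" for j u
  have F0: "(\<Sum>j\<in>{1..l}. a j * F j u) = 0" for u
  proof -
    have "euler_minus_id H = (\<Sum>j\<in>{1..l}. Polynomial.smult (a j) (euler_minus_id (level0 l j)))"
      by (simp add: H_def euler_minus_id_def pderiv_sum pderiv_smult sum_distrib_left sum_subtractf smult_diff_right)
    moreover have "euler_minus_id H = 0" by (simp add: \<open>H = 0\<close> euler_minus_id_def)
    ultimately have "(\<Sum>j\<in>{1..l}. a j * poly (euler_minus_id (level0 l j)) u) = 0"
      by (metis (no_types, lifting) poly_0 poly_smult poly_sum sum.cong)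
    then have "(\<Sum>j\<in>{1..l}. a j * (2 * poly (euler_minus_id (level0 l j)) u)) = 0"
      by (simp only: mult.left_commute[of _ 2] sum_distrib_left[symmetric] mult_zero_right)
    then show ?thesis by (simp add: poly_euler_minus_id_level0 F_def)
  qed
  have Fvan: "F j (real i) = 0" if "1 \<le> i" "i < j" for i j
  proof -
    have "(\<Prod>r\<in>{1..<j}. real r ^ 2 - 0 * real r + - (real i ^ 2)) = 0"
      using that by (intro prod_zero bexI[of _ i]) auto
    then show ?thesis unfolding F_def poly_Wpoly by simp
  qed
  have Fdiag: "F i (real i) \<noteq> 0" if "1 \<le> i" "i \<le> l" for i
  proof -
    have "(\<Prod>r\<in>{1..<i}. real r ^ 2 - 0 * real r + - (real i ^ 2)) \<noteq> 0"
      by (simp add: prod_zero_iff power2_eq_iff)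
    moreover have "prefactor real 0 l i \<noteq> 0" by (simp add: prefactor_def)
    moreover have "poly (Gpoly real l i) (real i) + poly (Gpoly real l i) (- real i) \<noteq> 0"
    proof (cases "i < l")
      case True
      have "(\<Prod>r\<in>{i + 2..l}. (- real i) ^ 2 - real r ^ 2) \<noteq> 0"
        by (simp add: prod_zero_iff power2_eq_iff)
      moreover have "- real i - real (i + 1) \<noteq> 0" "- real i - real i \<noteq> 0" using that by auto
      ultimately show ?thesis unfolding poly_Gpoly if_P[OF True] by simp
    next
      case False
      then show ?thesis using that by (simp add: poly_Gpoly)
    qed
    ultimately show ?thesis unfolding F_def poly_Wpoly by simp
  qed
  show ?thesis using k
  proof (induction k rule: less_induct)
    case (less k)
    have "(\<Sum>j\<in>{1..l}. a j * F j (real k)) = (\<Sum>j\<in>{k}. a j * F j (real k))"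
    proof (rule sum.mono_neutral_right)
      show "\<forall>j\<in>{1..l} - {k}. a j * F j (real k) = 0"
      proof
        fix j assume j: "j \<in> {1..l} - {k}"
        then consider "j < k" | "k < j" by force
        then show "a j * F j (real k) = 0"
          by cases (use less j in \<open>auto simp: Fvan\<close>)
      qed
    qed (use less in auto)
    with F0[of "real k"] Fdiag[of k] less.prems show ?case by simp
  qed
qed

section \<open>The determinant\<close>

text \<open>The hyperplanes \<open>x\<^sub>s + e x\<^sub>t - d z = 0\<close> are represented by tuples \<open>(s, t, e, d)\<close>; \<open>z = 0\<close> is
  treated separately.\<close>

definition forms :: "nat \<Rightarrow> (nat \<times> nat \<times> real \<times> real) set" where
  "forms l = (SIGMA s:{1..l}. {s<..l} \<times> {-1, 1} \<times> {0, 1})"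

abbreviation form_of :: "nat \<times> nat \<times> real \<times> real \<Rightarrow> mpoly" where
  "form_of H \<equiv> (case H of (s, t, e, d) \<Rightarrow> form s t e d)"

lemma mem_forms: "(s, t, e, d) \<in> forms l \<longleftrightarrow> 1 \<le> s \<and> s < t \<and> t \<le> l \<and> e \<in> {-1, 1} \<and> d \<in> {0, 1}"
  by (auto simp: forms_def)

lemma finite_forms: "finite (forms l)"
  by (auto simp: forms_def)

lemma card_forms: "card (forms l) = l * (2 * l - 2)"
proof -
  have "card ({s<..l} \<times> {-1, 1::real} \<times> {0, 1::real}) = (l - s) * 4" for s
    by (simp add: card_cartesian_product)
  moreover have "card (forms l) = (\<Sum>s\<in>{1..l}. card ({s<..l} \<times> {-1, 1::real} \<times> {0, 1::real}))"
    unfolding forms_def by (rule card_SigmaI) auto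
  ultimately have "card (forms l) = (\<Sum>s\<in>{1..l}. (l - s) * 4)"
    by (simp only:)
  also have "\<dots> = l * (2 * l - 2)"
  proof (induction l)
    case (Suc l)
    have "(\<Sum>s\<in>{1..Suc l}. (Suc l - s) * 4) = (\<Sum>s\<in>{1..l}. (l - s) * 4 + 4)"
      by (simp add: Suc_diff_le add.commute)
    also have "\<dots> = l * (2 * l - 2) + l * 4"
      unfolding sum.distrib Suc.IH by simp
    also have "\<dots> = Suc l * (2 * Suc l - 2)"
      by (cases l) (simp_all add: algebra_simps)
    finally show ?case .
  qed simp
  finally show ?thesis .
qed

text \<open>Distinct forms are not associated. If \<open>form s' t' e' d'\<close> vanished on the hyperplane of
  \<open>form s t e d\<close>, it would vanish at the points \<open>u\<^sub>r\<close> of that hyperplane whose only nonzero free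
  coordinate is the \<open>r\<close>-th, and these determine the four parameters one by one.\<close>

lemma form_sub_form_neq_0:
  assumes H: "(s, t, e, d) \<in> forms l" and H': "(s', t', e', d') \<in> forms l"
    and ne: "(s, t, e, d) \<noteq> (s', t', e', d')"
  shows "form_sub s t e d (form s' t' e' d') \<noteq> 0"
proof
  assume zero: "form_sub s t e d (form s' t' e' d') = 0"
  define w where "w v r = (if r = s then d * v 0 - e * v t else v r)" for v :: "nat \<Rightarrow> real" and r
  have st: "1 \<le> s" "s < t" "e \<noteq> 0" and st': "1 \<le> s'" "s' < t'" "e' \<noteq> 0"
    using H H' by (auto simp: mem_forms)
  have sub: "eval_at v (form_sub s t e d (Var r)) = w v r" for v r
    by (simp add: form_sub_def subst_var_Var w_def eval_at.hom_minus eval_at.hom_mult)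
  have subC: "eval_at v (form_sub s t e d (Const c)) = c" for v c
    by (simp add: form_sub_def)
  have lin: "w v s' + e' * w v t' - d' * w v 0 = 0" for v
    using arg_cong[OF zero, of "eval_at v"]
    by (simp add: form_def form_sub.hom_add form_sub.hom_minus form_sub.hom_mult
        eval_at.hom_add eval_at.hom_minus eval_at.hom_mult sub subC)
  define u where "u r i = (if i = r then 1 else 0 :: real)" for r i :: nat
  have "s' \<in> {s, t}"
    using lin[of "u s'"] st st' by (auto simp: w_def u_def split: if_splits)
  moreover have "t' \<in> {s, t}"
    using lin[of "u t'"] st st' by (auto simp: w_def u_def split: if_splits)
  ultimately have "s' = s" "t' = t" using st st' by auto
  moreover from this have "e' = e"
    using lin[of "u t"] st by (auto simp: w_def u_def)
  moreover from calculation have "d' = d"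
    using lin[of "u 0"] st by (auto simp: w_def u_def)
  ultimately show False using ne by simp
qed

lemma prod_forms_dvd:
  assumes "\<And>H. H \<in> forms l \<Longrightarrow> form_of H dvd f"
  shows "(\<Prod>H\<in>forms l. form_of H) dvd f"
proof -
  have "(\<Prod>H\<in>F. form_of H) dvd f" if "finite F" "F \<subseteq> forms l" for F
    using that
  proof (induction F)
    case (insert H F)
    obtain s t e d where Heq: "H = (s, t, e, d)" by (cases H)
    then have H: "(s, t, e, d) \<in> forms l" using insert.prems by simp
    obtain g where f: "f = (\<Prod>H\<in>F. form_of H) * g"
      using insert by (auto elim: dvdE)
    have st: "s \<noteq> 0" "s \<noteq> t" using H by (auto simp: mem_forms)
    have "form_sub s t e d f = 0"
      using assms[OF H] by (simp add: form_dvd_iff[OF st])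
    then have "(\<Prod>H\<in>F. form_sub s t e d (form_of H)) * form_sub s t e d g = 0"
      unfolding f by (simp add: form_sub.hom_mult form_sub.hom_prod)
    moreover have "(\<Prod>H\<in>F. form_sub s t e d (form_of H)) \<noteq> 0"
    proof -
      have "form_sub s t e d (form_of H') \<noteq> 0" if "H' \<in> F" for H'
      proof -
        obtain s' t' e' d' where H': "H' = (s', t', e', d')" by (cases H')
        then have "(s', t', e', d') \<in> forms l" "(s, t, e, d) \<noteq> (s', t', e', d')"
          using insert.hyps insert.prems Heq that by auto
        then show ?thesis using form_sub_form_neq_0[OF H] unfolding H' by simp
      qed
      then show ?thesis using insert.hyps by (simp add: prod_zero_iff)
    qed
    ultimately have "form s t e d dvd g" by (simp add: form_dvd_iff[OF st])
    then show ?case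
      using insert.hyps unfolding f Heq by (simp add: mult.commute mult_dvd_mono)
  qed simp
  with finite_forms show ?thesis by blast
qed

lemma form_neq_0: "(s, t, e, d) \<in> forms l \<Longrightarrow> form s t e d \<noteq> 0"
proof
  assume H: "(s, t, e, d) \<in> forms l" "form s t e d = 0"
  then have "eval_at (\<lambda>i. if i = s then 1 else 0) (form s t e d) = 0" by simp
  with H(1) show False
    by (auto simp: mem_forms form_def eval_at.hom_add eval_at.hom_minus eval_at.hom_mult)
qed

text \<open>Adding \<open>e\<close> times row \<open>t\<close> to row \<open>s\<close> makes row \<open>s\<close> divisible by the form. Rows are numbered from
  zero, so the row of \<open>x\<^sub>s\<close> has index \<open>s - 1\<close>.\<close>

lemma form_dvd_det:
  assumes B: "B \<in> carrier_mat l l" and H: "(s, t, e, d) \<in> forms l"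
    and dvd: "\<And>j. j < l \<Longrightarrow> form s t e d dvd B $$ (s - 1, j) + Const e * B $$ (t - 1, j)"
  shows "form s t e d dvd det B"
proof -
  define C where "C = addrow (Const e) (s - 1) (t - 1) B"
  have st: "s - 1 < l" "t - 1 < l" "s - 1 \<noteq> t - 1" using H by (auto simp: mem_forms)
  have C: "C \<in> carrier_mat l l" using B by (simp add: C_def)
  have "det B = det C" unfolding C_def using st B by (simp add: det_addrow)
  also have "\<dots> = (\<Sum>j<l. C $$ (s - 1, j) * cofactor C (s - 1) j)"
    by (rule laplace_expansion_row[OF C st(1)])
  also have "form s t e d dvd \<dots>"
  proof (rule dvd_sum)
    fix j assume "j \<in> {..<l}"
    then have "C $$ (s - 1, j) = B $$ (s - 1, j) + Const e * B $$ (t - 1, j)"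
      using B st by (simp add: C_def add.commute)
    with dvd \<open>j \<in> {..<l}\<close> show "form s t e d dvd C $$ (s - 1, j) * cofactor C (s - 1) j"
      by simp
  qed
  finally show ?thesis .
qed

definition coeff_mat :: "nat \<Rightarrow> mpoly mat" where
  "coeff_mat l = mat l l (\<lambda>(i, j). phi_poly l (Suc j) (Suc i))"

lemma coeff_mat_carrier [simp]: "coeff_mat l \<in> carrier_mat l l"
  and coeff_mat_dims [simp]: "dim_row (coeff_mat l) = l" "dim_col (coeff_mat l) = l"
  by (simp_all add: coeff_mat_def)

lemma form_dvd_coeff_mat:
  assumes "(s, t, e, d) \<in> forms l" "j < l"
  shows "form s t e d dvd coeff_mat l $$ (s - 1, j) + Const e * coeff_mat l $$ (t - 1, j)"
  using assms form_dvd_phi_poly[of "Suc j" l s t e d] by (auto simp: mem_forms coeff_mat_def)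

lemma det_coeff_mat_neq_0: "det (coeff_mat l) \<noteq> 0"
proof
  assume "det (coeff_mat l) = 0"
  then have "det (map_mat (eval_at real) (coeff_mat l)) = 0"
    by (simp add: eval_at.hom_det)
  then obtain v where v: "v \<in> carrier_vec l" "v \<noteq> 0\<^sub>v l" "map_mat (eval_at real) (coeff_mat l) *\<^sub>v v = 0\<^sub>v l"
    by (subst (asm) det_0_iff_vec_prod_zero[of _ l]) auto
  define a where "a j = v $ (j - 1)" for j
  have "a k = 0" if "1 \<le> k" "k \<le> l" for k
  proof (rule level0_independent[OF _ that])
    fix i assume i: "1 \<le> i" "i \<le> l"
    have ev: "poly (level0 l j) (real i) = real i * eval_at real (phi_poly l j i)" if "1 \<le> j" "j \<le> l" for j
      using hom_phi_poly[OF that i eval_at_hom[of real]] by (simp add: poly_level0)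
    have "(\<Sum>j\<in>{1..l}. a j * poly (level0 l j) (real i)) = real i * (\<Sum>j\<in>{1..l}. eval_at real (phi_poly l j i) * a j)"
      by (simp add: ev sum_distrib_left mult_ac)
    also have "(\<Sum>j\<in>{1..l}. eval_at real (phi_poly l j i) * a j) = (map_mat (eval_at real) (coeff_mat l) *\<^sub>v v) $ (i - 1)"
      using i v(1) by (simp add: coeff_mat_def scalar_prod_def a_def sum.atLeast1_atMost_eq atLeast0LessThan)
    also have "\<dots> = 0" using i by (simp add: v(3))
    finally show "(\<Sum>j\<in>{1..l}. a j * poly (level0 l j) (real i)) = 0" by simp
  qed
  then have "v $ k = 0" if "k < l" for k
    using that by (metis One_nat_def Suc_leI a_def diff_Suc_1 le_add1 plus_1_eq_Suc)
  then have "v = 0\<^sub>v l" using v(1) by (intro eq_vecI) auto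
  with v(2) show False ..
qed

lemma grade_form: "grade (form s t e d) = [:0, 1:] * [:form s t e d:]"
  by (simp add: form_def grade.hom_add grade.hom_minus grade.hom_mult grade_Var)

lemma poly_grade_0: "\<exists>c. poly (grade f) 0 = Const c"
proof -
  obtain l where "f \<in> poly_ring l" using ex_poly_ring by blast
  then show ?thesis
  proof (induction f rule: poly_ring_induct)
    case (Const c)
    then show ?case by auto
  next
    case (Var i)
    then show ?case by (intro exI[of _ 0]) (simp add: grade_Var)
  next
    case (add f g)
    then show ?case by (metis Const.hom_add grade.hom_add poly_add)
  next
    case (mult f g)
    then show ?case by (metis Const.hom_mult grade.hom_mult poly_mult)
  qed
qed

text \<open>The quotient of the determinant by the product of the forms is homogeneous of degree zero.\<close>

lemma det_coeff_mat:
  "\<exists>c. c \<noteq> 0 \<and> det (coeff_mat l) = Const c * (\<Prod>H\<in>forms l. form_of H)"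
proof -
  let ?Q = "\<Prod>H\<in>forms l. form_of H" and ?A = "coeff_mat l"
  let ?X = "[:0, 1::mpoly:]"
  let ?n = "l * (2 * l - 2)"
  have "?Q dvd det ?A"
    by (rule prod_forms_dvd) (auto intro!: form_dvd_det form_dvd_coeff_mat)
  then obtain k where k: "det ?A = ?Q * k" by (elim dvdE)
  have gQ: "grade ?Q = ?X ^ ?n * [:?Q:]"
  proof -
    have "grade ?Q = (\<Prod>H\<in>forms l. grade (form_of H))" by (rule grade.hom_prod)
    also have "\<dots> = (\<Prod>H\<in>forms l. ?X * [:form_of H:])"
      by (rule prod.cong) (auto simp: grade_form)
    also have "\<dots> = ?X ^ ?n * [:?Q:]"
      by (simp only: prod.distrib prod_constant card_forms prod_const_poly)
    finally show ?thesis .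
  qed
  have gA: "grade (det ?A) = ?X ^ ?n * [:det ?A:]"
  proof -
    interpret cp: comm_ring_hom "\<lambda>a::mpoly. [:a:]" by (rule const_poly_hom)
    have "map_mat grade ?A = ?X ^ (2 * l - 2) \<cdot>\<^sub>m map_mat (\<lambda>a. [:a:]) ?A"
      by (rule eq_matI) (simp_all add: coeff_mat_def grade_phi_poly)
    then have "grade (det ?A) = det (?X ^ (2 * l - 2) \<cdot>\<^sub>m map_mat (\<lambda>a. [:a:]) ?A)"
      by (simp flip: grade.hom_det)
    also have "\<dots> = (?X ^ (2 * l - 2)) ^ l * [:det ?A:]"
      unfolding det_smult cp.hom_det by (simp add: coeff_mat_def)
    also have "(?X ^ (2 * l - 2)) ^ l = ?X ^ ?n" by (simp only: power_mult[symmetric] mult.commute)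
    finally show ?thesis .
  qed
  have Q0: "?Q \<noteq> 0" using det_coeff_mat_neq_0[of l] k by auto
  have "(?X ^ ?n * [:?Q:]) * grade k = (?X ^ ?n * [:?Q:]) * [:k:]"
    using gA unfolding k grade.hom_mult gQ by (simp add: mult_ac)
  moreover have "?X ^ ?n * [:?Q:] \<noteq> 0" using Q0 by simp
  ultimately have "grade k = [:k:]" by (rule mult_left_cancel[THEN iffD1, rotated])
  then have "k = poly (grade k) 0" by simp
  then obtain c where c: "k = Const c" using poly_grade_0[of k] by auto
  moreover have "c \<noteq> 0" using det_coeff_mat_neq_0[of l] k c by auto
  ultimately show ?thesis using k by (auto simp: mult.commute)
qed

lemma det_in_poly_ring:
  assumes "B \<in> carrier_mat l l" "\<And>i j. i < l \<Longrightarrow> j < l \<Longrightarrow> B $$ (i, j) \<in> poly_ring n"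
  shows "det B \<in> poly_ring n"
proof -
  have "map_mat (retr n) B = B"
    using assms by (intro eq_matI) (auto simp: poly_ring_iff_retr)
  then show ?thesis by (metis poly_ring_iff_retr retr.hom_det)
qed

text \<open>By Cramer's rule the solution is the quotient of the determinant with one column replaced by \<open>b\<close>
  by the determinant itself. The hypothesis on \<open>b\<close> is the one that makes every form divide the
  former, and the latter is the product of the forms up to a constant.\<close>

lemma coeff_mat_solvable:
  assumes b: "b \<in> carrier_vec l" and bS: "\<And>i. i < l \<Longrightarrow> b $ i \<in> poly_ring l"
    and dvd: "\<And>s t e d. (s, t, e, d) \<in> forms l \<Longrightarrow> form s t e d dvd b $ (s - 1) + Const e * b $ (t - 1)"
  shows "\<exists>c \<in> carrier_vec l. (\<forall>k<l. c $ k \<in> poly_ring l) \<and> coeff_mat l *\<^sub>v c = b"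
proof -
  let ?A = "coeff_mat l"
  define D where "D = det ?A"
  define B where "B k = replace_col ?A b k" for k
  define f where "f = adj_mat ?A *\<^sub>v b"
  have A: "?A \<in> carrier_mat l l" by simp
  have adj: "adj_mat ?A \<in> carrier_mat l l" by (rule adj_mat(1)[OF A])
  have f: "f \<in> carrier_vec l" unfolding f_def using adj b by simp
  have D0: "D \<noteq> 0" unfolding D_def by (rule det_coeff_mat_neq_0)
  have BC: "B k \<in> carrier_mat l l" for k
    by (simp add: B_def replace_col_def coeff_mat_def)
  have Bent: "B k $$ (i, j) = (if j = k then b $ i else ?A $$ (i, j))" if "i < l" "j < l" for i j k
    using that by (simp add: B_def replace_col_def coeff_mat_def)
  have Af: "?A *\<^sub>v f = D \<cdot>\<^sub>v b"
  proof -
    have "?A *\<^sub>v f = (?A * adj_mat ?A) *\<^sub>v b"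
      unfolding f_def by (rule assoc_mult_mat_vec[symmetric, OF A adj b])
    also have "\<dots> = (D \<cdot>\<^sub>m 1\<^sub>m l) *\<^sub>v b" unfolding adj_mat(2)[OF A] D_def ..
    also have "\<dots> = D \<cdot>\<^sub>v b" using b by (intro eq_vecI) auto
    finally show ?thesis .
  qed
  have fk: "f $ k = det (B k)" if "k < l" for k
  proof -
    have "replace_col ?A (D \<cdot>\<^sub>v b) k = multcol k D (B k)"
      using b that by (intro eq_matI) (auto simp: replace_col_def B_def coeff_mat_def)
    moreover have "det (multcol k D (B k)) = det (B k) * D"
      unfolding multcol_mat[OF BC] using that by (simp add: det_mult[OF BC] det_multrow_mat)
    ultimately have "f $ k * D = D * det (B k)"
      using cramer_lemma_mat[OF A f that] by (auto simp: Af D_def mult.commute)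
    with D0 show ?thesis by (simp add: mult.commute)
  qed
  obtain c0 where c0: "c0 \<noteq> 0" "D = Const c0 * (\<Prod>H\<in>forms l. form_of H)"
    using det_coeff_mat unfolding D_def by blast
  \<comment> \<open>exact division of Cramer's numerators\<close>
  have "\<exists>q. D * q = det (B k)" if "k < l" for k
  proof -
    have "(\<Prod>H\<in>forms l. form_of H) dvd det (B k)"
    proof (rule prod_forms_dvd)
      fix H assume H: "H \<in> forms l"
      obtain s t e d where Heq: "H = (s, t, e, d)" by (cases H)
      with H have H': "(s, t, e, d) \<in> forms l" by simp
      then have "s - 1 < l" "t - 1 < l" by (auto simp: mem_forms)
      then have "form s t e d dvd B k $$ (s - 1, j) + Const e * B k $$ (t - 1, j)" if "j < l" for j
        using that dvd[OF H'] form_dvd_coeff_mat[OF H'] by (cases "j = k") (simp_all add: Bent)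
      then show "form_of H dvd det (B k)"
        unfolding Heq by (simp add: form_dvd_det[OF BC H'])
    qed
    then obtain q where q: "det (B k) = (\<Prod>H\<in>forms l. form_of H) * q" by (elim dvdE)
    have "Const c0 * Const (1 / c0) = 1" using c0(1) by (simp flip: Const.hom_mult)
    then have "D * (Const (1 / c0) * q) = det (B k)"
      unfolding c0(2) q by (simp add: mult_ac)
    then show ?thesis ..
  qed
  then obtain q where q: "\<And>k. k < l \<Longrightarrow> D * q k = det (B k)" by metis
  define c where "c = vec l q"
  have c: "c \<in> carrier_vec l" by (simp add: c_def)
  have entA: "?A $$ (i, j) \<in> poly_ring l" if "i < l" "j < l" for i j
    using that by (simp add: coeff_mat_def phi_poly_in_poly_ring)
  have "c $ k \<in> poly_ring l" if "k < l" for k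
  proof (rule poly_ring_cancel[OF _ _ D0])
    show "D \<in> poly_ring l" unfolding D_def by (rule det_in_poly_ring[OF A entA])
    have "det (B k) \<in> poly_ring l"
      by (rule det_in_poly_ring[OF BC]) (auto simp: Bent entA bS)
    then show "D * c $ k \<in> poly_ring l" using that by (simp add: c_def q)
  qed
  moreover have "?A *\<^sub>v c = b"
  proof -
    have "D \<cdot>\<^sub>v c = f" using f by (intro eq_vecI) (auto simp: c_def q fk)
    with Af have Ac: "?A *\<^sub>v (D \<cdot>\<^sub>v c) = D \<cdot>\<^sub>v b" by simp
    have "D * (?A *\<^sub>v c) $ i = D * b $ i" if "i < l" for i
      using arg_cong[OF Ac, of "\<lambda>v. v $ i"] that b c A
      by (simp add: scalar_prod_def mult.left_commute flip: sum_distrib_left)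
    with D0 show ?thesis using b A by (intro eq_vecI) (simp_all del: index_mult_mat_vec)
  qed
  ultimately show ?thesis using c by blast
qed

lemma coeff_mat_injective:
  assumes c: "c \<in> carrier_vec l" and "coeff_mat l *\<^sub>v c = 0\<^sub>v l"
  shows "c = 0\<^sub>v l"
  using det_0_iff_vec_prod_zero[OF coeff_mat_carrier[of l]] det_coeff_mat_neq_0[of l] assms by blast

section \<open>Derivations\<close>

definition deriv_of :: "nat \<Rightarrow> (nat \<Rightarrow> mpoly) \<Rightarrow> mpoly \<Rightarrow> mpoly" where
  "deriv_of l a = (\<lambda>f\<in>poly_ring l. \<Sum>i\<in>{0..l}. a i * partial i f)"

lemma deriv_of_in_Der:
  assumes "\<And>i. i \<le> l \<Longrightarrow> a i \<in> poly_ring l"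
  shows "deriv_of l a \<in> Der l"
proof -
  have "deriv_of l a f \<in> poly_ring l" if "f \<in> poly_ring l" for f
    using that assms by (auto simp: deriv_of_def intro!: poly_ring_sum poly_ring_mult partial_in_poly_ring)
  then have "deriv_of l a \<in> poly_ring l \<rightarrow>\<^sub>E poly_ring l"
    by (auto simp: deriv_of_def)
  moreover have "deriv_of l a (f + g) = deriv_of l a f + deriv_of l a g"
    if "f \<in> poly_ring l" "g \<in> poly_ring l" for f g
    using that by (simp add: deriv_of_def poly_ring_add partial_add distrib_left sum.distrib)
  moreover have "deriv_of l a (Const c * f) = Const c * deriv_of l a f" if "f \<in> poly_ring l" for c f
    using that by (simp add: deriv_of_def poly_ring_mult partial_mult sum_distrib_left mult.left_commute)
  moreover have "deriv_of l a (f * g) = deriv_of l a f * g + f * deriv_of l a g"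
    if "f \<in> poly_ring l" "g \<in> poly_ring l" for f g
  proof -
    have "deriv_of l a (f * g) = (\<Sum>i\<in>{0..l}. a i * partial i f * g + f * (a i * partial i g))"
      using that unfolding deriv_of_def
      by (simp add: poly_ring_mult partial_mult) (simp only: algebra_simps)
    with that show ?thesis
      by (simp add: deriv_of_def sum.distrib sum_distrib_left sum_distrib_right)
  qed
  ultimately show ?thesis by (simp add: Der_def)
qed

lemma deriv_of_Var: "i \<le> l \<Longrightarrow> deriv_of l a (Var i) = a i"
  by (simp add: deriv_of_def partial_Var if_distrib[of "\<lambda>x. _ * x"] sum.delta cong: if_cong)

lemma phi_eq:
  assumes "1 \<le> j" "j \<le> l"
  shows "phi l j = deriv_of l (\<lambda>i. if i = 0 then 0 else phi_poly l j i)"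
proof -
  have "{0..l} = insert 0 {1..l}" by auto
  then show ?thesis
    unfolding phi_def deriv_of_def using assms
    by (intro restrict_ext) (simp add: inv_to_fract_phi_coeff)
qed

lemma euler_eq: "euler l = deriv_of l Var"
proof -
  have "{0..l} = insert 0 {1..l}" by auto
  then show ?thesis by (simp add: euler_def deriv_of_def)
qed

context
  fixes l \<theta>
  assumes \<theta>: "\<theta> \<in> Der l"
begin

lemma Der_in: "f \<in> poly_ring l \<Longrightarrow> \<theta> f \<in> poly_ring l"
  and Der_add: "f \<in> poly_ring l \<Longrightarrow> g \<in> poly_ring l \<Longrightarrow> \<theta> (f + g) = \<theta> f + \<theta> g"
  and Der_Const_mult: "f \<in> poly_ring l \<Longrightarrow> \<theta> (Const c * f) = Const c * \<theta> f"
  and Der_mult: "f \<in> poly_ring l \<Longrightarrow> g \<in> poly_ring l \<Longrightarrow> \<theta> (f * g) = \<theta> f * g + f * \<theta> g"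
  and Der_undefined: "f \<notin> poly_ring l \<Longrightarrow> \<theta> f = undefined"
  using \<theta> by (auto simp: Der_def PiE_iff extensional_def)

lemma Der_Const: "\<theta> (Const c) = 0"
proof -
  have "\<theta> 1 = 0" using Der_mult[of 1 1] by simp
  then show ?thesis using Der_Const_mult[of 1 c] by simp
qed

lemma Der_expand: "f \<in> poly_ring l \<Longrightarrow> \<theta> f = (\<Sum>i\<in>{0..l}. \<theta> (Var i) * partial i f)"
proof (induction f rule: poly_ring_induct)
  case (Var i)
  then show ?case
    by (simp add: partial_Var if_distrib[of "\<lambda>x. _ * x"] sum.delta cong: if_cong)
next
  case (mult f g)
  then show ?case
    by (simp add: Der_mult partial_mult sum_distrib_left sum_distrib_right distrib_left sum.distrib mult_ac)
qed (simp_all add: Der_Const Der_add partial_add distrib_left sum.distrib)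

lemma Der_form:
  assumes "(s, t, e, d) \<in> forms l"
  shows "\<theta> (form s t e d) = \<theta> (Var s) + Const e * \<theta> (Var t) - Const d * \<theta> (Var 0)"
proof -
  have st: "s \<le> l" "t \<le> l" using assms by (auto simp: mem_forms)
  have "form s t e d = Var s + (Const e * Var t + Const (- d) * Var 0)"
    by (simp add: form_def Const.hom_uminus)
  then have "\<theta> (form s t e d) = \<theta> (Var s) + (Const e * \<theta> (Var t) + Const (- d) * \<theta> (Var 0))"
    using st by (simp add: Der_add Der_Const_mult poly_ring_add poly_ring_mult)
  then show ?thesis by (simp add: Const.hom_uminus)
qed

end

section \<open>The arrangement\<close>

definition form_vec :: "nat \<Rightarrow> nat \<Rightarrow> real \<Rightarrow> real \<Rightarrow> nat \<Rightarrow> real" where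
  "form_vec s t e d i = (if i = s then 1 else if i = t then e else if i = 0 then - d else 0)"

definition z_vec :: "nat \<Rightarrow> real" where
  "z_vec i = (if i = 0 then 1 else 0)"

lemma sum_form_vec:
  fixes v :: "nat \<Rightarrow> 'a::comm_ring_1"
  assumes "(s, t, e, d) \<in> forms l" and g0: "g 0 = 0"
  shows "(\<Sum>i\<in>{0..l}. g (form_vec s t e d i) * v i) = g 1 * v s + g e * v t + g (- d) * v 0"
proof -
  have st: "1 \<le> s" "s < t" "t \<le> l" using assms by (auto simp: mem_forms)
  have "(\<Sum>i\<in>{0..l}. g (form_vec s t e d i) * v i) = (\<Sum>i\<in>{s, t, 0}. g (form_vec s t e d i) * v i)"
    by (rule sum.mono_neutral_right) (use st g0 in \<open>auto simp: form_vec_def\<close>)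
  also have "\<dots> = g 1 * v s + g e * v t + g (- d) * v 0"
    using st by (simp add: form_vec_def add.assoc)
  finally show ?thesis .
qed

lemma sum_z_vec:
  fixes v :: "nat \<Rightarrow> 'a::comm_ring_1"
  assumes g0: "g 0 = 0"
  shows "(\<Sum>i\<in>{0..l}. g (z_vec i) * v i) = g 1 * v 0"
proof -
  have "(\<Sum>i\<in>{0..l}. g (z_vec i) * v i) = (\<Sum>i\<in>{0}. g (z_vec i) * v i)"
    by (rule sum.mono_neutral_right) (use g0 in \<open>auto simp: z_vec_def\<close>)
  then show ?thesis by (simp add: z_vec_def)
qed

lemma linear_form_form_vec: "(s, t, e, d) \<in> forms l \<Longrightarrow> linear_form l (form_vec s t e d) = form s t e d"
  by (simp add: linear_form_def sum_form_vec form_def Const.hom_uminus)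

lemma linear_form_z_vec: "linear_form l z_vec = Var 0"
  by (simp add: linear_form_def sum_z_vec)

lemma cone_shi_D_eq:
  "cone_shi_D l = insert (hyperplane l z_vec) {hyperplane l (form_vec s t e d) | s t e d. (s, t, e, d) \<in> forms l}"
proof -
  have z: "hyperplane l z_vec = {v \<in> pt_space l. v 0 = 0}"
    using sum_z_vec[of "\<lambda>x::real. x"] by (simp add: hyperplane_def)
  have f: "hyperplane l (form_vec s t e d) = {v \<in> pt_space l. v s + e * v t - d * v 0 = 0}"
    if "(s, t, e, d) \<in> forms l" for s t e d
    using sum_form_vec[OF that, of "\<lambda>x::real. x"] by (simp add: hyperplane_def)
  show ?thesis
  proof (intro equalityI subsetI)
    fix X assume "X \<in> cone_shi_D l"
    then consider "X = {v \<in> pt_space l. v 0 = 0}"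
      | s t e where "X = {v \<in> pt_space l. v s + e * v t = 0}" "1 \<le> s" "s < t" "t \<le> l" "e \<in> {-1, 1}"
      | s t e where "X = {v \<in> pt_space l. v s + e * v t - v 0 = 0}" "1 \<le> s" "s < t" "t \<le> l" "e \<in> {-1, 1}"
      unfolding cone_shi_D_def by blast
    then show "X \<in> insert (hyperplane l z_vec) {hyperplane l (form_vec s t e d) | s t e d. (s, t, e, d) \<in> forms l}"
    proof cases
      case 1
      then show ?thesis by (simp add: z)
    next
      case (2 s t e)
      then have m: "(s, t, e, 0) \<in> forms l" by (simp add: mem_forms)
      with f[OF m] 2(1) have "X = hyperplane l (form_vec s t e 0)" by simp
      with m show ?thesis by blast
    next
      case (3 s t e)
      then have m: "(s, t, e, 1) \<in> forms l" by (simp add: mem_forms)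
      with f[OF m] 3(1) have "X = hyperplane l (form_vec s t e 1)" by simp
      with m show ?thesis by blast
    qed
  next
    fix X assume "X \<in> insert (hyperplane l z_vec) {hyperplane l (form_vec s t e d) | s t e d. (s, t, e, d) \<in> forms l}"
    then consider "X = hyperplane l z_vec" | s t e d where "X = hyperplane l (form_vec s t e d)" "(s, t, e, d) \<in> forms l"
      by blast
    then show "X \<in> cone_shi_D l"
    proof cases
      case 1
      then show ?thesis unfolding cone_shi_D_def z by blast
    next
      case (2 s t e d)
      then have st: "1 \<le> s" "s < t" "t \<le> l" "e \<in> {-1, 1}" and d: "d = 0 \<or> d = 1" by (auto simp: mem_forms)
      from d show ?thesis
      proof
        assume "d = 0"
        with 2 f have "X = {v \<in> pt_space l. v s + e * v t = 0}" by simp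
        with st show ?thesis unfolding cone_shi_D_def by blast
      next
        assume "d = 1"
        with 2 f have "X = {v \<in> pt_space l. v s + e * v t - v 0 = 0}" by simp
        with st show ?thesis unfolding cone_shi_D_def by blast
      qed
    qed
  qed
qed

text \<open>Test the inclusion on the vectors with \<open>1\<close> in position \<open>i\<close> and \<open>- b i\<close> in position \<open>r\<close>.\<close>

lemma hyperplane_subset_imp_multiple:
  assumes r: "r \<le> l" "b r = 1" and sub: "hyperplane l b \<subseteq> hyperplane l a" and i: "i \<le> l"
  shows "a i = a r * b i"
proof (cases "i = r")
  case False
  define v where "v = (\<lambda>k\<in>{0..l}. if k = r then - b i else if k = i then 1 else 0)"
  have sum_v: "(\<Sum>k\<in>{0..l}. c k * v k) = c i - c r * b i" for c
  proof -
    have "(\<Sum>k\<in>{0..l}. c k * v k) = (\<Sum>k\<in>{r, i}. c k * v k)"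
      by (rule sum.mono_neutral_right) (use r i in \<open>auto simp: v_def\<close>)
    then show ?thesis using False r i by (simp add: v_def)
  qed
  have "v \<in> hyperplane l b"
    unfolding hyperplane_def pt_space_def by (simp add: sum_v r) (simp add: v_def)
  with sub have "v \<in> hyperplane l a" by blast
  then have "(\<Sum>k\<in>{0..l}. a k * v k) = 0" by (simp add: hyperplane_def)
  then show ?thesis by (simp add: sum_v)
qed (use r in simp)

lemma linear_form_multiple:
  assumes "r \<le> l" "b r = 1" "hyperplane l b \<subseteq> hyperplane l a"
  shows "linear_form l a = Const (a r) * linear_form l b"
  unfolding linear_form_def sum_distrib_left
  by (rule sum.cong) (auto simp: hyperplane_subset_imp_multiple[OF assms] Const.hom_mult mult.assoc)

lemma linear_form_in_poly_ring: "linear_form l a \<in> poly_ring l"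
  unfolding linear_form_def by (auto intro!: poly_ring_sum poly_ring_mult)

text \<open>All defining forms of a hyperplane are scalar multiples of one that has a coefficient one, so
  it suffices to test this one.\<close>

lemma log_derivations_cone_iff:
  "\<theta> \<in> log_derivations l (cone_shi_D l) \<longleftrightarrow> \<theta> \<in> Der l \<and>
     (\<exists>g\<in>poly_ring l. \<theta> (Var 0) = Var 0 * g) \<and>
     (\<forall>s t e d. (s, t, e, d) \<in> forms l \<longrightarrow> (\<exists>g\<in>poly_ring l. \<theta> (form s t e d) = form s t e d * g))"
  (is "?L \<longleftrightarrow> ?R")
proof
  assume L: ?L
  have *: "\<exists>g\<in>poly_ring l. \<theta> (linear_form l a) = linear_form l a * g"
    if "r \<le> l" "a r = 1" "hyperplane l a \<in> cone_shi_D l" for a r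
  proof -
    have "\<exists>i\<in>{0..l}. a i \<noteq> 0" using that by (intro bexI[of _ r]) auto
    with L that(3) show ?thesis unfolding log_derivations_def by blast
  qed
  show ?R
  proof (intro conjI allI impI)
    show "\<theta> \<in> Der l" using L by (simp add: log_derivations_def)
    show "\<exists>g\<in>poly_ring l. \<theta> (Var 0) = Var 0 * g"
      using *[of 0 z_vec] by (simp add: linear_form_z_vec z_vec_def cone_shi_D_eq)
    fix s t e d assume H: "(s, t, e, d) \<in> forms l"
    then have "hyperplane l (form_vec s t e d) \<in> cone_shi_D l" unfolding cone_shi_D_eq by blast
    moreover have "s \<le> l" "form_vec s t e d s = 1" using H by (auto simp: mem_forms form_vec_def)
    ultimately show "\<exists>g\<in>poly_ring l. \<theta> (form s t e d) = form s t e d * g"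
      using *[of s "form_vec s t e d"] by (simp add: linear_form_form_vec[OF H])
  qed
next
  assume R: ?R
  then have D: "\<theta> \<in> Der l" by simp
  have multiple: "\<exists>g\<in>poly_ring l. \<theta> (linear_form l a) = linear_form l a * g"
    if "r \<le> l" "b r = 1" "hyperplane l a = hyperplane l b" "g \<in> poly_ring l" "\<theta> (linear_form l b) = linear_form l b * g" for a b r g
  proof -
    have "linear_form l a = Const (a r) * linear_form l b"
      by (rule linear_form_multiple[where b = b]) (simp_all add: that)
    then have "\<theta> (linear_form l a) = linear_form l a * g"
      using that by (simp add: Der_Const_mult[OF D] linear_form_in_poly_ring mult.assoc)
    with that show ?thesis by blast
  qed
  show ?L
    unfolding log_derivations_def
  proof (intro CollectI conjI D allI impI)
    fix a assume "(\<exists>i\<in>{0..l}. a i \<noteq> 0) \<and> hyperplane l a \<in> cone_shi_D l"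
    then consider "hyperplane l a = hyperplane l z_vec"
      | s t e d where "hyperplane l a = hyperplane l (form_vec s t e d)" "(s, t, e, d) \<in> forms l"
      unfolding cone_shi_D_eq by blast
    then show "\<exists>g\<in>poly_ring l. \<theta> (linear_form l a) = linear_form l a * g"
    proof cases
      case 1
      from R obtain g where "g \<in> poly_ring l" "\<theta> (Var 0) = Var 0 * g" by blast
      then show ?thesis
        by (intro multiple[of 0 z_vec, OF _ _ 1]) (simp_all add: linear_form_z_vec z_vec_def)
    next
      case (2 s t e d)
      from R 2(2) obtain g where "g \<in> poly_ring l" "\<theta> (form s t e d) = form s t e d * g" by blast
      moreover have "s \<le> l" "form_vec s t e d s = 1" using 2(2) by (auto simp: mem_forms form_vec_def)
      ultimately show ?thesis
        using multiple[of s "form_vec s t e d", OF _ _ 2(1)] by (simp add: linear_form_form_vec[OF 2(2)])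
    qed
  qed
qed

lemma form_in_poly_ring: "(s, t, e, d) \<in> forms l \<Longrightarrow> form s t e d \<in> poly_ring l"
  by (metis linear_form_form_vec linear_form_in_poly_ring)

lemma euler_log: "euler l \<in> log_derivations l (cone_shi_D l)"
proof -
  have D: "euler l \<in> Der l" unfolding euler_eq by (rule deriv_of_in_Der) simp
  have V: "euler l (Var i) = Var i" if "i \<le> l" for i using that by (simp add: euler_eq deriv_of_Var)
  have "euler l (form s t e d) = form s t e d * 1" if "(s, t, e, d) \<in> forms l" for s t e d
  proof -
    have "s \<le> l" "t \<le> l" using that by (auto simp: mem_forms)
    then show ?thesis unfolding Der_form[OF D that] by (simp add: V form_def)
  qed
  moreover have "euler l (Var 0) = Var 0 * 1" by (simp add: V)
  ultimately show ?thesis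
    unfolding log_derivations_cone_iff using D poly_ring_1 by blast
qed

text \<open>As \<open>\<phi>\<^sub>j\<close> kills \<open>z\<close>, its value on a form is the combination of two coefficients treated in
  \<open>form_dvd_phi_poly\<close>.\<close>

lemma phi_log:
  assumes j: "1 \<le> j" "j \<le> l"
  shows "phi l j \<in> log_derivations l (cone_shi_D l)"
proof -
  have D: "phi l j \<in> Der l"
    unfolding phi_eq[OF j] by (rule deriv_of_in_Der) (simp add: phi_poly_in_poly_ring[OF j])
  have V: "phi l j (Var i) = (if i = 0 then 0 else phi_poly l j i)" if "i \<le> l" for i
    using that by (simp add: phi_eq[OF j] deriv_of_Var)
  have "\<exists>g\<in>poly_ring l. phi l j (form s t e d) = form s t e d * g" if H: "(s, t, e, d) \<in> forms l" for s t e d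
  proof -
    have st: "1 \<le> s" "s < t" "t \<le> l" "e \<in> {-1, 1}" "d \<in> {0, 1}" using H by (simp_all add: mem_forms)
    then have eq: "phi l j (form s t e d) = phi_poly l j s + Const e * phi_poly l j t"
      unfolding Der_form[OF D H] by (simp add: V)
    obtain g where g: "phi l j (form s t e d) = form s t e d * g"
      using form_dvd_phi_poly[OF j st] unfolding eq by (elim dvdE)
    moreover have "phi l j (form s t e d) \<in> poly_ring l"
      by (rule Der_in[OF D form_in_poly_ring[OF H]])
    ultimately have "g \<in> poly_ring l"
      using poly_ring_cancel[OF _ form_in_poly_ring[OF H] form_neq_0[OF H]] by simp
    with g show ?thesis by blast
  qed
  moreover have "phi l j (Var 0) = Var 0 * 0" by (simp add: V)
  ultimately show ?thesis
    unfolding log_derivations_cone_iff using D poly_ring_0 by blast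
qed

lemma lin_comb_eq:
  assumes f: "f \<in> poly_ring l"
  shows "lin_comb l {0..l} c (\<lambda>j. if j = 0 then euler l else phi l j) f =
    c 0 * Var 0 * partial 0 f + (\<Sum>i\<in>{1..l}. (c 0 * Var i + (\<Sum>j\<in>{1..l}. c j * phi_poly l j i)) * partial i f)"
proof -
  have I: "{0..l} = insert 0 {1..l}" by auto
  have phi: "phi l j f = (\<Sum>i\<in>{1..l}. phi_poly l j i * partial i f)" if "j \<in> {1..l}" for j
    using that f by (simp add: phi_eq deriv_of_def I)
  have "lin_comb l {0..l} c (\<lambda>j. if j = 0 then euler l else phi l j) f =
      c 0 * euler l f + (\<Sum>j\<in>{1..l}. c j * phi l j f)"
    using f by (simp add: lin_comb_def I)
  also have "(\<Sum>j\<in>{1..l}. c j * phi l j f) = (\<Sum>j\<in>{1..l}. \<Sum>i\<in>{1..l}. c j * (phi_poly l j i * partial i f))"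
    by (rule sum.cong) (simp_all add: phi sum_distrib_left)
  also have "\<dots> = (\<Sum>i\<in>{1..l}. \<Sum>j\<in>{1..l}. c j * (phi_poly l j i * partial i f))"
    by (rule sum.swap)
  also have "c 0 * euler l f = c 0 * Var 0 * partial 0 f + (\<Sum>i\<in>{1..l}. c 0 * Var i * partial i f)"
    using f by (simp add: euler_def distrib_left sum_distrib_left mult.assoc)
  finally show ?thesis
    by (simp add: distrib_right sum.distrib sum_distrib_right mult.assoc)
qed

lemma coeff_mat_mult_vec:
  assumes "c \<in> carrier_vec l" "1 \<le> i" "i \<le> l"
  shows "(coeff_mat l *\<^sub>v c) $ (i - 1) = (\<Sum>j\<in>{1..l}. c $ (j - 1) * phi_poly l j i)"
  using assms by (simp add: coeff_mat_def scalar_prod_def sum.atLeast1_atMost_eq atLeast0LessThan mult.commute)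

theorem theorem2p4:
  fixes l :: nat
  assumes "l \<ge> 2"
  shows "(\<forall>j\<in>{1..l}. \<forall>i\<in>{1..l}. phi_coeff l j i \<in> to_fract ` poly_ring l) \<and>
    is_basis l (log_derivations l (cone_shi_D l)) {0..l}
      (\<lambda>j. if j = 0 then euler l else phi l j)"
  unfolding is_basis_def
proof (intro conjI ballI impI)
  fix j i assume "j \<in> {1..l}" "i \<in> {1..l}"
  then show "phi_coeff l j i \<in> to_fract ` poly_ring l"
    by (auto simp: phi_poly_in_poly_ring simp flip: to_fract_phi_poly)
next
  show "finite {0..l}" by simp
next
  show "(\<lambda>j. if j = 0 then euler l else phi l j) ` {0..l} \<subseteq> log_derivations l (cone_shi_D l)"
    using euler_log phi_log by auto
next
  fix \<theta> assume \<theta>: "\<theta> \<in> log_derivations l (cone_shi_D l)"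
  then have D: "\<theta> \<in> Der l" by (simp add: log_derivations_def)
  from \<theta> obtain g where g: "g \<in> poly_ring l" "\<theta> (Var 0) = Var 0 * g"
    unfolding log_derivations_cone_iff by blast
  \<comment> \<open>the \<open>x\<close>-coefficients of \<open>\<theta> - g \<theta>\<^sub>E\<close>, a logarithmic derivation that kills \<open>z\<close>\<close>
  define b where "b = vec l (\<lambda>i. \<theta> (Var (Suc i)) - g * Var (Suc i))"
  have bi: "b $ (i - 1) = \<theta> (Var i) - g * Var i" if "1 \<le> i" "i \<le> l" for i
    using that by (cases i) (simp_all add: b_def)
  have "\<exists>c\<in>carrier_vec l. (\<forall>k<l. c $ k \<in> poly_ring l) \<and> coeff_mat l *\<^sub>v c = b"
  proof (rule coeff_mat_solvable)
    show "b \<in> carrier_vec l" by (simp add: b_def)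
    show "b $ i \<in> poly_ring l" if "i < l" for i
      using that g by (simp add: b_def poly_ring_diff poly_ring_mult Der_in[OF D])
    fix s t e d assume H: "(s, t, e, d) \<in> forms l"
    with \<theta> obtain k where k: "\<theta> (form s t e d) = form s t e d * k"
      unfolding log_derivations_cone_iff by blast
    have st: "1 \<le> s" "s \<le> l" "1 \<le> t" "t \<le> l" using H by (auto simp: mem_forms)
    have "b $ (s - 1) + Const e * b $ (t - 1) = form s t e d * (k - g)"
      using k unfolding Der_form[OF D H] g(2) bi[OF st(1,2)] bi[OF st(3,4)]
      by (simp add: form_def algebra_simps)
    then show "form s t e d dvd b $ (s - 1) + Const e * b $ (t - 1)" by simp
  qed
  then obtain c where c: "c \<in> carrier_vec l" "\<And>k. k < l \<Longrightarrow> c $ k \<in> poly_ring l" "coeff_mat l *\<^sub>v c = b"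
    by blast
  define C where "C j = (if j = 0 then g else c $ (j - 1))" for j
  have "\<theta> = lin_comb l {0..l} C (\<lambda>j. if j = 0 then euler l else phi l j)"
  proof
    fix f
    show "\<theta> f = lin_comb l {0..l} C (\<lambda>j. if j = 0 then euler l else phi l j) f"
    proof (cases "f \<in> poly_ring l")
      case True
      have coord: "C 0 * Var i + (\<Sum>j\<in>{1..l}. C j * phi_poly l j i) = \<theta> (Var i)" if "i \<in> {1..l}" for i
      proof -
        have "(\<Sum>j\<in>{1..l}. C j * phi_poly l j i) = (\<Sum>j\<in>{1..l}. c $ (j - 1) * phi_poly l j i)"
          by (rule sum.cong) (auto simp: C_def)
        also have "\<dots> = b $ (i - 1)"
          using coeff_mat_mult_vec[OF c(1), of i] that c(3) by simp
        also have "\<dots> = \<theta> (Var i) - g * Var i" using that by (intro bi) auto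
        finally show ?thesis by (simp add: C_def)
      qed
      have "{0..l} = insert 0 {1..l}" by auto
      then have "\<theta> f = C 0 * Var 0 * partial 0 f + (\<Sum>i\<in>{1..l}. \<theta> (Var i) * partial i f)"
        using Der_expand[OF D True] by (simp add: g(2) C_def mult_ac)
      moreover have "(\<Sum>i\<in>{1..l}. \<theta> (Var i) * partial i f) =
          (\<Sum>i\<in>{1..l}. (C 0 * Var i + (\<Sum>j\<in>{1..l}. C j * phi_poly l j i)) * partial i f)"
        by (rule sum.cong) (simp_all only: coord)
      ultimately show ?thesis unfolding lin_comb_eq[OF True] by (simp only:)
    qed (simp add: Der_undefined[OF D] lin_comb_def)
  qed
  moreover have "C \<in> {0..l} \<rightarrow> poly_ring l" using g(1) c(2) by (auto simp: C_def)
  ultimately show "\<exists>c\<in>{0..l} \<rightarrow> poly_ring l. \<theta> = lin_comb l {0..l} c (\<lambda>j. if j = 0 then euler l else phi l j)"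
    by blast
next
  fix c i
  assume lc: "lin_comb l {0..l} c (\<lambda>j. if j = 0 then euler l else phi l j) = (\<lambda>f\<in>poly_ring l. 0)"
    and i: "i \<in> {0..l}"
  \<comment> \<open>evaluate the relation at \<open>z\<close>, which only the Euler derivation does not kill, and then at the \<open>x\<^sub>i\<close>\<close>
  have at_Var: "lin_comb l {0..l} c (\<lambda>j. if j = 0 then euler l else phi l j) (Var i) = 0" if "i \<le> l" for i
    using that by (simp add: lc)
  have "c 0 * Var 0 = 0"
    using at_Var[of 0] by (simp add: lin_comb_eq partial_Var)
  then have c0: "c 0 = 0" by simp
  define v where "v = vec l (\<lambda>k. c (Suc k))"
  have v: "v \<in> carrier_vec l" by (simp add: v_def)
  have "coeff_mat l *\<^sub>v v = 0\<^sub>v l"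
  proof (rule eq_vecI)
    fix k assume "k < dim_vec (0\<^sub>v l :: mpoly vec)"
    then have k: "k < l" by simp
    have "(coeff_mat l *\<^sub>v v) $ (Suc k - 1) = (\<Sum>j\<in>{1..l}. v $ (j - 1) * phi_poly l j (Suc k))"
      using k by (intro coeff_mat_mult_vec[OF v]) auto
    also have "\<dots> = (\<Sum>j\<in>{1..l}. c j * phi_poly l j (Suc k))"
      by (rule sum.cong) (auto simp: v_def)
    also have "\<dots> = 0"
      using at_Var[of "Suc k"] k
      by (simp add: lin_comb_eq partial_Var c0 if_distrib[of "\<lambda>x. _ * x"] sum.delta cong: if_cong)
    finally show "(coeff_mat l *\<^sub>v v) $ k = 0\<^sub>v l $ k" using k by simp
  qed (simp add: coeff_mat_def)
  then have "v = 0\<^sub>v l" by (rule coeff_mat_injective[OF v])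
  show "c i = 0"
  proof (cases "i = 0")
    case False
    then have "c i = v $ (i - 1)" using i by (cases i) (simp_all add: v_def)
    with \<open>v = 0\<^sub>v l\<close> i False show ?thesis by simp
  qed (simp add: c0)
qed

end
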